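(* Let $N\ge1$, $\ell\in\{1,2,\dots\}$, $0<\ell<d$, $\{a_\alpha\}_{|\alpha|=\ell}\subset\mathbb{R}$, and $p>1$. Consider the Cauchy problem $$\partial_tu+(-\Delta)^{\frac d2}u=\sum_{|\alpha|=\ell}a_\alpha\partial_x^\alpha\bigl(|u|^{p-1}u\bigr)\ \text{ in }\mathbb{R}^N\times(0,\infty),\qquad u(\cdot,0)=\phi\ \text{ in }\mathbb{R}^N,$$ with $\phi$ locally integrable on $\mathbb{R}^N$ (solutions being understood as in the context). Then there exists $\gamma>0$ such that, if $$\sup_{x\in\mathbb{R}^N}\sup_{0<\sigma<T^{1/d}}\sigma^{\frac{d-\ell}{p-1}}\frac1{|B(x,\sigma)|}\int_{B(x,\sigma)}|\phi(y)|\,dy\le\gamma$$ for some $T\in(0,\infty]$, then the problem possesses a solution in $\mathbb{R}^N\times[0,T)$.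
   Context: $B(x,\sigma)$ is the open ball of centre $x$ and radius $\sigma$; $T^{1/d}=\infty$ if $T=\infty$; $\alpha$ ranges over multi-indices in $(\mathbb{N}\cup\{0\})^N$ of order $|\alpha|=\ell$. Let $G_d(x,t)=(2\pi)^{-N}\int_{\mathbb{R}^N}e^{ix\cdot\xi}e^{-t|\xi|^d}\,d\xi$ be the fundamental solution of $\partial_tu+(-\Delta)^{d/2}u=0$ in $\mathbb{R}^N\times(0,\infty)$. For $0<T\le\infty$, a solution of the Cauchy problem in $\mathbb{R}^N\times[0,T)$ is a function $u$ that is bounded and continuous on $\mathbb{R}^N\times(\tau,T)$ for every $\tau\in(0,T)$ and satisfies $$u(x,t)=\int_{\mathbb{R}^N}G_d(x-y,t)\phi(y)\,dy+\sum_{|\alpha|=\ell}a_\alpha\int_0^t\int_{\mathbb{R}^N}\partial_x^\alpha G_d(x-y,t-s)\,|u(y,s)|^{p-1}u(y,s)\,dy\,ds$$ for all $(x,t)\in\mathbb{R}^N\times(0,T)$. *)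

theory Defs
  imports "HOL-Analysis.Analysis"
begin

definition heat_kernel_integral :: "real \<Rightarrow> real ^ 'n \<Rightarrow> real \<Rightarrow> complex" where
  "heat_kernel_integral d x t =
     (LINT \<xi>|lborel. exp (\<i> * complex_of_real (x \<bullet> \<xi>)) *
                     complex_of_real (exp (- t * (norm \<xi> powr d))))"

lemma heat_kernel_integral_real:
  fixes x :: "real ^ 'n"
  shows "Im (heat_kernel_integral d x t) = 0"
proof -
  let ?f = "\<lambda>\<xi>::real^'n. exp (\<i> * complex_of_real (x \<bullet> \<xi>)) *
                     complex_of_real (exp (- t * (norm \<xi> powr d)))"
  have c: "cnj (?f \<xi>) = ?f (- \<xi>)" for \<xi>
    by (simp add: exp_cnj)
  have "cnj (heat_kernel_integral d x t) = (LINT \<xi>|lborel. cnj (?f \<xi>))"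
    unfolding heat_kernel_integral_def by (rule Bochner_Integration.integral_cnj[symmetric])
  also have "\<dots> = (LINT \<xi>|lborel. ?f (- \<xi>))"
    unfolding c by simp
  also have "\<dots> = (LINT \<xi>|distr lborel borel uminus. ?f \<xi>)"
    by (rule integral_distr[symmetric]) auto
  also have "\<dots> = heat_kernel_integral d x t"
    using lborel_affine[of "-1" "0 :: real ^ 'n"] by (simp add: density_1 heat_kernel_integral_def)
  finally show ?thesis
    by (metis Reals_cnj_iff complex_is_Real_iff)
qed

text \<open>
  The Fourier integral is real by the preceding lemma, so taking its real part only changes the type.
\<close>

definition heat_kernel :: "real \<Rightarrow> real ^ 'n \<Rightarrow> real \<Rightarrow> real" where
  "heat_kernel d x t = Re (heat_kernel_integral d x t) / (2 * pi) ^ CARD('n)"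

definition partial_deriv :: "'n \<Rightarrow> (real ^ 'n \<Rightarrow> real) \<Rightarrow> real ^ 'n \<Rightarrow> real" where
  "partial_deriv i f x = deriv (\<lambda>h. f (x + h *\<^sub>R axis i 1)) 0"

text \<open>
  A multi-index is a function \<^term>\<open>\<alpha> :: 'n \<Rightarrow> nat\<close>. The coordinates are processed in an arbitrary
  fixed enumeration of the index type; for functions that are smooth in space, such as the kernel
  at positive times, the result does not depend on the enumeration.
\<close>

definition multi_deriv :: "('n \<Rightarrow> nat) \<Rightarrow> (real ^ 'n \<Rightarrow> real) \<Rightarrow> real ^ 'n \<Rightarrow> real" where
  "multi_deriv \<alpha> f =
     foldr (\<lambda>i. partial_deriv i ^^ \<alpha> i) (SOME is. distinct is \<and> set is = (UNIV :: 'n set)) f"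

definition multi_indices :: "nat \<Rightarrow> ('n::finite \<Rightarrow> nat) set" where
  "multi_indices l = {\<alpha>. (\<Sum>i\<in>UNIV. \<alpha> i) = l}"

lemma finite_multi_indices: "finite (multi_indices l :: ('n::finite \<Rightarrow> nat) set)"
proof (rule finite_subset)
  have "\<alpha> i \<le> (\<Sum>i\<in>UNIV. \<alpha> i)" for \<alpha> :: "'n \<Rightarrow> nat" and i
    by (simp add: member_le_sum)
  then show "(multi_indices l :: ('n \<Rightarrow> nat) set) \<subseteq> PiE UNIV (\<lambda>_. {..l})"
    by (auto simp: multi_indices_def)
  show "finite (PiE (UNIV :: 'n set) (\<lambda>_. {..l}))"
    by (intro finite_PiE) auto
qed

definition locally_integrable :: "(real ^ 'n \<Rightarrow> real) \<Rightarrow> bool" where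
  "locally_integrable f \<longleftrightarrow> (\<forall>K. compact K \<longrightarrow> set_integrable lebesgue K f)"

definition time_root :: "real \<Rightarrow> ereal \<Rightarrow> ereal" where
  "time_root d T = (if T = \<infinity> then \<infinity> else ereal (real_of_ereal T powr (1 / d)))"

definition morrey_sup :: "real \<Rightarrow> nat \<Rightarrow> real \<Rightarrow> ereal \<Rightarrow> (real ^ 'n \<Rightarrow> real) \<Rightarrow> ereal" where
  "morrey_sup d l p T \<phi> =
     (SUP x. SUP \<sigma>\<in>{\<sigma>::real. 0 < \<sigma> \<and> ereal \<sigma> < time_root d T}.
        ereal (\<sigma> powr ((d - real l) / (p - 1)) *
               ((LINT y:ball x \<sigma>|lebesgue. \<bar>\<phi> y\<bar>) / measure lebesgue (ball x \<sigma>))))"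

definition power_nonlinearity :: "real \<Rightarrow> real \<Rightarrow> real" where
  "power_nonlinearity p v = \<bar>v\<bar> powr (p - 1) * v"

text \<open>
  The Bochner integral is \<^term>\<open>0::real\<close> for non-integrable functions, so the absolute
  convergence of all integrals in Duhamel's formula is required explicitly. The values of
  \<^term>\<open>u x t\<close> for times outside the open interval from \<^term>\<open>0::real\<close> to \<^term>\<open>T :: ereal\<close>
  are irrelevant.
\<close>

definition is_solution ::
  "real \<Rightarrow> nat \<Rightarrow> (('n::finite \<Rightarrow> nat) \<Rightarrow> real) \<Rightarrow> real \<Rightarrow> (real ^ 'n \<Rightarrow> real) \<Rightarrow> ereal \<Rightarrow>
   (real ^ 'n \<Rightarrow> real \<Rightarrow> real) \<Rightarrow> bool" where
  "is_solution d l a p \<phi> T u \<longleftrightarrow>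
     (\<forall>\<tau>::real. 0 < \<tau> \<and> ereal \<tau> < T \<longrightarrow>
        bounded ((\<lambda>(x, t). u x t) ` (UNIV \<times> {t. \<tau> < t \<and> ereal t < T})) \<and>
        continuous_on (UNIV \<times> {t. \<tau> < t \<and> ereal t < T}) (\<lambda>(x, t). u x t)) \<and>
     (\<forall>x. \<forall>t::real. 0 < t \<and> ereal t < T \<longrightarrow>
        integrable lebesgue (\<lambda>y. heat_kernel d (x - y) t * \<phi> y) \<and>
        (\<forall>\<alpha>\<in>multi_indices l.
           set_integrable lborel (UNIV \<times> {0<..<t})
             (\<lambda>(y, s). multi_deriv \<alpha> (\<lambda>z. heat_kernel d z (t - s)) (x - y) *
                       power_nonlinearity p (u y s))) \<and>
        u x t =
          (LINT y|lebesgue. heat_kernel d (x - y) t * \<phi> y) +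
          (\<Sum>\<alpha>\<in>multi_indices l. a \<alpha> *
             (LINT s:{0<..<t}|lborel. LINT y|lborel.
                multi_deriv \<alpha> (\<lambda>z. heat_kernel d z (t - s)) (x - y) *
                power_nonlinearity p (u y s))))"

end

theory Submission
  imports Defs "HOL-Real_Asymp.Real_Asymp"
begin

text \<open>
  Let \<open>K\<^sub>a(x) = a / (a + |x|)\<^bsup>N+1\<^esup>\<close>. Up to constants these kernels form a convolution semigroup in \<open>a\<close>, like
  the Poisson kernel, and \<open>|\<partial>\<^sup>\<alpha>G(x,t)| \<le> C t\<^bsup>-|\<alpha>|/d\<^esup> K\<^sub>r(x)\<close> with \<open>r = t\<^bsup>1/d\<^esup>\<close>; the decay rate
  \<open>N + 1\<close> comes from integrating the Fourier integral by parts \<open>N + 1\<close> times, which \<open>d > 1\<close> permits.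
  Hence \<open>w(x,t) = (K\<^sub>r * |\<phi>|)(x)\<close> satisfies \<open>K\<^bsub>(t-s)^(1/d)\<^esub> * w(s) \<le> C w(t)\<close>, and averaging
  over balls of radius \<open>r\<close> turns the hypothesis on \<open>\<phi>\<close> into \<open>w \<le> C \<gamma> t\<^bsup>-\<kappa>\<^esup>\<close>
  with \<open>\<kappa> = (d - l) / (d (p - 1))\<close>. If \<open>|u| \<le> M w\<close>, then
  \<open>|u|\<^sup>p \<le> M\<^sup>p (C \<gamma>)\<^bsup>p-1\<^esup> s\<^bsup>l/d-1\<^esup> w\<close>, and the remaining time integral of
  \<open>(t - s)\<^bsup>-l/d\<^esup> s\<^bsup>l/d-1\<^esup>\<close> is a Beta integral independent of \<open>t\<close>. So for small \<open>\<gamma>\<close> the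
  Duhamel map is a contraction with respect to the weight \<open>w\<close>, for every \<open>p > 1\<close>.
\<close>

section \<open>The majorant kernel\<close>

text \<open>The obstacle is small p. The bound |u| \<le> M t^(-\<kappa>) alone gives a source of
  size s^(-\<kappa> p) with \<kappa> p = \<kappa> + 1 - l/d, which is integrable at s = 0 only for p
  > d/l. Hence only p - 1 of the p factors of w are estimated by the supremum; the last one is kept
  as a function of x, and the convolution with the kernel reproduces it. This asks three things of
  the majorant: convolutions close up, scales that differ by a bounded factor are comparable, and a
  translation by at most the scale costs a constant. The kernel bound is the other difficulty:
  |\<xi>|^d is in general not smooth at the origin, so the N + 1 integrations by parts are made on a
  regularized symbol, with bounds that do not depend on the regularization, and the limit is taken
  in the final inequality. The bound is shown at t = 1 and transported by scaling. Size estimates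
  use nonnegative integrals, where Fubini needs no integrability; for this the datum is replaced by
  a Borel representative.\<close>

lemma ennreal_le_suminf:
  fixes f :: "nat \<Rightarrow> ennreal"
  shows "f k \<le> (\<Sum>i. f i)"
  using sum_le_suminf[of f "{k}"] by simp

text \<open>Each value of \<open>g\<close> is at most one term of a series of ball indicators, hence
  at most its sum, which integrates term by term to the unit ball volume times the sum of c_k r_k^N.
  Growing balls measure decay at infinity, shrinking ones a singularity at the origin.\<close>

lemma nn_integral_le_dyadic:
  fixes g :: "'a::euclidean_space \<Rightarrow> ennreal"
  assumes "\<And>x. \<exists>k. g x \<le> ennreal (c k) * indicator (ball 0 (r k)) x"
    and "\<And>k. 0 \<le> c k" "\<And>k. 0 \<le> r k" and "summable (\<lambda>k. c k * r k ^ DIM('a))"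
  shows "(\<integral>\<^sup>+x. g x \<partial>lborel) < \<infinity>"
proof -
  have "(\<integral>\<^sup>+x. g x \<partial>lborel) \<le>
        (\<integral>\<^sup>+x. (\<Sum>k. ennreal (c k) * indicator (ball 0 (r k)) (x::'a)) \<partial>lborel)"
  proof (intro nn_integral_mono)
    fix x :: 'a
    obtain k where "g x \<le> ennreal (c k) * indicator (ball 0 (r k)) x"
      using assms(1) by blast
    then show "g x \<le> (\<Sum>k. ennreal (c k) * indicator (ball 0 (r k)) x)"
      using ennreal_le_suminf[of "\<lambda>k. ennreal (c k) * indicator (ball 0 (r k)) x" k] by (rule order_trans)
  qed
  also have "\<dots> = (\<Sum>k. ennreal (c k) * emeasure lborel (ball (0::'a) (r k)))"
    by (subst nn_integral_suminf) (measurable, auto simp: nn_integral_cmult_indicator)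
  also have "\<dots> = (\<Sum>k. ennreal (unit_ball_vol DIM('a) * (c k * r k ^ DIM('a))))"
    using assms by (intro suminf_cong) (simp add: emeasure_ball ennreal_mult'[symmetric] algebra_simps)
  also have "\<dots> < \<infinity>"
    using assms by (subst suminf_ennreal2) (auto intro!: summable_mult)
  finally show ?thesis .
qed

definition decay_kernel :: "real \<Rightarrow> 'a::euclidean_space \<Rightarrow> real" where
  "decay_kernel a x = a / (a + norm x) ^ (DIM('a) + 1)"

lemma decay_denom_pos: "0 < a \<Longrightarrow> 0 < (a + norm x) ^ n" for x :: "'a::real_normed_vector"
  by (intro zero_less_power add_pos_nonneg) auto

lemma decay_kernel_nonneg: "0 \<le> a \<Longrightarrow> 0 \<le> decay_kernel a x"
  by (simp add: decay_kernel_def)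

lemma decay_kernel_minus_commute: "decay_kernel a (x - y) = decay_kernel a (y - x)"
  by (simp add: decay_kernel_def norm_minus_commute)

lemma measurable_decay_kernel [measurable]:
  assumes [measurable]: "f \<in> borel_measurable M" "g \<in> borel_measurable M"
  shows "(\<lambda>x. decay_kernel (f x) (g x :: 'a::euclidean_space)) \<in> borel_measurable M"
  unfolding decay_kernel_def by measurable

text \<open>If 2^k is the first such power above |x|, the kernel is at most (2 / 2^k)^(N+1), while
  the ball has volume of order 2^(kN): the one surplus power leaves a geometric series of ratio
  1/2.\<close>

lemma nn_integral_decay_kernel_one:
  "(\<integral>\<^sup>+x. decay_kernel 1 (x::'a::euclidean_space) \<partial>lborel) < \<infinity>"
proof (rule nn_integral_le_dyadic)
  fix x :: 'a
  define k where "k = (LEAST k. norm x < 2 ^ k)"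
  obtain n where "norm x < 2 ^ n"
    using real_arch_pow[of 2 "norm x"] by auto
  then have k: "norm x < 2 ^ k"
    unfolding k_def by (rule LeastI)
  have "2 ^ k \<le> 2 * (1 + norm x)"
  proof (cases k)
    case (Suc j)
    then have "\<not> norm x < 2 ^ j"
      unfolding k_def using not_less_Least[of j "\<lambda>k. norm x < 2 ^ k"] by auto
    then show ?thesis using Suc by simp
  qed simp
  then have "1 / (1 + norm x) \<le> 2 / 2 ^ k"
    by (simp add: field_simps add_pos_nonneg)
  then have "(1 / (1 + norm x)) ^ (DIM('a) + 1) \<le> (2 / 2 ^ k) ^ (DIM('a) + 1)"
    by (intro power_mono) auto
  then have "decay_kernel 1 x \<le> (2 / 2 ^ k) ^ (DIM('a) + 1)"
    by (simp only: decay_kernel_def power_one_over power_one)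
  then show "\<exists>k. ennreal (decay_kernel 1 x) \<le>
      ennreal ((2 / 2 ^ k) ^ (DIM('a) + 1)) * indicator (ball 0 (2 ^ k)) x"
    using k by (intro exI[of _ k]) (auto intro!: ennreal_leI)
next
  have "(2 / 2 ^ k) ^ (DIM('a) + 1) * (2 ^ k) ^ DIM('a) = 2 ^ (DIM('a) + 1) * (1/2::real) ^ k" for k
    by (simp add: power_divide power_add power_mult_distrib)
  then show "summable (\<lambda>k. (2 / 2 ^ k) ^ (DIM('a) + 1) * (2 ^ k) ^ DIM('a) :: real)"
    by (auto intro!: summable_mult simp del: power_Suc)
qed auto

text \<open>On the shell 2^(-k-1) \<le> |x| < 2^(-k) the power is at most 2^(r(k+1)); against the
  volume 2^(-kN) this is a geometric series of ratio 2^(r-N), convergent because r < N.\<close>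

lemma nn_integral_norm_powr_unit_ball:
  fixes r :: real
  assumes "0 \<le> r" "r < DIM('a)"
  shows "(\<integral>\<^sup>+x. norm (x::'a::euclidean_space) powr (-r) * indicator (ball 0 1) x \<partial>lborel) < \<infinity>"
proof (rule nn_integral_le_dyadic)
  fix x :: 'a
  let ?c = "\<lambda>k. 2 powr (r * (real k + 1))" and ?r = "\<lambda>k. (1/2)^k :: real"
  show "\<exists>k. ennreal (norm x powr (-r) * indicator (ball 0 1) x) \<le>
      ennreal (?c k) * indicator (ball 0 (?r k)) x"
  \<comment> \<open>\<open>0 powr (-r)\<close> is 0, so the origin belongs to no shell, and outside
    the ball the indicator vanishes.\<close>
  proof (cases "x = 0 \<or> norm x \<ge> 1")
    case False
    define k where "k = (LEAST k. (1/2)^Suc k \<le> norm x)"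
    obtain n where "(1/2)^n < norm x"
      using real_arch_pow_inv[of "norm x" "1/2"] False by auto
    then have "(1/2) ^ Suc n \<le> norm x"
      using zero_less_power[of "1/2::real" n] unfolding power_Suc by linarith
    then have k: "(1/2)^Suc k \<le> norm x"
      unfolding k_def by (rule LeastI)
    have "norm x < (1/2)^k"
    proof (cases k)
      case (Suc j)
      then show ?thesis
        unfolding k_def using not_less_Least[of j "\<lambda>k. (1/2)^Suc k \<le> norm x"] by auto
    qed (use False in auto)
    moreover have "norm x powr (-r) \<le> ?c k"
    proof -
      have "norm x powr (-r) \<le> ((1/2)^Suc k) powr (-r)"
        using k assms by (intro powr_mono2') auto
      also have "\<dots> = ?c k"
      proof -
        have "((1/2)^Suc k) = (2 powr (-(real k + 1)) :: real)"
          by (subst powr_minus) (simp add: powr_add powr_realpow power_one_over divide_simps)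
        then show ?thesis
          by (simp only: powr_powr) (simp add: algebra_simps)
      qed
      finally show ?thesis .
    qed
    ultimately show ?thesis
      using False by (intro exI[of _ k]) (auto intro!: ennreal_leI)
  qed auto
next
  let ?q = "2 powr (r - DIM('a)) :: real"
  have "2 powr (r * (real k + 1)) * ((1/2)^k) ^ DIM('a) = 2 powr r * ?q ^ k" for k
    by (simp add: powr_realpow[symmetric] powr_powr powr_divide powr_diff powr_add power_divide
           divide_simps algebra_simps power_mult[symmetric])
  moreover have "?q < 1"
    using assms by (simp add: powr_less_one)
  ultimately show "summable (\<lambda>k. 2 powr (r * (real k + 1)) * ((1/2)^k) ^ DIM('a) :: real)"
    by (auto intro!: summable_mult summable_geometric)
qed auto

lemma nn_integral_lborel_reflect_scale:
  fixes g :: "'a::euclidean_space \<Rightarrow> ennreal"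
  assumes [measurable]: "g \<in> borel_measurable borel" and "0 < a"
  shows "(\<integral>\<^sup>+y. g y \<partial>lborel) = ennreal (a ^ DIM('a)) * (\<integral>\<^sup>+y. g (x - a *\<^sub>R y) \<partial>lborel)"
proof -
  have "(\<integral>\<^sup>+y. g y \<partial>lborel) =
      (\<integral>\<^sup>+y. g y \<partial>(density (distr lborel borel (\<lambda>y. x + (-a) *\<^sub>R y)) (\<lambda>_. \<bar>-a\<bar> ^ DIM('a))))"
    using lborel_affine[of "-a" x] assms by (simp only:)
  then show ?thesis
    using assms by (simp add: nn_integral_density nn_integral_distr nn_integral_cmult)
qed

text \<open>\<open>enn2real\<close> loses nothing, the integral being finite by
  \<open>nn_integral_decay_kernel_one\<close>.\<close>

definition decay_mass :: "'a::euclidean_space itself \<Rightarrow> real" where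
  "decay_mass _ = enn2real (\<integral>\<^sup>+x. decay_kernel 1 (x::'a) \<partial>lborel)"

lemma decay_mass_nonneg: "0 \<le> decay_mass TYPE('a::euclidean_space)"
  by (simp add: decay_mass_def)

text \<open>The family consists of L^1-normalized dilations: the kernel of scale a at a y is a^(-N)
  times the unit kernel at y, and the Jacobian cancels the power.\<close>

lemma nn_integral_decay_kernel:
  fixes x :: "'a::euclidean_space"
  assumes "0 < a"
  shows "(\<integral>\<^sup>+y. decay_kernel a (x - y) \<partial>lborel) = decay_mass TYPE('a)"
proof -
  have *: "decay_kernel a (a *\<^sub>R y) = (1 / a ^ DIM('a)) * decay_kernel 1 y" for y :: 'a
  proof -
    have "a + norm (a *\<^sub>R y) = a * (1 + norm y)"
      using assms by (simp add: algebra_simps)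
    then show ?thesis
      using assms unfolding decay_kernel_def by (simp add: power_mult_distrib)
  qed
  have "(\<integral>\<^sup>+y. decay_kernel a (x - y) \<partial>lborel) =
      ennreal (a ^ DIM('a)) * (\<integral>\<^sup>+y. decay_kernel a (a *\<^sub>R y :: 'a) \<partial>lborel)"
    using assms by (subst nn_integral_lborel_reflect_scale[of _ a x]) auto
  also have "\<dots> = (\<integral>\<^sup>+y. decay_kernel 1 (y :: 'a) \<partial>lborel)"
    using assms
    by (subst nn_integral_cmult[symmetric]) (auto simp: * ennreal_mult'[symmetric])
  also have "\<dots> = decay_mass TYPE('a)"
    using nn_integral_decay_kernel_one unfolding decay_mass_def
    by (subst ennreal_enn2real) auto
  finally show ?thesis .
qed

text \<open>A larger scale has a larger denominator, so only the quotient b / a of the numerators is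
  lost.\<close>

lemma decay_kernel_mono_scale:
  fixes x :: "'a::euclidean_space"
  assumes "0 < a" "a \<le> b"
  shows "decay_kernel b x \<le> b / a * decay_kernel a x"
proof -
  have "(a + norm x) ^ (DIM('a) + 1) \<le> (b + norm x) ^ (DIM('a) + 1)"
    using assms by (intro power_mono) auto
  then have "b / (b + norm x) ^ (DIM('a) + 1) \<le> b / (a + norm x) ^ (DIM('a) + 1)"
    using assms by (intro divide_left_mono mult_pos_pos decay_denom_pos) auto
  then show ?thesis
    using assms by (simp add: decay_kernel_def)
qed

text \<open>A Harnack-type inequality: a step of length at most a changes a + |x| by at most a
  factor 2, which is raised to the power N + 1.\<close>

lemma decay_kernel_shift:
  fixes x y :: "'a::euclidean_space"
  assumes "0 < a" "norm (x - y) \<le> a"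
  shows "decay_kernel a x \<le> 2 ^ (DIM('a) + 1) * decay_kernel a y"
proof -
  have "a + norm y \<le> 2 * (a + norm x)"
    using assms norm_triangle_sub[of y x] norm_ge_zero[of x] unfolding norm_minus_commute[of y x]
    by argo
  then have "(1 / (a + norm x)) ^ (DIM('a) + 1) \<le> (2 / (a + norm y)) ^ (DIM('a) + 1)"
    using assms by (intro power_mono) (auto simp: field_simps add_pos_nonneg)
  then have "a * (1 / (a + norm x)) ^ (DIM('a) + 1) \<le> a * (2 / (a + norm y)) ^ (DIM('a) + 1)"
    using assms by (intro mult_left_mono) auto
  then show ?thesis
    unfolding decay_kernel_def power_divide by (simp add: ac_simps)
qed

text \<open>
  Since \<open>(a + |x - y|) + (b + |y|) \<ge> a + b + |x|\<close>, one of the two denominators is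
  at least half of that of the kernel at scale \<open>a + b\<close>; the other factor is integrated.
\<close>

lemma decay_kernel_mult_le:
  fixes x y :: "'a::euclidean_space"
  assumes "0 < a" "0 < b"
  shows "decay_kernel a (x - y) * decay_kernel b (y - z) \<le>
    2 ^ (DIM('a) + 1) * decay_kernel (a + b) (x - z) * (decay_kernel a (x - y) + decay_kernel b (y - z))"
proof -
  have half: "decay_kernel c v \<le> 2 ^ (DIM('a) + 1) * decay_kernel (a + b) (x - z)"
    if "0 < c" "c \<le> a + b" "a + b + norm (x - z) \<le> 2 * (c + norm v)" for c and v :: 'a
  proof -
    have "(a + b + norm (x - z)) ^ (DIM('a) + 1) \<le> 2 ^ (DIM('a) + 1) * (c + norm v) ^ (DIM('a) + 1)"
      unfolding power_mult_distrib[symmetric] using assms that by (intro power_mono) auto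
    moreover have "0 < (a + b + norm (x - z)) ^ (DIM('a) + 1)" "0 < (c + norm v) ^ (DIM('a) + 1)"
      using assms that by (intro decay_denom_pos; simp)+
    ultimately have "1 / (c + norm v) ^ (DIM('a) + 1) \<le>
        2 ^ (DIM('a) + 1) / (a + b + norm (x - z)) ^ (DIM('a) + 1)"
      by (simp add: field_simps)
    then have "c * (1 / (c + norm v) ^ (DIM('a) + 1)) \<le>
        (a + b) * (2 ^ (DIM('a) + 1) / (a + b + norm (x - z)) ^ (DIM('a) + 1))"
      using assms that by (intro mult_mono) auto
    then show ?thesis
      unfolding decay_kernel_def by (simp add: mult.commute)
  qed
  have nn: "0 \<le> decay_kernel a (x - y)" "0 \<le> decay_kernel b (y - z)" "0 \<le> decay_kernel (a+b) (x - z)"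
    using assms by (auto intro!: decay_kernel_nonneg)
  have "norm (x - z) \<le> norm (x - y) + norm (y - z)"
    using norm_triangle_ineq[of "x - y" "y - z"] by simp
  then consider "a + b + norm (x - z) \<le> 2 * (a + norm (x - y))" | "a + b + norm (x - z) \<le> 2 * (b + norm (y - z))"
    by argo
  then have "decay_kernel a (x - y) \<le> 2 ^ (DIM('a) + 1) * decay_kernel (a + b) (x - z) \<or>
      decay_kernel b (y - z) \<le> 2 ^ (DIM('a) + 1) * decay_kernel (a + b) (x - z)"
    using half[of a "x - y"] half[of b "y - z"] assms by auto
  moreover have "u * v \<le> w * (u + v)" if "0 \<le> u" "0 \<le> v" "u \<le> w \<or> v \<le> w" for u v w :: real
  proof -
    have "0 \<le> w" using that by auto
    then have "u * v \<le> w * v \<or> u * v \<le> w * u" "0 \<le> w * u" "0 \<le> w * v"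
      using that mult_right_mono[of u w v] mult_right_mono[of v w u] by (auto simp: mult.commute)
    then show ?thesis
      unfolding distrib_left by linarith
  qed
  ultimately show ?thesis
    using nn by blast
qed

text \<open>Each of the two kernels in the pointwise bound integrates to the same mass, hence the
  extra factor 2 over 2^(N+1).\<close>

lemma nn_integral_decay_kernel_mult:
  fixes x z :: "'a::euclidean_space"
  assumes "0 < a" "0 < b"
  shows "(\<integral>\<^sup>+y. ennreal (decay_kernel a (x - y)) * decay_kernel b (y - z) \<partial>lborel) \<le>
    ennreal (2 ^ (DIM('a) + 2) * decay_mass TYPE('a) * decay_kernel (a + b) (x - z))"
proof -
  let ?k = "2 ^ (DIM('a) + 1) * decay_kernel (a + b) (x - z)"
  have nn: "0 \<le> ?k" using assms by (intro mult_nonneg_nonneg decay_kernel_nonneg) auto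
  have *: "ennreal (decay_kernel a (x - y)) * decay_kernel b (y - z) \<le>
      ennreal ?k * (ennreal (decay_kernel a (x - y)) + ennreal (decay_kernel b (z - y)))" for y
    using decay_kernel_mult_le[OF assms, of x y z] assms
    by (simp add: decay_kernel_nonneg flip: ennreal_mult ennreal_plus) 
       (auto simp: decay_kernel_minus_commute[of _ z] intro!: ennreal_leI)
  have "(\<integral>\<^sup>+y. ennreal (decay_kernel a (x - y)) * decay_kernel b (y - z) \<partial>lborel) \<le>
      (\<integral>\<^sup>+y. ennreal ?k * (ennreal (decay_kernel a (x - y)) + ennreal (decay_kernel b (z - y))) \<partial>lborel)"
    by (intro nn_integral_mono *)
  also have "\<dots> = ennreal ?k * (ennreal (decay_mass TYPE('a)) + ennreal (decay_mass TYPE('a)))"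
    using assms by (simp add: nn_integral_cmult nn_integral_add nn_integral_decay_kernel)
  also have "\<dots> = ennreal (2 ^ (DIM('a) + 2) * decay_mass TYPE('a) * decay_kernel (a + b) (x - z))"
    using nn decay_mass_nonneg[where 'a='a]
    by (simp flip: ennreal_mult ennreal_plus add: algebra_simps)
  finally show ?thesis .
qed

section \<open>Fourier integrals of regularized symbols\<close>

text \<open>The exponential wins at infinity, and continuity settles the compact remainder. Staying
  above y0 > 0 is what admits negative exponents a.\<close>

lemma powr_mult_exp_bounded:
  fixes a b t y0 :: real
  assumes "0 < b" "0 < t" "0 < y0"
  shows "\<exists>C>0. \<forall>y\<ge>y0. y powr a * exp (- t * y powr b) \<le> C"
proof -
  have "((\<lambda>y::real. y powr a * exp (- t * y powr b)) \<longlongrightarrow> 0) at_top"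
    using assms by real_asymp
  then have "\<forall>\<^sub>F y in at_top. y powr a * exp (- t * y powr b) < 1"
    by (rule order_tendstoD) simp
  then obtain Y where Y: "y powr a * exp (- t * y powr b) < 1" if "y \<ge> Y" for y
    by (auto simp: eventually_at_top_linorder)
  have "continuous_on {y0..Y} (\<lambda>y. y powr a * exp (- t * y powr b))"
    using assms by (auto intro!: continuous_intros)
  then have "bounded ((\<lambda>y. y powr a * exp (- t * y powr b)) ` {y0..Y})"
    by (intro compact_imp_bounded compact_continuous_image) auto
  then obtain B where B: "\<And>y. y \<in> {y0..Y} \<Longrightarrow> y powr a * exp (- t * y powr b) \<le> B"
    unfolding bounded_iff by (metis (no_types, lifting) abs_le_D1 imageI real_norm_def)
  have "y powr a * exp (- t * y powr b) \<le> max 1 B" if "y \<ge> y0" for y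
    using B[of y] Y[of y] that by (cases "y \<le> Y") auto
  then show ?thesis
    by (intro exI[of _ "max 1 B"]) auto
qed

text \<open>If q is at least of order (1 + |x|)^2, the power -(N+1)/2 of q decays like the unit
  kernel. The estimates below split off this power and leave the rest to the exponential.\<close>

lemma decay_kernel_one_ge:
  fixes x :: "'a::euclidean_space"
  assumes "1 + norm x \<le> c * sqrt q" "0 < q" "0 < c"
  shows "q powr (- real (DIM('a) + 1) / 2) \<le> c ^ (DIM('a) + 1) * decay_kernel 1 x"
proof -
  have "(1 + norm x) ^ (DIM('a) + 1) \<le> c ^ (DIM('a) + 1) * sqrt q ^ (DIM('a) + 1)"
    unfolding power_mult_distrib[symmetric] using assms by (intro power_mono) auto
  moreover have "sqrt q ^ (DIM('a) + 1) = q powr ((DIM('a) + 1) / 2)"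
    using assms by (simp add: powr_half_sqrt[symmetric] powr_realpow[symmetric] powr_powr
          powr_add add_divide_distrib)
  ultimately have "1 / q powr ((DIM('a) + 1) / 2) \<le> c ^ (DIM('a) + 1) * (1 / (1 + norm x) ^ (DIM('a) + 1))"
    using decay_denom_pos[of 1 x "DIM('a) + 1"] assms by (simp add: divide_simps mult.commute)
  then show ?thesis
    unfolding decay_kernel_def powr_minus_divide minus_divide_left[symmetric] .
qed

definition shifted_sq :: "real \<Rightarrow> 'a::euclidean_space \<Rightarrow> real" where
  "shifted_sq e x = (norm x)\<^sup>2 + e"

lemma shifted_sq_pos: "0 < e \<Longrightarrow> 0 < shifted_sq e x"
  by (simp add: shifted_sq_def add_nonneg_pos)

lemma measurable_shifted_sq [measurable]: "shifted_sq e \<in> borel_measurable borel"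
  unfolding shifted_sq_def by measurable

lemma norm_le_sqrt_shifted_sq: "0 \<le> e \<Longrightarrow> norm x \<le> sqrt (shifted_sq e x)"
  by (rule real_le_rsqrt) (simp add: shifted_sq_def)

text \<open>The constant depends on e and may blow up as e tends to 0: the bound justifies
  integrability and integration by parts at fixed e, and does not serve as an estimate in the
  limit.\<close>

lemma shifted_sq_powr_exp_le_decay_kernel:
  fixes d r e :: real
  assumes "0 < d" "0 < e"
  shows "\<exists>C. \<forall>x::'a::euclidean_space.
    shifted_sq e x powr (r / 2) * exp (- (shifted_sq e x powr (d / 2))) \<le> C * decay_kernel 1 x"
proof -
  let ?n = "DIM('a) + 1"
  obtain C where C: "C > 0" "\<And>y. y \<ge> e \<Longrightarrow> y powr ((r + ?n) / 2) * exp (- (y powr (d / 2))) \<le> C"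
    using powr_mult_exp_bounded[of "d/2" 1 e "(r + ?n) / 2"] assms by auto
  \<comment> \<open>Times sqrt q, the two summands bound 1 and |x|, since q \<ge> e and q \<ge>
    |x|^2.\<close>
  define c where "c = 1 / sqrt e + 1"
  have "shifted_sq e x powr (r / 2) * exp (- (shifted_sq e x powr (d / 2))) \<le>
      C * c ^ ?n * decay_kernel 1 x" for x :: 'a
  proof -
    define q where "q = shifted_sq e x"
    have q: "q \<ge> e" "q > 0" using assms by (auto simp: q_def shifted_sq_def add_nonneg_pos)
    have "1 \<le> sqrt q / sqrt e"
      using q assms by simp
    have "1 + norm x \<le> c * sqrt q"
    proof -
      have "c * sqrt q = sqrt q / sqrt e + sqrt q"
        by (simp add: c_def distrib_right)
      then show ?thesis
        using \<open>1 \<le> sqrt q / sqrt e\<close> norm_le_sqrt_shifted_sq[of e x] assms unfolding q_def by linarith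
    qed
    then have *: "q powr (- real ?n / 2) \<le> c ^ ?n * decay_kernel 1 x"
      using q assms by (intro decay_kernel_one_ge) (auto simp: c_def add_pos_pos)
    have "q powr (r / 2) * exp (- (q powr (d / 2))) =
        q powr ((r + ?n) / 2) * exp (- (q powr (d / 2))) * q powr (- real ?n / 2)"
      using q by (simp add: powr_add[symmetric] add_divide_distrib diff_divide_distrib)
    also have "\<dots> \<le> C * (c ^ ?n * decay_kernel 1 x)"
      using C q * by (intro mult_mono) auto
    finally show ?thesis
      by (simp add: q_def mult.assoc)
  qed
  then show ?thesis by blast
qed

text \<open>The counterpart that is uniform in e. As e tends to 0 a singularity |x|^r may form at
  the origin, integrable since r > -N. The value e = 0 is included so that the unregularized symbol
  is covered; x = 0 is left out since for r < 0 no finite value there dominates e^(r/2) for all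
  small e.\<close>

lemma shifted_sq_powr_exp_dominated:
  fixes d t r :: real
  assumes "0 < d" "0 < t" "- DIM('a) < r"
  shows "\<exists>g. integrable lborel g \<and> (\<forall>x::'a::euclidean_space. 0 \<le> g x) \<and> (\<forall>e\<in>{0..1}. \<forall>x. x \<noteq> 0 \<longrightarrow>
    shifted_sq e x powr (r / 2) * exp (- t * (shifted_sq e x powr (d / 2))) \<le> g x)"
proof -
  let ?n = "DIM('a) + 1"
  obtain C where C: "C > 0" "\<And>y. y \<ge> 1 \<Longrightarrow> y powr ((r + ?n) / 2) * exp (- t * (y powr (d / 2))) \<le> C"
    using powr_mult_exp_bounded[of "d/2" t 1 "(r + ?n) / 2"] assms by auto
  define r' where "r' = max 0 (- r)"
  \<comment> \<open>On the unit ball q is at most 2, so \<open>D\<close> bounds q^(r/2) for r \<ge>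
    0; for r < 0 one uses q \<ge> |x|^2 instead.\<close>
  define D where "D = (2::real) powr (\<bar>r\<bar> / 2)"
  define g where "g x = C * 2 ^ ?n * decay_kernel 1 x + D * (norm x powr (-r') * indicator (ball 0 1) x)"
    for x :: 'a
  have nn: "0 \<le> g x" for x
    using C by (auto simp: g_def D_def decay_kernel_nonneg intro!: add_nonneg_nonneg)
  have i1: "integrable lborel (\<lambda>x::'a. decay_kernel 1 x)"
    using nn_integral_decay_kernel_one[where 'a='a]
    by (intro integrableI_nonneg) (auto simp: decay_kernel_nonneg)
  have i2: "integrable lborel (\<lambda>x::'a. norm x powr (-r') * indicator (ball 0 1) x)"
    using nn_integral_norm_powr_unit_ball[of r', where 'a='a] assms
    by (intro integrableI_nonneg) (measurable, auto simp: r'_def)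
  have "integrable lborel g"
    unfolding g_def by (intro Bochner_Integration.integrable_add integrable_mult_right i1 i2)
  moreover have "shifted_sq e x powr (r / 2) * exp (- t * (shifted_sq e x powr (d / 2))) \<le> g x"
    if e: "e \<in> {0..1}" and x: "x \<noteq> 0" for e x
  proof -
    define q where "q = shifted_sq e x"
    have q: "q > 0" using x e by (auto simp: q_def shifted_sq_def intro!: add_pos_nonneg)
    show ?thesis
    proof (cases "norm x < 1")
      case True
      have "(norm x)\<^sup>2 \<le> 1" using True by (simp add: power_le_one)
      then have q2: "q \<le> 2" using e by (auto simp: q_def shifted_sq_def)
      have "q powr (r / 2) \<le> D * norm x powr (-r')"
      proof (cases "0 \<le> r")
        case True
        then show ?thesis
          using x q q2 by (auto simp: r'_def D_def intro!: powr_mono2)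
      next
        case False
        have "q powr (r / 2) \<le> ((norm x)\<^sup>2) powr (r / 2)"
          using False x e by (intro powr_mono2') (auto simp: q_def shifted_sq_def)
        also have "\<dots> = norm x powr r"
          using x by (simp add: powr_powr flip: powr_numeral)
        also have "\<dots> \<le> D * norm x powr r"
          using ge_one_powr_ge_zero[of 2 "\<bar>r\<bar> / 2"] by (simp add: D_def mult_le_cancel_right1)
        finally show ?thesis
          using False by (simp add: r'_def)
      qed
      moreover have "exp (- t * (q powr (d / 2))) \<le> 1"
        using assms by simp
      ultimately have "q powr (r / 2) * exp (- t * (q powr (d / 2))) \<le> D * norm x powr (-r') * 1"
        by (intro mult_mono) (auto simp: D_def)
      also have "\<dots> \<le> g x"
        using True C by (auto simp: g_def decay_kernel_nonneg)
      finally show ?thesis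
        by (simp add: q_def)
    next
      case False
      have q1: "q \<ge> 1" using False e by (auto simp: q_def shifted_sq_def intro!: add_increasing2)
      have "1 \<le> sqrt q" using q1 by simp
      moreover have "norm x \<le> sqrt q"
        using norm_le_sqrt_shifted_sq[of e x] e by (simp add: q_def)
      ultimately have "1 + norm x \<le> 2 * sqrt q"
        by linarith
      then have *: "q powr (- real ?n / 2) \<le> 2 ^ ?n * decay_kernel 1 x"
        using q by (intro decay_kernel_one_ge) auto
      have "q powr (r / 2) * exp (- t * (q powr (d / 2))) =
          q powr ((r + ?n) / 2) * exp (- t * (q powr (d / 2))) * q powr (- real ?n / 2)"
        using q by (simp add: powr_add[symmetric] add_divide_distrib diff_divide_distrib)
      also have "\<dots> \<le> C * (2 ^ ?n * decay_kernel 1 x)"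
        using C q1 * by (intro mult_mono) auto
      also have "\<dots> \<le> g x"
        by (auto simp: g_def D_def mult.assoc)
      finally show ?thesis
        by (simp add: q_def)
    qed
  qed
  ultimately show ?thesis
    using nn by blast
qed

section \<open>Differentiation under the integral sign and integration by parts\<close>

text \<open>The mean value inequality turns the bound on the derivative into |F h x - F 0 x| \<le> g
  x |h|, so \<open>g\<close> dominates all difference quotients and dominated convergence
  applies.\<close>

lemma has_vector_derivative_integral:
  fixes F F' :: "real \<Rightarrow> 'a \<Rightarrow> complex"
  assumes deriv: "\<And>h x. \<bar>h\<bar> < 1 \<Longrightarrow> ((\<lambda>h. F h x) has_vector_derivative F' h x) (at h)"
    and bound: "\<And>h x. \<bar>h\<bar> < 1 \<Longrightarrow> cmod (F' h x) \<le> g x"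
    and int: "\<And>h. \<bar>h\<bar> < 1 \<Longrightarrow> integrable M (F h)" and [measurable]: "F' 0 \<in> borel_measurable M"
    and g: "integrable M g"
  shows "((\<lambda>h. LINT x|M. F h x) has_vector_derivative (LINT x|M. F' 0 x)) (at 0)"
proof -
  have Q: "(LINT x|M. (1 / h) *\<^sub>R (F h x - F 0 x)) = (1 / h) *\<^sub>R ((LINT x|M. F h x) - (LINT x|M. F 0 x))"
    if "\<bar>h\<bar> < 1" for h
    using int[OF that] int[of 0] by simp
  have lip: "cmod (F h x - F 0 x) \<le> g x * \<bar>h\<bar>" if "\<bar>h\<bar> < 1" for h x
  proof -
    have "norm (F h x - F 0 x) \<le> g x * norm (h - 0)"
    proof (rule differentiable_bound[where S = "{-1<..<1}" and f' = "\<lambda>h. \<lambda>k. k *\<^sub>R F' h x"])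
      fix k :: real assume k: "k \<in> {-1<..<1}"
      then show "((\<lambda>h. F h x) has_derivative (\<lambda>c. c *\<^sub>R F' k x)) (at k within {-1<..<1})"
        using deriv[of k x] unfolding has_vector_derivative_def by (auto intro: has_derivative_at_withinI)
      show "onorm (\<lambda>c. c *\<^sub>R F' k x) \<le> g x"
        using bound[of k x] k by (intro onorm_le) (auto simp: abs_less_iff mult_left_mono mult.commute)
    qed (use that in auto)
    then show ?thesis by simp
  qed
  have "(\<lambda>n. (1 / h n) *\<^sub>R ((LINT x|M. F (h n) x) - (LINT x|M. F 0 x))) \<longlonglongrightarrow> (LINT x|M. F' 0 x)"
    if h0: "h \<longlonglongrightarrow> 0" and hn: "\<And>n. h n \<noteq> 0" and h1: "\<And>n. \<bar>h n\<bar> < 1" for h :: "nat \<Rightarrow> real"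
    unfolding Q[OF h1, symmetric]
  proof (rule integral_dominated_convergence[where w = g])
    show "(\<lambda>x. (1 / h n) *\<^sub>R (F (h n) x - F 0 x)) \<in> borel_measurable M" for n
      using int[OF h1[of n]] int[of 0] by auto
    show "AE x in M. (\<lambda>n. (1 / h n) *\<^sub>R (F (h n) x - F 0 x)) \<longlonglongrightarrow> F' 0 x"
    proof (intro AE_I2)
      fix x
      have "((\<lambda>k. (1 / k) *\<^sub>R (F k x - F 0 x)) \<longlongrightarrow> F' 0 x) (at 0)"
      proof -
        have "((\<lambda>k. norm (F k x - F 0 x - k *\<^sub>R F' 0 x) / norm k) \<longlongrightarrow> 0) (at 0)"
          using deriv[of 0 x] unfolding has_vector_derivative_def has_derivative_at by simp
        then have "((\<lambda>k. norm ((1 / k) *\<^sub>R (F k x - F 0 x) - F' 0 x)) \<longlongrightarrow> 0) (at 0)"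
        proof (rule Lim_transform_eventually)
          have "norm (F k x - F 0 x - k *\<^sub>R F' 0 x) / norm k = norm ((1 / k) *\<^sub>R (F k x - F 0 x) - F' 0 x)"
            if "k \<noteq> 0" for k
          proof -
            have "(1 / k) *\<^sub>R (F k x - F 0 x) - F' 0 x = (1 / k) *\<^sub>R (F k x - F 0 x - k *\<^sub>R F' 0 x)"
              using that by (simp add: scaleR_diff_right)
            then show ?thesis by simp
          qed
          then show "\<forall>\<^sub>F k in at 0. norm (F k x - F 0 x - k *\<^sub>R F' 0 x) / norm k =
              norm ((1 / k) *\<^sub>R (F k x - F 0 x) - F' 0 x)"
            by (auto simp: eventually_at_filter)
        qed
        then show ?thesis
          by (subst Lim_null) (rule tendsto_norm_zero_cancel)
      qed
      then show "(\<lambda>n. (1 / h n) *\<^sub>R (F (h n) x - F 0 x)) \<longlonglongrightarrow> F' 0 x"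
        using h0 hn unfolding tendsto_at_iff_sequentially comp_def by auto
    qed
    show "AE x in M. norm ((1 / h n) *\<^sub>R (F (h n) x - F 0 x)) \<le> g x" for n
      using lip[OF h1[of n]] hn[of n]
      by (intro AE_I2) (simp add: divide_le_eq norm_scaleR del: scaleR_diff_right scaleR_right_diff_distrib)
  qed (use g in auto)
  note seq = this
  \<comment> \<open>Inside (-1, 1) every test sequence satisfies |h n| < 1, as \<open>seq\<close>
    demands; the interval is open, so the limit at 0 is the same.\<close>
  have "((\<lambda>h. (1 / h) *\<^sub>R ((LINT x|M. F h x) - (LINT x|M. F 0 x))) \<longlongrightarrow> (LINT x|M. F' 0 x)) (at 0 within {-1<..<1})"
    unfolding tendsto_at_iff_sequentially comp_def using seq by (auto simp: abs_less_iff)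
  then have lim: "((\<lambda>h. (1 / h) *\<^sub>R ((LINT x|M. F h x) - (LINT x|M. F 0 x))) \<longlongrightarrow> (LINT x|M. F' 0 x)) (at 0)"
    by (simp add: at_within_open[of 0 "{-1<..<1::real}"])
  have "((\<lambda>k. norm ((LINT x|M. F k x) - (LINT x|M. F 0 x) - k *\<^sub>R (LINT x|M. F' 0 x)) / norm k) \<longlongrightarrow> 0) (at 0)"
  proof (rule Lim_transform_eventually)
    show "((\<lambda>k. norm ((1 / k) *\<^sub>R ((LINT x|M. F k x) - (LINT x|M. F 0 x)) - (LINT x|M. F' 0 x))) \<longlongrightarrow> 0) (at 0)"
      using lim by (subst (asm) Lim_null) (rule tendsto_norm_zero)
    have "norm ((1 / k) *\<^sub>R ((LINT x|M. F k x) - (LINT x|M. F 0 x)) - (LINT x|M. F' 0 x)) =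
        norm ((LINT x|M. F k x) - (LINT x|M. F 0 x) - k *\<^sub>R (LINT x|M. F' 0 x)) / norm k"
      if "k \<noteq> 0" for k
    proof -
      have "(1 / k) *\<^sub>R ((LINT x|M. F k x) - (LINT x|M. F 0 x)) - (LINT x|M. F' 0 x) =
          (1 / k) *\<^sub>R ((LINT x|M. F k x) - (LINT x|M. F 0 x) - k *\<^sub>R (LINT x|M. F' 0 x))"
        using that by (simp add: scaleR_diff_right)
      then show ?thesis by simp
    qed
    then show "\<forall>\<^sub>F k in at 0. norm ((1 / k) *\<^sub>R ((LINT x|M. F k x) - (LINT x|M. F 0 x)) - (LINT x|M. F' 0 x)) =
        norm ((LINT x|M. F k x) - (LINT x|M. F 0 x) - k *\<^sub>R (LINT x|M. F' 0 x)) / norm k"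
      by (auto simp: eventually_at_filter)
  qed
  then show ?thesis
    unfolding has_vector_derivative_def has_derivative_at by (simp add: bounded_linear_scaleR_left)
qed

lemma integral_lborel_translate:
  fixes f :: "'a::euclidean_space \<Rightarrow> complex"
  assumes [measurable]: "f \<in> borel_measurable borel"
  shows "(LINT x|lborel. f (x + c)) = (LINT x|lborel. f x)"
proof -
  have "(LINT x|lborel. f x) = (LINT x|(distr lborel borel (\<lambda>x. c + x)). f x)"
    by (simp add: lborel_distr_plus)
  then show ?thesis
    by (simp add: integral_distr add.commute)
qed

text \<open>Boundary terms are avoided: by translation invariance, replacing f(\<xi>) by f(\<xi> + h
  b) multiplies the Fourier integral by exp(-i h (x \<bullet> b)). Differentiating this identity at
  h = 0, under the integral on one side and explicitly on the other, gives the claim.\<close>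

lemma fourier_integral_by_parts:
  fixes f f' :: "'a::euclidean_space \<Rightarrow> complex"
  assumes b: "b \<in> Basis"
    and deriv: "\<And>\<xi> h. ((\<lambda>h. f (\<xi> + h *\<^sub>R b)) has_vector_derivative f' (\<xi> + h *\<^sub>R b)) (at h)"
    and [measurable]: "f \<in> borel_measurable borel" "f' \<in> borel_measurable borel"
    and f: "\<And>\<xi>. cmod (f \<xi>) \<le> C * decay_kernel 1 \<xi>"
    and f': "\<And>\<xi>. cmod (f' \<xi>) \<le> C * decay_kernel 1 \<xi>"
  shows "cmod (LINT \<xi>|lborel. exp (\<i> * complex_of_real (x \<bullet> \<xi>)) * f' \<xi>) =
      \<bar>x \<bullet> b\<bar> * cmod (LINT \<xi>|lborel. exp (\<i> * complex_of_real (x \<bullet> \<xi>)) * f \<xi>)"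
proof -
  let ?e = "\<lambda>\<xi>. exp (\<i> * complex_of_real (x \<bullet> \<xi>))"
  let ?I = "LINT \<xi>|lborel. ?e \<xi> * f \<xi>"
  have C: "0 \<le> C"
    using order_trans[OF norm_ge_zero f[of 0]] by (simp add: decay_kernel_def)
  have e1: "cmod (?e \<xi>) = 1" for \<xi> by (simp add: norm_exp_eq_Re)
  define g where "g \<xi> = C * 2 ^ (DIM('a) + 1) * decay_kernel 1 \<xi>" for \<xi> :: 'a
  have g: "integrable lborel g"
    unfolding g_def using nn_integral_decay_kernel_one[where 'a='a]
    by (intro integrable_mult_right integrableI_nonneg) (auto simp: decay_kernel_nonneg)
  \<comment> \<open>Translations of length below 1 cost the factor 2^(N+1), so \<open>g\<close>
    dominates all of them at once.\<close>
  have shift: "C * decay_kernel 1 (\<xi> + h *\<^sub>R b) \<le> g \<xi>" if "\<bar>h\<bar> < 1" for h \<xi>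
    using decay_kernel_shift[of 1 "\<xi> + h *\<^sub>R b" \<xi>] that b C
    by (auto simp: g_def mult.assoc intro!: mult_left_mono)
  have "((\<lambda>h. LINT \<xi>|lborel. ?e \<xi> * f (\<xi> + h *\<^sub>R b)) has_vector_derivative
      (LINT \<xi>|lborel. ?e \<xi> * f' (\<xi> + 0 *\<^sub>R b))) (at 0)"
  proof (rule has_vector_derivative_integral[where g = g])
    fix h :: real and \<xi> :: 'a
    assume h: "\<bar>h\<bar> < 1"
    show "((\<lambda>h. ?e \<xi> * f (\<xi> + h *\<^sub>R b)) has_vector_derivative ?e \<xi> * f' (\<xi> + h *\<^sub>R b)) (at h)"
      by (intro has_vector_derivative_mult_right deriv)
    show "cmod (?e \<xi> * f' (\<xi> + h *\<^sub>R b)) \<le> g \<xi>"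
      unfolding norm_mult e1 using f'[of "\<xi> + h *\<^sub>R b"] shift[OF h, of \<xi>] by simp
  next
    fix h :: real assume h: "\<bar>h\<bar> < 1"
    show "integrable lborel (\<lambda>\<xi>. ?e \<xi> * f (\<xi> + h *\<^sub>R b))"
    proof (rule Bochner_Integration.integrable_bound[OF g])
      show "AE \<xi> in lborel. norm (?e \<xi> * f (\<xi> + h *\<^sub>R b)) \<le> norm (g \<xi>)"
      proof (intro AE_I2)
        fix \<xi>
        have "norm (?e \<xi> * f (\<xi> + h *\<^sub>R b)) \<le> g \<xi>"
          unfolding norm_mult e1 using f[of "\<xi> + h *\<^sub>R b"] shift[OF h, of \<xi>] by simp
        then show "norm (?e \<xi> * f (\<xi> + h *\<^sub>R b)) \<le> norm (g \<xi>)" by simp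
      qed
    qed auto
  qed (use g in auto)
  moreover have "(LINT \<xi>|lborel. ?e \<xi> * f (\<xi> + h *\<^sub>R b)) = exp (- (h *\<^sub>R (\<i> * complex_of_real (x \<bullet> b)))) * ?I" for h
  proof -
    have "?e \<xi> * f (\<xi> + h *\<^sub>R b) =
        exp (- (h *\<^sub>R (\<i> * complex_of_real (x \<bullet> b)))) * (?e (\<xi> + h *\<^sub>R b) * f (\<xi> + h *\<^sub>R b))" for \<xi>
    proof -
      have "\<i> * complex_of_real (x \<bullet> \<xi>) =
          - (h *\<^sub>R (\<i> * complex_of_real (x \<bullet> b))) + \<i> * complex_of_real (x \<bullet> (\<xi> + h *\<^sub>R b))"
        by (simp add: inner_add_right scaleR_conv_of_real distrib_left mult.left_commute)
      then show ?thesis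
        by (simp only: exp_add mult.assoc)
    qed
    then have "(LINT \<xi>|lborel. ?e \<xi> * f (\<xi> + h *\<^sub>R b)) =
        exp (- (h *\<^sub>R (\<i> * complex_of_real (x \<bullet> b)))) * (LINT \<xi>|lborel. ?e (\<xi> + h *\<^sub>R b) * f (\<xi> + h *\<^sub>R b))"
      by (simp only: integral_mult_right_zero)
    then show ?thesis
      using integral_lborel_translate[of "\<lambda>\<xi>. ?e \<xi> * f \<xi>" "h *\<^sub>R b"] by simp
  qed
  moreover have "((\<lambda>h. exp (- (h *\<^sub>R (\<i> * complex_of_real (x \<bullet> b)))) * ?I) has_vector_derivative
      - (\<i> * complex_of_real (x \<bullet> b)) * ?I) (at 0)"
  proof -
    have "((\<lambda>h. exp (h *\<^sub>R (- (\<i> * complex_of_real (x \<bullet> b))))) has_vector_derivative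
        exp (0 *\<^sub>R (- (\<i> * complex_of_real (x \<bullet> b)))) * (- (\<i> * complex_of_real (x \<bullet> b)))) (at 0)"
      by (rule exp_scaleR_has_vector_derivative_right)
    then show ?thesis
      by (intro has_vector_derivative_mult_left) simp
  qed
  ultimately have "(LINT \<xi>|lborel. ?e \<xi> * f' (\<xi> + 0 *\<^sub>R b)) = - (\<i> * complex_of_real (x \<bullet> b)) * ?I"
    by (simp only: vector_derivative_unique_at)
  then show ?thesis
    by (simp add: norm_mult)
qed

text \<open>
  Replacing \<open>|\<xi>|\<^sup>2\<close> by \<open>|\<xi>|\<^sup>2 + e\<close> removes the singularity of \<open>|\<xi>|\<^sup>d\<close> at the origin. Along a basis
  direction \<open>b\<close> the functions below are closed under differentiation up to linear combinations.
\<close>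

definition reg_term :: "real \<Rightarrow> 'a::euclidean_space \<Rightarrow> real \<Rightarrow> nat \<Rightarrow> real \<Rightarrow> 'a \<Rightarrow> real" where
  "reg_term d b e k s \<xi> =
     (\<xi> \<bullet> b) ^ k * shifted_sq e \<xi> powr s * exp (- (shifted_sq e \<xi> powr (d / 2)))"

lemma measurable_reg_term [measurable]: "reg_term d b e k s \<in> borel_measurable borel"
  unfolding reg_term_def by measurable

lemma shifted_sq_has_derivative:
  "((\<lambda>h. shifted_sq e (\<xi> + h *\<^sub>R b)) has_real_derivative 2 * ((\<xi> + h *\<^sub>R b) \<bullet> b)) (at h)"
  unfolding shifted_sq_def power2_norm_eq_inner
  by (auto intro!: derivative_eq_intros simp: inner_add_left inner_add_right inner_commute algebra_simps)

text \<open>The three terms come from the monomial, the power and the exponential. For k = 0 the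
  truncated \<open>k - 1\<close> is harmless because its coefficient vanishes.\<close>

lemma reg_term_has_derivative:
  assumes "b \<in> Basis" "0 < e"
  shows "((\<lambda>h. reg_term d b e k s (\<xi> + h *\<^sub>R b)) has_real_derivative
     real k * reg_term d b e (k - 1) s (\<xi> + h *\<^sub>R b) + 2 * s * reg_term d b e (k + 1) (s - 1) (\<xi> + h *\<^sub>R b)
       - d * reg_term d b e (k + 1) (s - 1 + d / 2) (\<xi> + h *\<^sub>R b)) (at h)"
proof -
  let ?q = "\<lambda>h. shifted_sq e (\<xi> + h *\<^sub>R b)" and ?c = "\<lambda>h. (\<xi> + h *\<^sub>R b) \<bullet> b"
  have q: "?q h > 0" using assms by (intro shifted_sq_pos)
  have c: "(?c has_real_derivative 1) (at h)"
    using assms by (auto intro!: derivative_eq_intros simp: inner_add_left)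
  have "((\<lambda>h. ?c h ^ k * ?q h powr s * exp (- (?q h powr (d / 2)))) has_real_derivative
     real k * ?c h ^ (k - 1) * ?q h powr s * exp (- (?q h powr (d / 2)))
     + ?c h ^ k * (s * ?q h powr (s - 1) * (2 * ?c h)) * exp (- (?q h powr (d / 2)))
     + ?c h ^ k * ?q h powr s *
       (exp (- (?q h powr (d / 2))) * - (d / 2 * ?q h powr (d / 2 - 1) * (2 * ?c h)))) (at h)"
  proof -
    have p: "((\<lambda>h. ?q h powr r) has_real_derivative r * ?q h powr (r - 1) * (2 * ?c h)) (at h)" for r
      using DERIV_chain2[OF has_real_derivative_powr[OF q, of r] shifted_sq_has_derivative[of e \<xi> b h]]
      by simp
    have x: "((\<lambda>h. exp (- (?q h powr (d / 2)))) has_real_derivative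
        exp (- (?q h powr (d / 2))) * - (d / 2 * ?q h powr (d / 2 - 1) * (2 * ?c h))) (at h)"
      by (rule DERIV_fun_exp[OF DERIV_minus[OF p]])
    have k: "((\<lambda>h. ?c h ^ k) has_real_derivative real k * ?c h ^ (k - 1)) (at h)"
      using DERIV_power[OF c, of k] by simp
    show ?thesis
      by (rule DERIV_cong[OF DERIV_mult[OF DERIV_mult[OF k p] x]]) (simp add: algebra_simps)
  qed
  moreover have "?q h powr (s + d / 2 - 1) = ?q h powr s * ?q h powr (d / 2 - 1)"
    by (simp add: powr_add[symmetric] add_diff_eq)
  ultimately show ?thesis
    unfolding reg_term_def by (elim DERIV_cong) (simp add: algebra_simps)
qed

section \<open>Fourier integral bounds uniform in the regularization\<close>

text \<open>\<open>R\<close> collects the part of a monomial that does not vary along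
  \<open>b\<close> and hence acts as a constant under differentiation; \<rho> is its degree.\<close>

locale fourier_symbol =
  fixes R :: "'a::euclidean_space \<Rightarrow> complex" and b :: 'a and \<rho> :: nat and d :: real
  assumes measurable_R [measurable]: "R \<in> borel_measurable borel"
    and norm_R: "\<And>\<xi>. cmod (R \<xi>) \<le> norm \<xi> ^ \<rho>"
    and R_shift: "\<And>\<xi> h. R (\<xi> + h *\<^sub>R b) = R \<xi>"
    and b: "b \<in> Basis" and d: "1 < d"
begin

definition reg_symbol :: "real \<Rightarrow> nat \<Rightarrow> real \<Rightarrow> 'a \<Rightarrow> complex" where
  "reg_symbol e k s \<xi> = R \<xi> * complex_of_real (reg_term d b e k s \<xi>)"

definition reg_fourier :: "real \<Rightarrow> nat \<Rightarrow> real \<Rightarrow> 'a \<Rightarrow> complex" where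
  "reg_fourier e k s x = (LINT \<xi>|lborel. exp (\<i> * complex_of_real (x \<bullet> \<xi>)) * reg_symbol e k s \<xi>)"

lemma measurable_reg_symbol [measurable]: "reg_symbol e k s \<in> borel_measurable borel"
  unfolding reg_symbol_def by measurable

text \<open>Both |\<xi>| and |\<xi> \<bullet> b| are at most the square root of the shifted square
  q, so the size of the symbol is governed by one power of q, half the degree \<rho> + k + 2
  s.\<close>

lemma norm_reg_symbol_le:
  assumes "0 < e"
  shows "cmod (reg_symbol e k s \<xi>) \<le>
    shifted_sq e \<xi> powr ((real \<rho> + real k + 2 * s) / 2) * exp (- (shifted_sq e \<xi> powr (d / 2)))"
proof -
  let ?q = "shifted_sq e \<xi>"
  have q: "?q > 0" using assms by (intro shifted_sq_pos)
  have n: "norm \<xi> ^ m \<le> ?q powr (real m / 2)" for m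
  proof -
    have "norm \<xi> ^ m \<le> sqrt ?q ^ m"
      using norm_le_sqrt_shifted_sq[of e \<xi>] assms by (intro power_mono) auto
    also have "\<dots> = ?q powr (real m / 2)"
      using q by (simp add: powr_half_sqrt[symmetric] powr_realpow[symmetric] powr_powr)
    finally show ?thesis .
  qed
  have "\<bar>\<xi> \<bullet> b\<bar> \<le> norm \<xi>"
    using Basis_le_norm[OF b] by auto
  then have "\<bar>\<xi> \<bullet> b\<bar> ^ k \<le> norm \<xi> ^ k"
    by (intro power_mono) auto
  then have "cmod (R \<xi>) * \<bar>\<xi> \<bullet> b\<bar> ^ k \<le> ?q powr (real \<rho> / 2) * ?q powr (real k / 2)"
    using norm_R[of \<xi>] n[of \<rho>] n[of k] by (intro mult_mono) auto
  then have "(cmod (R \<xi>) * \<bar>\<xi> \<bullet> b\<bar> ^ k) * (?q powr s * exp (- (?q powr (d / 2)))) \<le>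
      (?q powr (real \<rho> / 2) * ?q powr (real k / 2)) * (?q powr s * exp (- (?q powr (d / 2))))"
    by (intro mult_right_mono) auto
  moreover have "?q powr (real \<rho> / 2) * ?q powr (real k / 2) * ?q powr s = ?q powr ((real \<rho> + real k + 2 * s) / 2)"
    by (simp add: powr_add[symmetric] add_divide_distrib)
  ultimately show ?thesis
    unfolding reg_symbol_def reg_term_def norm_mult norm_of_real abs_mult power_abs[symmetric] abs_exp_cancel
    by (simp add: mult.assoc[symmetric])
qed

lemma norm_reg_symbol_le_decay_kernel:
  assumes "0 < e"
  shows "\<exists>C. \<forall>\<xi>. cmod (reg_symbol e k s \<xi>) \<le> C * decay_kernel 1 \<xi>"
proof -
  obtain C where "\<And>\<xi>::'a. shifted_sq e \<xi> powr ((real \<rho> + real k + 2 * s) / 2) *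
      exp (- (shifted_sq e \<xi> powr (d / 2))) \<le> C * decay_kernel 1 \<xi>"
    using shifted_sq_powr_exp_le_decay_kernel[of d e "real \<rho> + real k + 2 * s"] assms d by auto
  then show ?thesis
    by (intro exI[of _ C] allI order_trans[OF norm_reg_symbol_le[OF assms]])
qed

lemma integrable_reg_symbol:
  assumes "0 < e"
  shows "integrable lborel (\<lambda>\<xi>. exp (\<i> * complex_of_real (x \<bullet> \<xi>)) * reg_symbol e k s \<xi>)"
proof -
  obtain C where C: "\<And>\<xi>. cmod (reg_symbol e k s \<xi>) \<le> C * decay_kernel 1 \<xi>"
    using norm_reg_symbol_le_decay_kernel[OF assms] by blast
  have "integrable lborel (\<lambda>\<xi>::'a. C * decay_kernel 1 \<xi>)"
    using nn_integral_decay_kernel_one[where 'a='a]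
    by (intro integrable_mult_right integrableI_nonneg) (auto simp: decay_kernel_nonneg)
  then show ?thesis
    by (rule Bochner_Integration.integrable_bound)
       (use C in \<open>auto simp: norm_mult intro!: order_trans[OF _ abs_ge_self]\<close>)
qed

text \<open>The decay constants depend on e but only license the integration by parts; the
  coefficients of the resulting inequality are free of e, so it can be iterated uniformly.\<close>

lemma reg_fourier_step:
  assumes "0 < e"
  shows "\<bar>x \<bullet> b\<bar> * cmod (reg_fourier e k s x) \<le> real k * cmod (reg_fourier e (k - 1) s x) +
     2 * \<bar>s\<bar> * cmod (reg_fourier e (k + 1) (s - 1) x) + d * cmod (reg_fourier e (k + 1) (s - 1 + d / 2) x)"
proof -
  define f' where "f' \<xi> = of_nat k * reg_symbol e (k - 1) s \<xi> + complex_of_real (2 * s) * reg_symbol e (k + 1) (s - 1) \<xi>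
      - complex_of_real d * reg_symbol e (k + 1) (s - 1 + d / 2) \<xi>" for \<xi>
  have deriv: "((\<lambda>h. reg_symbol e k s (\<xi> + h *\<^sub>R b)) has_vector_derivative f' (\<xi> + h *\<^sub>R b)) (at h)" for \<xi> h
  proof -
    have "((\<lambda>h. R \<xi> * complex_of_real (reg_term d b e k s (\<xi> + h *\<^sub>R b))) has_vector_derivative
       R \<xi> * complex_of_real (real k * reg_term d b e (k - 1) s (\<xi> + h *\<^sub>R b)
         + 2 * s * reg_term d b e (k + 1) (s - 1) (\<xi> + h *\<^sub>R b)
         - d * reg_term d b e (k + 1) (s - 1 + d / 2) (\<xi> + h *\<^sub>R b))) (at h)"
      using reg_term_has_derivative[OF b assms]
      by (intro has_vector_derivative_mult_right has_vector_derivative_of_real)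
         (simp add: has_real_derivative_iff_has_vector_derivative)
    then show ?thesis
      by (simp add: reg_symbol_def f'_def R_shift algebra_simps)
  qed
  obtain C0 where C0: "\<And>\<xi>. cmod (reg_symbol e k s \<xi>) \<le> C0 * decay_kernel 1 \<xi>"
    using norm_reg_symbol_le_decay_kernel[OF assms] by blast
  obtain C1 where C1: "\<And>\<xi>. cmod (reg_symbol e (k - 1) s \<xi>) \<le> C1 * decay_kernel 1 \<xi>"
    using norm_reg_symbol_le_decay_kernel[OF assms] by blast
  obtain C2 where C2: "\<And>\<xi>. cmod (reg_symbol e (k + 1) (s - 1) \<xi>) \<le> C2 * decay_kernel 1 \<xi>"
    using norm_reg_symbol_le_decay_kernel[OF assms] by blast
  obtain C3 where C3: "\<And>\<xi>. cmod (reg_symbol e (k + 1) (s - 1 + d / 2) \<xi>) \<le> C3 * decay_kernel 1 \<xi>"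
    using norm_reg_symbol_le_decay_kernel[OF assms] by blast
  define C where "C = max C0 (real k * C1 + 2 * \<bar>s\<bar> * C2 + d * C3)"
  have f'_le: "cmod (f' \<xi>) \<le> C * decay_kernel 1 \<xi>" for \<xi>
  proof -
    have "cmod (f' \<xi>) \<le> real k * cmod (reg_symbol e (k - 1) s \<xi>) + 2 * \<bar>s\<bar> * cmod (reg_symbol e (k + 1) (s - 1) \<xi>)
        + d * cmod (reg_symbol e (k + 1) (s - 1 + d / 2) \<xi>)"
      unfolding f'_def using d
      by (intro order_trans[OF norm_triangle_ineq4] add_mono order_trans[OF norm_triangle_ineq])
         (auto simp: norm_mult)
    also have "\<dots> \<le> real k * (C1 * decay_kernel 1 \<xi>) + 2 * \<bar>s\<bar> * (C2 * decay_kernel 1 \<xi>) + d * (C3 * decay_kernel 1 \<xi>)"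
      using d by (intro add_mono mult_left_mono C1 C2 C3) auto
    also have "\<dots> = (real k * C1 + 2 * \<bar>s\<bar> * C2 + d * C3) * decay_kernel 1 \<xi>"
      by (simp add: algebra_simps)
    also have "\<dots> \<le> C * decay_kernel 1 \<xi>"
      unfolding C_def by (intro mult_right_mono decay_kernel_nonneg) auto
    finally show ?thesis .
  qed
  have f_le: "cmod (reg_symbol e k s \<xi>) \<le> C * decay_kernel 1 \<xi>" for \<xi>
    using C0[of \<xi>] unfolding C_def
    by (rule order_trans) (intro mult_right_mono decay_kernel_nonneg, auto)
  have [measurable]: "f' \<in> borel_measurable borel"
    unfolding f'_def by measurable
  let ?e = "\<lambda>\<xi>. exp (\<i> * complex_of_real (x \<bullet> \<xi>))"
  have "(LINT \<xi>|lborel. ?e \<xi> * f' \<xi>) = (LINT \<xi>|lborel. of_nat k * (?e \<xi> * reg_symbol e (k - 1) s \<xi>) +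
      complex_of_real (2 * s) * (?e \<xi> * reg_symbol e (k + 1) (s - 1) \<xi>)
      - complex_of_real d * (?e \<xi> * reg_symbol e (k + 1) (s - 1 + d / 2) \<xi>))"
    unfolding f'_def by (intro Bochner_Integration.integral_cong) (auto simp: algebra_simps)
  also have "\<dots> = of_nat k * reg_fourier e (k - 1) s x + complex_of_real (2 * s) * reg_fourier e (k + 1) (s - 1) x
      - complex_of_real d * reg_fourier e (k + 1) (s - 1 + d / 2) x"
    unfolding reg_fourier_def using integrable_reg_symbol[OF assms]
    by (subst Bochner_Integration.integral_diff Bochner_Integration.integral_add
        Bochner_Integration.integral_mult_right_zero;
        (intro Bochner_Integration.integrable_add integrable_mult_right)?)+ auto
  finally have "\<bar>x \<bullet> b\<bar> * cmod (reg_fourier e k s x) = cmod (of_nat k * reg_fourier e (k - 1) s x +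
      complex_of_real (2 * s) * reg_fourier e (k + 1) (s - 1) x - complex_of_real d * reg_fourier e (k + 1) (s - 1 + d / 2) x)"
    using fourier_integral_by_parts[of b "reg_symbol e k s" f' C x, OF b deriv _ _ f_le f'_le]
    by (simp add: reg_fourier_def)
  also have "\<dots> \<le> real k * cmod (reg_fourier e (k - 1) s x) +
     2 * \<bar>s\<bar> * cmod (reg_fourier e (k + 1) (s - 1) x) + d * cmod (reg_fourier e (k + 1) (s - 1 + d / 2) x)"
    using d by (intro order_trans[OF norm_triangle_ineq4] add_mono order_trans[OF norm_triangle_ineq])
         (auto simp: norm_mult)
  finally show ?thesis .
qed

text \<open>
  The hypothesis on \<open>(m, k, s)\<close> is stable under \<open>reg_fourier_step\<close>: each derivative lowers the degree
  \<open>\<rho> + k + 2 * s\<close> by one, or by \<open>1 - d < 0\<close>, and a polynomial prefactor (\<open>s = 0\<close>) never reaches a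
  negative degree. For \<open>m = 0\<close> it makes the symbol integrable uniformly in \<open>e\<close>.
\<close>

lemma reg_fourier_bound:
  assumes "real m - DIM('a) < real \<rho> + real k + 2 * s \<or> s = 0 \<and> m \<le> DIM('a) + 1"
  shows "\<exists>C. \<forall>e\<in>{0<..1}. \<forall>x. \<bar>x \<bullet> b\<bar> ^ m * cmod (reg_fourier e k s x) \<le> C"
  using assms
proof (induction m arbitrary: k s)
  case 0
  \<comment> \<open>In the second alternative s = 0, and the degree \<rho> + k is
    nonnegative.\<close>
  then have "- DIM('a) < real \<rho> + real k + 2 * s"
    using DIM_positive[where 'a='a] by (auto intro: less_le_trans[of _ 0])
  then obtain g where g: "integrable lborel g" "\<And>x::'a. 0 \<le> g x"
    "\<And>e x. e \<in> {0..1} \<Longrightarrow> x \<noteq> 0 \<Longrightarrow> shifted_sq e x powr ((real \<rho> + real k + 2 * s) / 2) *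
       exp (- (shifted_sq e x powr (d / 2))) \<le> g x"
    using shifted_sq_powr_exp_dominated[of d 1 "real \<rho> + real k + 2 * s", where 'a='a] d by auto
  have "cmod (reg_fourier e k s x) \<le> integral\<^sup>L lborel g" if e: "e \<in> {0<..1}" for e x
  proof -
    have "AE \<xi> in lborel. norm (exp (\<i> * complex_of_real (x \<bullet> \<xi>)) * reg_symbol e k s \<xi>) \<le> g \<xi>"
      using AE_lborel_singleton[of "0::'a"]
    proof eventually_elim
      case (elim \<xi>)
      show ?case
        using norm_reg_symbol_le[of e k s \<xi>] g(3)[of e \<xi>] e elim by (auto simp: norm_mult)
    qed
    then show ?thesis
      unfolding reg_fourier_def using integrable_reg_symbol[of e x k s] g(1) e
      by (intro order_trans[OF integral_norm_bound] integral_mono_AE) auto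
  qed
  then show ?case by (intro exI[of _ "integral\<^sup>L lborel g"]) auto
next
  case (Suc m)
  have "\<exists>C1. \<forall>e\<in>{0<..1}. \<forall>x. \<bar>x \<bullet> b\<bar> ^ m * (real k * cmod (reg_fourier e (k - 1) s x)) \<le> C1"
  proof (cases "k = 0")
    case False
    then obtain C1 where C1: "\<forall>e\<in>{0<..1}. \<forall>x. \<bar>x \<bullet> b\<bar> ^ m * cmod (reg_fourier e (k - 1) s x) \<le> C1"
      using Suc.IH[of "k - 1" s] Suc.prems by (auto simp: of_nat_diff)
    then have "\<forall>e\<in>{0<..1}. \<forall>x. real k * (\<bar>x \<bullet> b\<bar> ^ m * cmod (reg_fourier e (k - 1) s x)) \<le> real k * C1"
      by (auto intro!: mult_left_mono)
    then show ?thesis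
      by (auto simp: mult.left_commute)
  qed auto
  then obtain C1 where C1: "\<And>e x. e \<in> {0<..1} \<Longrightarrow> \<bar>x \<bullet> b\<bar> ^ m * (real k * cmod (reg_fourier e (k - 1) s x)) \<le> C1"
    by blast
  have "\<exists>C2. \<forall>e\<in>{0<..1}. \<forall>x. \<bar>x \<bullet> b\<bar> ^ m * (2 * \<bar>s\<bar> * cmod (reg_fourier e (k + 1) (s - 1) x)) \<le> C2"
  proof (cases "s = 0")
    case False
    then obtain C2 where C2: "\<forall>e\<in>{0<..1}. \<forall>x. \<bar>x \<bullet> b\<bar> ^ m * cmod (reg_fourier e (k + 1) (s - 1) x) \<le> C2"
      using Suc.IH[of "k + 1" "s - 1"] Suc.prems by auto
    then have "\<forall>e\<in>{0<..1}. \<forall>x. 2 * \<bar>s\<bar> * (\<bar>x \<bullet> b\<bar> ^ m * cmod (reg_fourier e (k + 1) (s - 1) x)) \<le> 2 * \<bar>s\<bar> * C2"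
      by (intro ballI allI mult_left_mono) auto
    then show ?thesis
      by (metis mult.left_commute)
  qed auto
  then obtain C2 where C2: "\<And>e x. e \<in> {0<..1} \<Longrightarrow> \<bar>x \<bullet> b\<bar> ^ m * (2 * \<bar>s\<bar> * cmod (reg_fourier e (k + 1) (s - 1) x)) \<le> C2"
    by blast
  \<comment> \<open>In the second alternative s = 0 and m \<le> N, while the new degree \<rho> + k -
    1 + d is positive because d > 1. This is where d > 1 decides.\<close>
  have "real m - DIM('a) < real \<rho> + real (k + 1) + 2 * (s - 1 + d / 2)"
    using Suc.prems d by auto
  then obtain C3 where C3: "\<And>e x. e \<in> {0<..1} \<Longrightarrow> \<bar>x \<bullet> b\<bar> ^ m * cmod (reg_fourier e (k + 1) (s - 1 + d / 2) x) \<le> C3"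
    using Suc.IH[of "k + 1" "s - 1 + d / 2"] by blast
  have "\<bar>x \<bullet> b\<bar> ^ Suc m * cmod (reg_fourier e k s x) \<le> C1 + C2 + d * C3" if e: "e \<in> {0<..1}" for e x
  proof -
    have "\<bar>x \<bullet> b\<bar> ^ Suc m * cmod (reg_fourier e k s x) = \<bar>x \<bullet> b\<bar> ^ m * (\<bar>x \<bullet> b\<bar> * cmod (reg_fourier e k s x))"
      by (simp add: mult.left_commute)
    also have "\<dots> \<le> \<bar>x \<bullet> b\<bar> ^ m * (real k * cmod (reg_fourier e (k - 1) s x) +
     2 * \<bar>s\<bar> * cmod (reg_fourier e (k + 1) (s - 1) x) + d * cmod (reg_fourier e (k + 1) (s - 1 + d / 2) x))"
      using e by (intro mult_left_mono reg_fourier_step) auto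
    also have "\<dots> = \<bar>x \<bullet> b\<bar> ^ m * (real k * cmod (reg_fourier e (k - 1) s x)) +
       \<bar>x \<bullet> b\<bar> ^ m * (2 * \<bar>s\<bar> * cmod (reg_fourier e (k + 1) (s - 1) x)) +
       d * (\<bar>x \<bullet> b\<bar> ^ m * cmod (reg_fourier e (k + 1) (s - 1 + d / 2) x))"
      by (simp add: algebra_simps)
    also have "\<dots> \<le> C1 + C2 + d * C3"
      using d by (intro add_mono mult_left_mono C1 C2 C3 e) auto
    finally show ?thesis .
  qed
  then show ?case by blast
qed

text \<open>The start s = 0, m = N + 1 is the extreme case that \<open>reg_fourier_bound\<close>
  admits. Its constant is free of e, so it survives the limit, in which dominated convergence
  restores the singular symbol.\<close>

lemma fourier_limit_bound:
  "\<exists>C. \<forall>x. \<bar>x \<bullet> b\<bar> ^ (DIM('a) + 1) * cmod (LINT \<xi>|lborel. exp (\<i> * complex_of_real (x \<bullet> \<xi>)) *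
      (R \<xi> * complex_of_real ((\<xi> \<bullet> b) ^ k * exp (- (norm \<xi> powr d))))) \<le> C"
proof -
  obtain C where C: "\<And>e x. e \<in> {0<..1} \<Longrightarrow> \<bar>x \<bullet> b\<bar> ^ (DIM('a) + 1) * cmod (reg_fourier e k 0 x) \<le> C"
    using reg_fourier_bound[of "DIM('a) + 1" k 0] by blast
  have "- DIM('a) < real \<rho> + real k + 2 * 0"
    using DIM_positive[where 'a='a] by linarith
  then obtain g where g: "integrable lborel g" "\<And>x::'a. 0 \<le> g x"
    "\<And>e x. e \<in> {0..1} \<Longrightarrow> x \<noteq> 0 \<Longrightarrow> shifted_sq e x powr ((real \<rho> + real k + 2 * 0) / 2) *
       exp (- (shifted_sq e x powr (d / 2))) \<le> g x"
    using shifted_sq_powr_exp_dominated[of d 1 "real \<rho> + real k + 2 * 0", where 'a='a] d by auto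
  define e where "e n = 1 / real (Suc n)" for n
  have e: "e n \<in> {0<..1}" for n by (auto simp: e_def)
  have e0: "e \<longlonglongrightarrow> 0" unfolding e_def using lim_1_over_n LIMSEQ_Suc by fastforce
  have "\<bar>x \<bullet> b\<bar> ^ (DIM('a) + 1) * cmod (LINT \<xi>|lborel. exp (\<i> * complex_of_real (x \<bullet> \<xi>)) *
      (R \<xi> * complex_of_real ((\<xi> \<bullet> b) ^ k * exp (- (norm \<xi> powr d))))) \<le> C" for x
  proof -
    have "(\<lambda>n. reg_fourier (e n) k 0 x) \<longlonglongrightarrow> (LINT \<xi>|lborel. exp (\<i> * complex_of_real (x \<bullet> \<xi>)) *
      (R \<xi> * complex_of_real ((\<xi> \<bullet> b) ^ k * exp (- (norm \<xi> powr d)))))"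
      unfolding reg_fourier_def
    proof (rule integral_dominated_convergence[where w = g])
      show "AE \<xi> in lborel. norm (exp (\<i> * complex_of_real (x \<bullet> \<xi>)) * reg_symbol (e n) k 0 \<xi>) \<le> g \<xi>" for n
        using AE_lborel_singleton[of "0::'a"]
      proof eventually_elim
        case (elim \<xi>)
        show ?case
          using norm_reg_symbol_le[of "e n" k 0 \<xi>] g(3)[of "e n" \<xi>] e[of n] elim by (auto simp: norm_mult)
      qed
      show "AE \<xi> in lborel. (\<lambda>n. exp (\<i> * complex_of_real (x \<bullet> \<xi>)) * reg_symbol (e n) k 0 \<xi>) \<longlonglongrightarrow>
        exp (\<i> * complex_of_real (x \<bullet> \<xi>)) * (R \<xi> * complex_of_real ((\<xi> \<bullet> b) ^ k * exp (- (norm \<xi> powr d))))"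
        using AE_lborel_singleton[of "0::'a"]
      proof eventually_elim
        case (elim \<xi>)
        have s: "(\<lambda>n. shifted_sq (e n) \<xi>) \<longlonglongrightarrow> (norm \<xi>)\<^sup>2"
          unfolding shifted_sq_def using tendsto_add[OF tendsto_const e0, of "(norm \<xi>)\<^sup>2"] by simp
        have "(\<lambda>n. shifted_sq (e n) \<xi> powr (d / 2)) \<longlonglongrightarrow> (norm \<xi>)\<^sup>2 powr (d / 2)"
          using elim by (intro tendsto_powr s tendsto_const) auto
        also have "(norm \<xi>)\<^sup>2 powr (d / 2) = norm \<xi> powr d"
          using elim by (simp add: powr_powr flip: powr_numeral)
        finally have *: "(\<lambda>n. shifted_sq (e n) \<xi> powr (d / 2)) \<longlonglongrightarrow> norm \<xi> powr d" .
        have "reg_symbol (e n) k 0 \<xi> = R \<xi> * complex_of_real ((\<xi> \<bullet> b) ^ k * exp (- (shifted_sq (e n) \<xi> powr (d / 2))))" for n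
          using shifted_sq_pos[of "e n" \<xi>] e[of n] by (simp add: reg_symbol_def reg_term_def)
        then show ?case
          using * by (auto intro!: tendsto_intros)
      qed
    qed (use g in auto)
    then have "(\<lambda>n. \<bar>x \<bullet> b\<bar> ^ (DIM('a) + 1) * cmod (reg_fourier (e n) k 0 x)) \<longlonglongrightarrow>
      \<bar>x \<bullet> b\<bar> ^ (DIM('a) + 1) * cmod (LINT \<xi>|lborel. exp (\<i> * complex_of_real (x \<bullet> \<xi>)) *
      (R \<xi> * complex_of_real ((\<xi> \<bullet> b) ^ k * exp (- (norm \<xi> powr d)))))"
      by (intro tendsto_intros)
    then show ?thesis
      by (rule LIMSEQ_le_const2) (use C e in auto)
  qed
  then show ?thesis by blast
qed

end

section \<open>Derivatives of the heat kernel\<close>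

definition monomial_symbol :: "('n::finite \<Rightarrow> nat) \<Rightarrow> real ^ 'n \<Rightarrow> complex" where
  "monomial_symbol \<alpha> \<xi> = (\<Prod>j\<in>UNIV. (\<i> * complex_of_real (\<xi> $ j)) ^ \<alpha> j)"

text \<open>The formal result of differentiating (2 pi)^N G under the integral sign. It is estimated
  as a Fourier integral; that it really gives the iterated derivatives is
  \<open>multi_deriv_heat_kernel\<close>.\<close>

definition fourier_kernel :: "real \<Rightarrow> ('n::finite \<Rightarrow> nat) \<Rightarrow> real \<Rightarrow> real ^ 'n \<Rightarrow> complex" where
  "fourier_kernel d \<alpha> t x = (LINT \<xi>|lborel. monomial_symbol \<alpha> \<xi> *
     (exp (\<i> * complex_of_real (x \<bullet> \<xi>)) * complex_of_real (exp (- t * (norm \<xi> powr d)))))"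

lemma measurable_monomial_symbol [measurable]: "monomial_symbol \<alpha> \<in> borel_measurable borel"
  unfolding monomial_symbol_def by measurable

lemma norm_monomial_symbol_le: "cmod (monomial_symbol \<alpha> \<xi>) \<le> norm \<xi> ^ (\<Sum>j\<in>UNIV. \<alpha> j)"
proof -
  have "cmod (monomial_symbol \<alpha> \<xi>) = (\<Prod>j\<in>UNIV. \<bar>\<xi> $ j\<bar> ^ \<alpha> j)"
    by (simp add: monomial_symbol_def prod_norm[symmetric] norm_power norm_mult)
  also have "\<dots> \<le> (\<Prod>j\<in>UNIV. norm \<xi> ^ \<alpha> j)"
    by (intro prod_mono) (auto intro!: power_mono component_le_norm_cart)
  finally show ?thesis
    by (simp add: power_sum)
qed

text \<open>The case e = 0 of the uniform majorant. It is the dominating function for continuity and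
  differentiability of the kernel.\<close>

lemma integrable_norm_power_exp:
  assumes "0 < d" "0 < t"
  shows "integrable lborel (\<lambda>\<xi>::'a::euclidean_space. norm \<xi> ^ k * exp (- t * (norm \<xi> powr d)))"
proof -
  have "- DIM('a) < real k"
    using DIM_positive[where 'a='a] by linarith
  then obtain g where g: "integrable lborel g" "\<And>x::'a. 0 \<le> g x"
    "\<And>e x. e \<in> {0..1} \<Longrightarrow> x \<noteq> 0 \<Longrightarrow> shifted_sq e x powr (real k / 2) *
       exp (- t * (shifted_sq e x powr (d / 2))) \<le> g x"
    using shifted_sq_powr_exp_dominated[of d t "real k", where 'a='a] assms by auto
  show ?thesis
  proof (rule Bochner_Integration.integrable_bound[OF g(1)])
    show "AE \<xi> in lborel. norm (norm \<xi> ^ k * exp (- t * (norm \<xi> powr d))) \<le> norm (g \<xi>)"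
      using AE_lborel_singleton[of "0::'a"]
    proof eventually_elim
      case (elim \<xi>)
      have "shifted_sq 0 \<xi> powr (r / 2) = norm \<xi> powr r" for r
        using elim by (simp add: shifted_sq_def powr_powr flip: powr_numeral)
      then show ?case
        using g(3)[of 0 \<xi>] g(2)[of \<xi>] elim by (simp add: powr_realpow)
    qed
  qed auto
qed

lemma integrable_fourier_kernel:
  assumes "0 < d" "0 < t"
  shows "integrable lborel (\<lambda>\<xi>. monomial_symbol \<alpha> \<xi> *
     (exp (\<i> * complex_of_real (x \<bullet> \<xi>)) * complex_of_real (exp (- t * (norm \<xi> powr d)))))"
  by (rule Bochner_Integration.integrable_bound[OF integrable_norm_power_exp[OF assms, of "\<Sum>j\<in>UNIV. \<alpha> j"]])
     (auto simp: norm_mult abs_mult intro!: AE_I2 mult_right_mono norm_monomial_symbol_le)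

text \<open>Integration by parts along one axis gives decay in that coordinate only; since |x| is at
  most N times some coordinate modulus, choosing the axis according to x gives decay in |x|.\<close>

lemma fourier_kernel_one_bound:
  fixes \<alpha> :: "'n::finite \<Rightarrow> nat"
  assumes "1 < d"
  shows "\<exists>C. \<forall>x. cmod (fourier_kernel d \<alpha> 1 x) \<le> C * decay_kernel 1 x"
proof -
  let ?n = "CARD('n)"
  have "\<exists>C. \<forall>x. \<bar>x $ i\<bar> ^ (?n + 1) * cmod (fourier_kernel d \<alpha> 1 x) \<le> C" for i
  proof -
    \<comment> \<open>All factors except the power of coordinate \<open>i\<close>; the constant
      power of the imaginary unit that goes with it is put into \<open>R\<close> as well.\<close>
    define R where "R \<xi> = (\<Prod>j\<in>UNIV - {i}. (\<i> * complex_of_real (\<xi> $ j)) ^ \<alpha> j) * \<i> ^ \<alpha> i" for \<xi> :: "real ^ 'n"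
    interpret fourier_symbol R "axis i 1" "\<Sum>j\<in>UNIV - {i}. \<alpha> j" d
    proof
      show "R \<in> borel_measurable borel" unfolding R_def by measurable
      show "cmod (R \<xi>) \<le> norm \<xi> ^ (\<Sum>j\<in>UNIV - {i}. \<alpha> j)" for \<xi>
      proof -
        have "cmod (R \<xi>) = (\<Prod>j\<in>UNIV - {i}. \<bar>\<xi> $ j\<bar> ^ \<alpha> j)"
          by (simp add: R_def prod_norm[symmetric] norm_power norm_mult)
        also have "\<dots> \<le> (\<Prod>j\<in>UNIV - {i}. norm \<xi> ^ \<alpha> j)"
          by (intro prod_mono) (auto intro!: power_mono component_le_norm_cart)
        finally show ?thesis
          by (simp add: power_sum)
      qed
      show "R (\<xi> + h *\<^sub>R axis i 1) = R \<xi>" for \<xi> h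
        unfolding R_def by (intro arg_cong2[where f = "(*)"] prod.cong) (auto simp: axis_def)
      show "axis i 1 \<in> (Basis :: (real ^ 'n) set)"
        by simp
    qed fact
    have "monomial_symbol \<alpha> \<xi> = R \<xi> * complex_of_real ((\<xi> \<bullet> axis i 1) ^ \<alpha> i)" for \<xi>
      unfolding monomial_symbol_def R_def
      by (subst prod.remove[of UNIV i]) (auto simp: power_mult_distrib inner_axis mult_ac)
    then have "fourier_kernel d \<alpha> 1 x = (LINT \<xi>|lborel. exp (\<i> * complex_of_real (x \<bullet> \<xi>)) *
      (R \<xi> * complex_of_real ((\<xi> \<bullet> axis i 1) ^ \<alpha> i * exp (- (norm \<xi> powr d)))))" for x
      unfolding fourier_kernel_def by (intro Bochner_Integration.integral_cong) (auto simp: mult_ac)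
    then show ?thesis
      using fourier_limit_bound[of "\<alpha> i"] by (simp add: inner_axis)
  qed
  then obtain C where C: "\<And>i x. \<bar>x $ i\<bar> ^ (?n + 1) * cmod (fourier_kernel d \<alpha> 1 x) \<le> C i"
    by metis
  \<comment> \<open>The trivial bound, for points where all coordinates are small and the weighted
    bounds say nothing.\<close>
  define C0 where "C0 = (LINT \<xi>|lborel. norm (\<xi> :: real^'n) ^ (\<Sum>j\<in>UNIV. \<alpha> j) * exp (- 1 * (norm \<xi> powr d)))"
  have C0: "cmod (fourier_kernel d \<alpha> 1 x) \<le> C0" for x
    unfolding fourier_kernel_def C0_def
    using integrable_fourier_kernel[of d 1 \<alpha> x] integrable_norm_power_exp[of d 1 "\<Sum>j\<in>UNIV. \<alpha> j"] assms
    by (intro order_trans[OF integral_norm_bound] integral_mono_AE integrable_norm)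
       (auto simp: norm_mult abs_mult intro!: AE_I2 mult_right_mono norm_monomial_symbol_le)
  define D where "D = C0 + (\<Sum>i\<in>UNIV. \<bar>C i\<bar>)"
  have D: "C0 \<le> D" "C i \<le> D" for i
  proof -
    have "0 \<le> C0" using C0[of 0] norm_ge_zero order_trans by blast
    moreover have "\<bar>C i\<bar> \<le> (\<Sum>i\<in>UNIV. \<bar>C i\<bar>)" by (intro member_le_sum) auto
    ultimately show "C0 \<le> D" "C i \<le> D" by (auto simp: D_def sum_nonneg)
  qed
  have "cmod (fourier_kernel d \<alpha> 1 x) \<le> (2 * ?n) ^ (?n + 1) * D * decay_kernel 1 x" for x
  proof -
    \<comment> \<open>Otherwise the coordinate moduli would sum to less than |x|, against the
      comparison with the l1 norm.\<close>
    have "\<exists>i. norm x \<le> ?n * \<bar>x $ i\<bar>"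
    proof (rule ccontr)
      assume "\<not> ?thesis"
      then have "\<bar>x $ i\<bar> < norm x / ?n" for i
        by (simp add: not_le field_simps)
      then have "(\<Sum>i\<in>UNIV. \<bar>x $ i\<bar>) < (\<Sum>i\<in>(UNIV::'n set). norm x / ?n)"
        by (intro sum_strict_mono) auto
      then show False
        using norm_le_l1_cart[of x] by simp
    qed
    then obtain i where i: "norm x \<le> ?n * \<bar>x $ i\<bar>" ..
    \<comment> \<open>\<open>m\<close> merges both regimes: it equals 1 where the trivial bound is
      used, and 1 + |x| \<le> 2 m in either case.\<close>
    define m where "m = max 1 (?n * \<bar>x $ i\<bar>)"
    have m: "m ^ (?n + 1) * cmod (fourier_kernel d \<alpha> 1 x) \<le> ?n ^ (?n + 1) * D"
    proof (cases "?n * \<bar>x $ i\<bar> \<le> 1")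
      case True
      have "1 * cmod (fourier_kernel d \<alpha> 1 x) \<le> ?n ^ (?n + 1) * D"
        using C0[of x] D order_trans[OF norm_ge_zero C0[of x]] one_le_power[of "real ?n" "?n + 1"]
        by (intro mult_mono) (auto simp: Suc_le_eq)
      then show ?thesis
        using True by (simp add: m_def max_def)
    next
      case False
      have "?n ^ (?n + 1) * (\<bar>x $ i\<bar> ^ (?n + 1) * cmod (fourier_kernel d \<alpha> 1 x)) \<le> ?n ^ (?n + 1) * D"
        using order_trans[OF C[of x i] D(2)] by (intro mult_left_mono) auto
      then show ?thesis
        using False by (simp add: m_def max_def power_mult_distrib mult_ac)
    qed
    have "1 + norm x \<le> 2 * m"
      using i by (auto simp: m_def)
    then have "(1 + norm x) ^ (?n + 1) \<le> (2 * m) ^ (?n + 1)"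
      by (intro power_mono) auto
    then have "(1 + norm x) ^ (?n + 1) * cmod (fourier_kernel d \<alpha> 1 x) \<le>
        2 ^ (?n + 1) * (m ^ (?n + 1) * cmod (fourier_kernel d \<alpha> 1 x))"
      by (simp only: power_mult_distrib mult.assoc[symmetric]) (intro mult_right_mono norm_ge_zero)
    also have "\<dots> \<le> 2 ^ (?n + 1) * (?n ^ (?n + 1) * D)"
      using m by (intro mult_left_mono) auto
    finally show ?thesis
      using decay_denom_pos[of 1 x "?n + 1"]
      by (simp add: decay_kernel_def field_simps power_mult_distrib)
  qed
  then show ?thesis by blast
qed

text \<open>Substituting \<xi> / a normalizes the time to 1: the Jacobian contributes a^(-N), the
  monomial a^(-|\<alpha>|), and x is divided by a.\<close>

lemma fourier_kernel_scale:
  fixes \<alpha> :: "'n::finite \<Rightarrow> nat"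
  assumes "0 < a" "0 < d"
  shows "fourier_kernel d \<alpha> (a powr d) x =
    complex_of_real ((1 / a) ^ (CARD('n) + (\<Sum>j\<in>UNIV. \<alpha> j))) * fourier_kernel d \<alpha> 1 ((1 / a) *\<^sub>R x)"
proof -
  let ?F = "\<lambda>\<xi>. monomial_symbol \<alpha> \<xi> *
     (exp (\<i> * complex_of_real (x \<bullet> \<xi>)) * complex_of_real (exp (- (a powr d) * (norm \<xi> powr d))))"
  have F: "?F ((1 / a) *\<^sub>R \<xi>) = complex_of_real ((1 / a) ^ (\<Sum>j\<in>UNIV. \<alpha> j)) * (monomial_symbol \<alpha> \<xi> *
     (exp (\<i> * complex_of_real (((1 / a) *\<^sub>R x) \<bullet> \<xi>)) * complex_of_real (exp (- 1 * (norm \<xi> powr d)))))" for \<xi>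
  proof -
    have "monomial_symbol \<alpha> ((1 / a) *\<^sub>R \<xi>) = complex_of_real ((1 / a) ^ (\<Sum>j\<in>UNIV. \<alpha> j)) * monomial_symbol \<alpha> \<xi>"
      unfolding monomial_symbol_def power_sum of_real_prod prod.distrib[symmetric]
      by (intro prod.cong) (auto simp: power_mult_distrib[symmetric])
    moreover have "a powr d * (norm ((1 / a) *\<^sub>R \<xi>) powr d) = norm \<xi> powr d"
      using assms by (simp add: powr_divide powr_mult)
    ultimately show ?thesis by simp
  qed
  have "fourier_kernel d \<alpha> (a powr d) x =
     (LINT \<xi>|density (distr lborel borel (\<lambda>\<xi>. 0 + (1 / a) *\<^sub>R \<xi>)) (\<lambda>_. ennreal (\<bar>1 / a\<bar> ^ DIM(real^'n))). ?F \<xi>)"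
    unfolding fourier_kernel_def using lborel_affine[of "1 / a" "0 :: real ^ 'n"] assms by simp
  also have "\<dots> = complex_of_real ((1 / a) ^ CARD('n)) * (LINT \<xi>|lborel. ?F ((1 / a) *\<^sub>R \<xi>))"
    using assms by (simp add: integral_density integral_distr scaleR_conv_of_real[where 'a=complex])
  also have "(LINT \<xi>|lborel. ?F ((1 / a) *\<^sub>R \<xi>)) =
      complex_of_real ((1 / a) ^ (\<Sum>j\<in>UNIV. \<alpha> j)) * fourier_kernel d \<alpha> 1 ((1 / a) *\<^sub>R x)"
    unfolding F fourier_kernel_def by (rule integral_mult_right_zero)
  finally show ?thesis
    by (simp add: power_add mult.assoc)
qed

text \<open>With a = t^(1/d), the power a^(-N) turns the unit kernel at x / a into the kernel of
  scale a, and a^(-|\<alpha>|) = t^(-|\<alpha>|/d) is left over.\<close>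

lemma fourier_kernel_bound:
  fixes \<alpha> :: "'n::finite \<Rightarrow> nat"
  assumes "1 < d"
  shows "\<exists>C\<ge>0. \<forall>t>0. \<forall>x. cmod (fourier_kernel d \<alpha> t x) \<le>
    C * t powr (- real (\<Sum>j\<in>UNIV. \<alpha> j) / d) * decay_kernel (t powr (1 / d)) x"
proof -
  obtain C where C: "\<And>x. cmod (fourier_kernel d \<alpha> 1 x) \<le> C * decay_kernel 1 x"
    using fourier_kernel_one_bound[OF assms] by blast
  have "0 \<le> C"
    using order_trans[OF norm_ge_zero C[of 0]] by (simp add: decay_kernel_def)
  moreover have "cmod (fourier_kernel d \<alpha> t x) \<le>
    C * t powr (- real (\<Sum>j\<in>UNIV. \<alpha> j) / d) * decay_kernel (t powr (1 / d)) x" if t: "0 < t" for t x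
  proof -
    define a where "a = t powr (1 / d)"
    let ?k = "\<Sum>j\<in>UNIV. \<alpha> j"
    have a: "a > 0" "a powr d = t" using t assms by (auto simp: a_def powr_powr)
    have sc: "(1 / a) ^ CARD('n) * decay_kernel 1 ((1 / a) *\<^sub>R x) = decay_kernel a x"
    proof -
      have "1 + norm ((1 / a) *\<^sub>R x) = (a + norm x) / a"
        using a by (simp add: field_simps)
      then show ?thesis
        using a unfolding decay_kernel_def by (simp add: power_divide)
    qed
    have "t powr (- real ?k / d) = a powr (- real ?k)"
      by (simp add: a_def powr_powr)
    also have "\<dots> = (1 / a) ^ ?k"
      using a by (simp only: powr_minus powr_realpow power_one_over inverse_eq_divide)
    finally have tk: "t powr (- real ?k / d) = (1 / a) ^ ?k" .
    have "cmod (fourier_kernel d \<alpha> t x) = (1 / a) ^ (CARD('n) + ?k) * cmod (fourier_kernel d \<alpha> 1 ((1 / a) *\<^sub>R x))"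
      using fourier_kernel_scale[of a d \<alpha> x] a assms by (simp add: norm_mult norm_power norm_divide)
    also have "\<dots> \<le> (1 / a) ^ (CARD('n) + ?k) * (C * decay_kernel 1 ((1 / a) *\<^sub>R x))"
      using a by (intro mult_left_mono C) auto
    also have "\<dots> = C * (1 / a) ^ ?k * ((1 / a) ^ CARD('n) * decay_kernel 1 ((1 / a) *\<^sub>R x))"
      by (simp add: power_add mult_ac)
    finally show ?thesis
      unfolding sc tk a_def[symmetric] .
  qed
  ultimately show ?thesis by blast
qed

text \<open>Continuity is local, and for times above \<tau> the integrand is dominated by its size
  at time \<tau>.\<close>

lemma continuous_on_fourier_kernel:
  fixes \<alpha> :: "'n::finite \<Rightarrow> nat"
  assumes "0 < d"
  shows "continuous_on (UNIV \<times> {0<..}) (\<lambda>(x, t). fourier_kernel d \<alpha> t x)"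
proof (rule open_Times[THEN continuous_on_eq_continuous_at, THEN iffD2, OF open_UNIV open_greaterThan], rule ballI)
  fix z :: "(real ^ 'n) \<times> real" assume z: "z \<in> UNIV \<times> {0<..}"
  define \<tau> where "\<tau> = snd z / 2"
  have \<tau>: "\<tau> > 0" "z \<in> UNIV \<times> {\<tau><..}" using z by (cases z, auto simp: \<tau>_def)+
  have "continuous_on (UNIV \<times> {\<tau><..}) (\<lambda>(x, t). fourier_kernel d \<alpha> t x)"
    unfolding continuous_on_sequentially
  proof (intro allI ballI impI, elim conjE)
    fix s :: "nat \<Rightarrow> (real ^ 'n) \<times> real" and z
    assume s: "\<forall>n. s n \<in> UNIV \<times> {\<tau><..}" "s \<longlonglongrightarrow> z"
    have s1: "(\<lambda>n. fst (s n)) \<longlonglongrightarrow> fst z" and s2: "(\<lambda>n. snd (s n)) \<longlonglongrightarrow> snd z"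
      using s(2) by (auto intro: tendsto_fst tendsto_snd)
    have "(\<lambda>n. fourier_kernel d \<alpha> (snd (s n)) (fst (s n))) \<longlonglongrightarrow> fourier_kernel d \<alpha> (snd z) (fst z)"
      unfolding fourier_kernel_def
    proof (rule integral_dominated_convergence[OF _ _ integrable_norm_power_exp[OF assms \<tau>(1), of "\<Sum>j\<in>UNIV. \<alpha> j"]])
      show "AE \<xi> in lborel. (\<lambda>n. monomial_symbol \<alpha> \<xi> * (exp (\<i> * complex_of_real (fst (s n) \<bullet> \<xi>)) *
          complex_of_real (exp (- snd (s n) * (norm \<xi> powr d))))) \<longlonglongrightarrow> monomial_symbol \<alpha> \<xi> *
          (exp (\<i> * complex_of_real (fst z \<bullet> \<xi>)) * complex_of_real (exp (- snd z * (norm \<xi> powr d))))"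
        by (intro AE_I2 tendsto_intros s1 s2)
      show "AE \<xi> in lborel. norm (monomial_symbol \<alpha> \<xi> * (exp (\<i> * complex_of_real (fst (s n) \<bullet> \<xi>)) *
          complex_of_real (exp (- snd (s n) * (norm \<xi> powr d))))) \<le>
          norm \<xi> ^ (\<Sum>j\<in>UNIV. \<alpha> j) * exp (- \<tau> * (norm \<xi> powr d))" for n
      proof (intro AE_I2)
        fix \<xi> :: "real ^ 'n"
        have "\<tau> \<le> snd (s n)" using s(1) by (metis greaterThan_iff less_imp_le mem_Times_iff)
        then have "exp (- snd (s n) * (norm \<xi> powr d)) \<le> exp (- \<tau> * (norm \<xi> powr d))"
          by (simp add: mult_right_mono)
        then show "norm (monomial_symbol \<alpha> \<xi> * (exp (\<i> * complex_of_real (fst (s n) \<bullet> \<xi>)) *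
          complex_of_real (exp (- snd (s n) * (norm \<xi> powr d))))) \<le>
          norm \<xi> ^ (\<Sum>j\<in>UNIV. \<alpha> j) * exp (- \<tau> * (norm \<xi> powr d))"
          using norm_monomial_symbol_le[of \<alpha> \<xi>] by (simp add: norm_mult mult_mono)
      qed
    qed measurable
    then show "((\<lambda>(x, t). fourier_kernel d \<alpha> t x) \<circ> s) \<longlonglongrightarrow> (case z of (x, t) \<Rightarrow> fourier_kernel d \<alpha> t x)"
      by (simp add: comp_def case_prod_beta)
  qed
  then show "isCont (\<lambda>(x, t). fourier_kernel d \<alpha> t x) z"
    using \<tau>(2) continuous_on_eq_continuous_at[OF open_Times[OF open_UNIV open_greaterThan]] by blast
qed

section \<open>Identification with the iterated partial derivatives\<close>

lemma fourier_kernel_has_derivative: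
  fixes \<alpha> :: "'n::finite \<Rightarrow> nat"
  assumes "0 < d" "0 < t"
  shows "((\<lambda>h. fourier_kernel d \<alpha> t (x + h *\<^sub>R axis i 1)) has_vector_derivative
     fourier_kernel d (\<alpha>(i := Suc (\<alpha> i))) t x) (at 0)"
proof -
  let ?F = "\<lambda>\<beta> h \<xi>. monomial_symbol \<beta> \<xi> *
     (exp (\<i> * complex_of_real ((x + h *\<^sub>R axis i 1) \<bullet> \<xi>)) * complex_of_real (exp (- t * (norm \<xi> powr d))))"
  let ?\<alpha>' = "\<alpha>(i := Suc (\<alpha> i))"
  have sym: "monomial_symbol ?\<alpha>' \<xi> = monomial_symbol \<alpha> \<xi> * (\<i> * complex_of_real (\<xi> $ i))" for \<xi>
    unfolding monomial_symbol_def by (subst (1 2) prod.remove[of UNIV i]) auto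
  have "((\<lambda>h. LINT \<xi>|lborel. ?F \<alpha> h \<xi>) has_vector_derivative (LINT \<xi>|lborel. ?F ?\<alpha>' 0 \<xi>)) (at 0)"
  proof (rule has_vector_derivative_integral[OF _ _ _ _ integrable_norm_power_exp[OF assms, of "\<Sum>j\<in>UNIV. ?\<alpha>' j"]])
    fix h :: real and \<xi> :: "real ^ 'n"
    have "((\<lambda>h. exp (\<i> * complex_of_real (x \<bullet> \<xi>)) * exp (h *\<^sub>R (\<i> * complex_of_real (\<xi> $ i)))) has_vector_derivative
       exp (\<i> * complex_of_real (x \<bullet> \<xi>)) * (exp (h *\<^sub>R (\<i> * complex_of_real (\<xi> $ i))) * (\<i> * complex_of_real (\<xi> $ i)))) (at h)"
      by (intro has_vector_derivative_mult_right exp_scaleR_has_vector_derivative_right)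
    moreover have e: "exp (\<i> * complex_of_real (x \<bullet> \<xi>)) * exp (h *\<^sub>R (\<i> * complex_of_real (\<xi> $ i))) =
        exp (\<i> * complex_of_real ((x + h *\<^sub>R axis i 1) \<bullet> \<xi>))" for h
      by (simp add: exp_add[symmetric] inner_add_left inner_axis' inner_commute[of _ \<xi>] inner_axis
          scaleR_conv_of_real[where 'a=complex] algebra_simps)
    ultimately have "((\<lambda>h. exp (\<i> * complex_of_real ((x + h *\<^sub>R axis i 1) \<bullet> \<xi>))) has_vector_derivative
        exp (\<i> * complex_of_real ((x + h *\<^sub>R axis i 1) \<bullet> \<xi>)) * (\<i> * complex_of_real (\<xi> $ i))) (at h)"
      by (simp only: mult.assoc[symmetric])
    then have "((\<lambda>h. ?F \<alpha> h \<xi>) has_vector_derivative monomial_symbol \<alpha> \<xi> *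
        ((exp (\<i> * complex_of_real ((x + h *\<^sub>R axis i 1) \<bullet> \<xi>)) * (\<i> * complex_of_real (\<xi> $ i))) *
         complex_of_real (exp (- t * (norm \<xi> powr d))))) (at h)"
      by (intro has_vector_derivative_mult_right has_vector_derivative_mult_left)
    then show "((\<lambda>h. ?F \<alpha> h \<xi>) has_vector_derivative ?F ?\<alpha>' h \<xi>) (at h)"
      by (simp add: sym mult_ac)
    show "cmod (?F ?\<alpha>' h \<xi>) \<le> norm \<xi> ^ (\<Sum>j\<in>UNIV. ?\<alpha>' j) * exp (- t * (norm \<xi> powr d))"
      unfolding norm_mult[of "monomial_symbol ?\<alpha>' \<xi>"]
      by (intro mult_mono norm_monomial_symbol_le) (auto simp: norm_mult)
    show "integrable lborel (?F \<alpha> h)"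
      by (rule integrable_fourier_kernel[OF assms])
  qed measurable
  then show ?thesis
    by (simp add: fourier_kernel_def)
qed

definition kernel_deriv :: "real \<Rightarrow> ('n::finite \<Rightarrow> nat) \<Rightarrow> real ^ 'n \<Rightarrow> real \<Rightarrow> real" where
  "kernel_deriv d \<alpha> x t = Re (fourier_kernel d \<alpha> t x) / (2 * pi) ^ CARD('n)"

lemma heat_kernel_eq: "heat_kernel d x t = kernel_deriv d (\<lambda>_. 0) x t"
  by (simp add: heat_kernel_def heat_kernel_integral_def kernel_deriv_def fourier_kernel_def monomial_symbol_def)

lemma partial_deriv_kernel_deriv:
  fixes \<alpha> :: "'n::finite \<Rightarrow> nat"
  assumes "0 < d" "0 < t"
  shows "partial_deriv i (\<lambda>z. kernel_deriv d \<alpha> z t) = (\<lambda>z. kernel_deriv d (\<alpha>(i := Suc (\<alpha> i))) z t)"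
proof
  fix x
  have "((\<lambda>h. kernel_deriv d \<alpha> (x + h *\<^sub>R axis i 1) t) has_vector_derivative
      kernel_deriv d (\<alpha>(i := Suc (\<alpha> i))) x t) (at 0)"
    unfolding kernel_deriv_def
    by (intro has_vector_derivative_divide bounded_linear.has_vector_derivative[OF bounded_linear_Re]
        fourier_kernel_has_derivative assms)
  then show "partial_deriv i (\<lambda>z. kernel_deriv d \<alpha> z t) x = kernel_deriv d (\<alpha>(i := Suc (\<alpha> i))) x t"
    unfolding partial_deriv_def by (intro DERIV_imp_deriv) (simp add: has_real_derivative_iff_has_vector_derivative)
qed

lemma multi_deriv_heat_kernel:
  fixes \<alpha> :: "'n::finite \<Rightarrow> nat"
  assumes "0 < d" "0 < t"
  shows "multi_deriv \<alpha> (\<lambda>z. heat_kernel d z t) = (\<lambda>x. kernel_deriv d \<alpha> x t)"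
proof -
  have pow: "(partial_deriv i ^^ k) (\<lambda>z. kernel_deriv d \<beta> z t) = (\<lambda>z. kernel_deriv d (\<beta>(i := \<beta> i + k)) z t)"
    for i :: 'n and k \<beta>
    by (induction k) (simp_all add: partial_deriv_kernel_deriv[OF assms] fun_upd_same del: fun_upd_apply)
  \<comment> \<open>Invariant for a partial enumeration: coordinates outside the list carry exponent
    0, and distinctness makes each coordinate start from 0 when its turn comes.\<close>
  have fold: "foldr (\<lambda>i. partial_deriv i ^^ \<alpha> i) is (\<lambda>z. heat_kernel d z t) =
      (\<lambda>z. kernel_deriv d (\<lambda>j. if j \<in> set is then \<alpha> j else 0) z t)" if "distinct is" for "is"
    using that
  proof (induction "is")
    case Nil
    then show ?case by (simp add: heat_kernel_eq)
  next
    case (Cons i js)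
    have "(\<lambda>j. if j \<in> set js then \<alpha> j else 0)(i := (if i \<in> set js then \<alpha> i else 0) + \<alpha> i) =
        (\<lambda>j. if j \<in> set (i # js) then \<alpha> j else 0)"
      using Cons.prems by auto
    with Cons show ?case
      by (simp add: pow)
  qed
  \<comment> \<open>An enumeration exists, so \<open>SOME\<close> picks a genuine one; by
    \<open>fold\<close> the result depends only on its set of entries.\<close>
  have "\<exists>is. distinct is \<and> set is = (UNIV :: 'n set)"
    using finite_distinct_list[OF finite] by blast
  then have "distinct (SOME is. distinct is \<and> set is = (UNIV :: 'n set)) \<and>
      set (SOME is. distinct is \<and> set is = (UNIV :: 'n set)) = UNIV"
    by (rule someI_ex)
  then show ?thesis
    unfolding multi_deriv_def by (simp add: fold)
qed

lemma kernel_deriv_bound: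
  fixes \<alpha> :: "'n::finite \<Rightarrow> nat"
  assumes "1 < d"
  shows "\<exists>C\<ge>0. \<forall>t>0. \<forall>x. \<bar>kernel_deriv d \<alpha> x t\<bar> \<le>
    C * t powr (- real (\<Sum>j\<in>UNIV. \<alpha> j) / d) * decay_kernel (t powr (1 / d)) x"
proof -
  obtain C where C: "C \<ge> 0" "\<And>t x. t > 0 \<Longrightarrow> cmod (fourier_kernel d \<alpha> t x) \<le>
    C * t powr (- real (\<Sum>j\<in>UNIV. \<alpha> j) / d) * decay_kernel (t powr (1 / d)) x"
    using fourier_kernel_bound[OF assms, of \<alpha>] by blast
  have "1 \<le> (2 * pi) ^ CARD('n)"
    using pi_ge_two by (intro one_le_power) simp
  then have "\<bar>kernel_deriv d \<alpha> x t\<bar> \<le> cmod (fourier_kernel d \<alpha> t x) / 1" for x t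
    unfolding kernel_deriv_def abs_divide by (intro frac_le) (auto simp: abs_Re_le_cmod)
  then show ?thesis
    using C by (intro exI[of _ C] conjI allI impI order_trans[OF _ C(2)]) simp_all
qed

lemma continuous_on_kernel_deriv:
  assumes "0 < d"
  shows "continuous_on (UNIV \<times> {0<..}) (\<lambda>(x, t). kernel_deriv d \<alpha> x t)"
  using continuous_on_fourier_kernel[OF assms, of \<alpha>]
  unfolding kernel_deriv_def case_prod_beta by (intro continuous_intros) auto

section \<open>Averages of the initial datum\<close>

text \<open>Extended-valued, so that Fubini and comparisons can be used before finiteness is known;
  finiteness comes from the smallness of ball averages.\<close>

definition kernel_average :: "('a::euclidean_space \<Rightarrow> real) \<Rightarrow> real \<Rightarrow> 'a \<Rightarrow> ennreal" where
  "kernel_average \<phi> a x = (\<integral>\<^sup>+z. ennreal (decay_kernel a (x - z)) * ennreal \<bar>\<phi> z\<bar> \<partial>lborel)"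

lemma measurable_kernel_average [measurable]:
  assumes [measurable]: "\<phi> \<in> borel_measurable borel" "f \<in> borel_measurable M" "g \<in> borel_measurable M"
  shows "(\<lambda>x. kernel_average \<phi> (f x) (g x)) \<in> borel_measurable M"
  unfolding kernel_average_def by measurable

text \<open>Fubini moves the outer convolution onto the inner kernel, where the almost-semigroup
  property of the kernels applies for each z.\<close>

lemma kernel_average_semigroup:
  fixes x :: "'a::euclidean_space"
  assumes [measurable]: "\<phi> \<in> borel_measurable borel" and "0 < a" "0 < b"
  shows "(\<integral>\<^sup>+y. ennreal (decay_kernel a (x - y)) * kernel_average \<phi> b y \<partial>lborel) \<le>
    ennreal (2 ^ (DIM('a) + 2) * decay_mass TYPE('a)) * kernel_average \<phi> (a + b) x"
proof -
  have "(\<integral>\<^sup>+y. ennreal (decay_kernel a (x - y)) * kernel_average \<phi> b y \<partial>lborel) =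
     (\<integral>\<^sup>+y. \<integral>\<^sup>+z. ennreal (decay_kernel a (x - y)) * (ennreal (decay_kernel b (y - z)) * ennreal \<bar>\<phi> z\<bar>) \<partial>lborel \<partial>lborel)"
    unfolding kernel_average_def by (intro nn_integral_cong nn_integral_cmult[symmetric]) measurable
  also have "\<dots> = (\<integral>\<^sup>+z. \<integral>\<^sup>+y. ennreal (decay_kernel a (x - y)) * (ennreal (decay_kernel b (y - z)) * ennreal \<bar>\<phi> z\<bar>) \<partial>lborel \<partial>lborel)"
    by (rule lborel_pair.Fubini') measurable
  also have "\<dots> = (\<integral>\<^sup>+z. (\<integral>\<^sup>+y. ennreal (decay_kernel a (x - y)) * ennreal (decay_kernel b (y - z)) \<partial>lborel) * ennreal \<bar>\<phi> z\<bar> \<partial>lborel)"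
    by (intro nn_integral_cong) (simp add: nn_integral_multc mult.assoc[symmetric])
  also have "\<dots> \<le> (\<integral>\<^sup>+z. ennreal (2 ^ (DIM('a) + 2) * decay_mass TYPE('a)) *
      (ennreal (decay_kernel (a + b) (x - z)) * ennreal \<bar>\<phi> z\<bar>) \<partial>lborel)"
  proof (intro nn_integral_mono)
    fix z
    have "(\<integral>\<^sup>+y. ennreal (decay_kernel a (x - y)) * ennreal (decay_kernel b (y - z)) \<partial>lborel) \<le>
        ennreal (2 ^ (DIM('a) + 2) * decay_mass TYPE('a)) * ennreal (decay_kernel (a + b) (x - z))"
      using nn_integral_decay_kernel_mult[OF assms(2,3), of x z] assms decay_mass_nonneg[where 'a='a]
      by (subst ennreal_mult[symmetric]) (simp_all add: decay_kernel_nonneg)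
    then show "(\<integral>\<^sup>+y. ennreal (decay_kernel a (x - y)) * ennreal (decay_kernel b (y - z)) \<partial>lborel) * ennreal \<bar>\<phi> z\<bar> \<le>
        ennreal (2 ^ (DIM('a) + 2) * decay_mass TYPE('a)) * (ennreal (decay_kernel (a + b) (x - z)) * ennreal \<bar>\<phi> z\<bar>)"
      unfolding mult.assoc[symmetric] by (rule mult_right_mono) simp
  qed
  also have "\<dots> = ennreal (2 ^ (DIM('a) + 2) * decay_mass TYPE('a)) * kernel_average \<phi> (a + b) x"
    unfolding kernel_average_def by (intro nn_integral_cmult) measurable
  finally show ?thesis .
qed

lemma kernel_average_scale:
  fixes x :: "'a::euclidean_space"
  assumes [measurable]: "\<phi> \<in> borel_measurable borel" and "0 < a" "a \<le> b"
  shows "kernel_average \<phi> b x \<le> ennreal (b / a) * kernel_average \<phi> a x"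
proof -
  have "kernel_average \<phi> b x \<le> (\<integral>\<^sup>+z. ennreal (b / a) * (ennreal (decay_kernel a (x - z)) * ennreal \<bar>\<phi> z\<bar>) \<partial>lborel)"
    unfolding kernel_average_def
  proof (intro nn_integral_mono)
    fix z
    have "ennreal (decay_kernel b (x - z)) \<le> ennreal (b / a) * ennreal (decay_kernel a (x - z))"
      using decay_kernel_mono_scale[OF assms(2,3), of "x - z"] assms
      by (simp add: ennreal_mult[symmetric] decay_kernel_nonneg ennreal_leI)
    then show "ennreal (decay_kernel b (x - z)) * ennreal \<bar>\<phi> z\<bar> \<le>
        ennreal (b / a) * (ennreal (decay_kernel a (x - z)) * ennreal \<bar>\<phi> z\<bar>)"
      unfolding mult.assoc[symmetric] by (rule mult_right_mono) simp
  qed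
  also have "\<dots> = ennreal (b / a) * kernel_average \<phi> a x"
    unfolding kernel_average_def by (intro nn_integral_cmult) measurable
  finally show ?thesis .
qed

text \<open>
  The kernel varies by a bounded factor on balls of radius \<open>a\<close>, so it may be replaced by its
  average over such a ball; Fubini's theorem then produces the ball averages of \<open>\<phi>\<close>.
\<close>

lemma kernel_average_le_ball_average:
  fixes x :: "'a::euclidean_space"
  assumes [measurable]: "\<phi> \<in> borel_measurable borel" and "0 < a" "0 \<le> m"
    and ball: "\<And>z. (\<integral>\<^sup>+y. indicator (ball z a) y * ennreal \<bar>\<phi> y\<bar> \<partial>lborel) \<le>
      ennreal m * emeasure lborel (ball (0::'a) a)"
  shows "kernel_average \<phi> a x \<le> ennreal (2 ^ (DIM('a) + 1) * decay_mass TYPE('a) * m)"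
proof -
  let ?V = "emeasure lborel (ball (0::'a) a)" and ?c = "ennreal (2 ^ (DIM('a) + 1))"
  have V: "emeasure lborel (ball y a) = ?V" for y :: 'a
    using assms by (simp add: emeasure_ball)
  \<comment> \<open>The ball volume is cancelled at the end, so it must be neither 0 nor
    infinite.\<close>
  have V0: "?V \<noteq> 0" "?V \<noteq> top"
  proof -
    have "0 < unit_ball_vol DIM('a) * a ^ DIM('a)"
      using assms(2) by (intro mult_pos_pos zero_less_power unit_ball_vol_pos) auto
    moreover have "?V = ennreal (unit_ball_vol DIM('a) * a ^ DIM('a))"
      using assms(2) by (intro emeasure_ball) auto
    ultimately show "?V \<noteq> 0" "?V \<noteq> top"
      by (simp_all only: ennreal_eq_0_iff ennreal_neq_top not_le not_False_eq_True)
  qed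
  \<comment> \<open>Written through \<open>dist\<close>, the indicator is jointly measurable in
    centre and point and symmetric in them, as the exchange of integrals demands.\<close>
  have ind: "indicator (ball y a) z = (indicator {0..<a} (dist y z) :: ennreal)" for y z :: 'a
    by (auto simp: indicator_def)
  have K: "?V * ennreal (decay_kernel a (x - y)) \<le>
      ?c * (\<integral>\<^sup>+z. ennreal (decay_kernel a (x - z)) * indicator (ball y a) z \<partial>lborel)" for y
  proof -
    have "?V * ennreal (decay_kernel a (x - y)) = (\<integral>\<^sup>+z. ennreal (decay_kernel a (x - y)) * indicator (ball y a) z \<partial>lborel)"
      by (subst nn_integral_cmult_indicator) (simp_all add: V[of y] mult.commute)
    also have "\<dots> \<le> (\<integral>\<^sup>+z. ?c * (ennreal (decay_kernel a (x - z)) * indicator (ball y a) z) \<partial>lborel)"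
    proof (intro nn_integral_mono)
      fix z
      show "ennreal (decay_kernel a (x - y)) * indicator (ball y a) z \<le>
          ?c * (ennreal (decay_kernel a (x - z)) * indicator (ball y a) z)"
      proof (cases "z \<in> ball y a")
        case True
        then have "norm ((x - y) - (x - z)) \<le> a"
          by (simp add: dist_norm norm_minus_commute)
        then have "decay_kernel a (x - y) \<le> 2 ^ (DIM('a) + 1) * decay_kernel a (x - z)"
          using decay_kernel_shift assms(2) by blast
        then show ?thesis
          using True assms by (simp add: ennreal_mult[symmetric] decay_kernel_nonneg ennreal_leI del: power_Suc)
      qed simp
    qed
    also have "\<dots> = ?c * (\<integral>\<^sup>+z. ennreal (decay_kernel a (x - z)) * indicator (ball y a) z \<partial>lborel)"
      unfolding ind by (intro nn_integral_cmult) measurable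
    finally show ?thesis .
  qed
  have "?V * kernel_average \<phi> a x = (\<integral>\<^sup>+y. ?V * (ennreal (decay_kernel a (x - y)) * ennreal \<bar>\<phi> y\<bar>) \<partial>lborel)"
    unfolding kernel_average_def by (intro nn_integral_cmult[symmetric]) measurable
  also have "\<dots> \<le> (\<integral>\<^sup>+y. ?c * (\<integral>\<^sup>+z. ennreal (decay_kernel a (x - z)) * indicator (ball y a) z \<partial>lborel) * ennreal \<bar>\<phi> y\<bar> \<partial>lborel)"
    unfolding mult.assoc[of ?V, symmetric] by (intro nn_integral_mono mult_right_mono K) simp
  also have "\<dots> = (\<integral>\<^sup>+y. \<integral>\<^sup>+z. ?c * (ennreal (decay_kernel a (x - z)) * indicator {0..<a} (dist y z)) * ennreal \<bar>\<phi> y\<bar> \<partial>lborel \<partial>lborel)"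
    unfolding ind by (intro nn_integral_cong) (simp add: nn_integral_multc nn_integral_cmult)
  also have "\<dots> = (\<integral>\<^sup>+z. \<integral>\<^sup>+y. ?c * (ennreal (decay_kernel a (x - z)) * indicator {0..<a} (dist y z)) * ennreal \<bar>\<phi> y\<bar> \<partial>lborel \<partial>lborel)"
    by (rule lborel_pair.Fubini') measurable
  also have "\<dots> = (\<integral>\<^sup>+z. (?c * ennreal (decay_kernel a (x - z))) * (\<integral>\<^sup>+y. indicator (ball z a) y * ennreal \<bar>\<phi> y\<bar> \<partial>lborel) \<partial>lborel)"
    unfolding ind by (intro nn_integral_cong, subst nn_integral_cmult[symmetric])
       (measurable, simp add: mult.assoc dist_commute)
  also have "\<dots> \<le> (\<integral>\<^sup>+z. (?c * ennreal (decay_kernel a (x - z))) * (ennreal m * ?V) \<partial>lborel)"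
    by (intro nn_integral_mono mult_left_mono ball) simp
  also have "\<dots> = ?c * (\<integral>\<^sup>+z. ennreal (decay_kernel a (x - z)) \<partial>lborel) * (ennreal m * ?V)"
    by (subst nn_integral_multc) (simp_all add: nn_integral_cmult)
  also have "\<dots> = ?V * ennreal (2 ^ (DIM('a) + 1) * decay_mass TYPE('a) * m)"
    using assms decay_mass_nonneg[where 'a='a]
    by (simp add: nn_integral_decay_kernel ennreal_mult mult_ac del: power_Suc)
  finally show ?thesis
    using V0 by (simp add: ennreal_mult_le_mult_iff)
qed

section \<open>Time integrals with endpoint singularities\<close>

text \<open>The two integrals are exchanged by s to t - s. The case c = t serves the Beta integral,
  c = 2 e the error of cutting off the kernel near s = t.\<close>

lemma nn_integral_powr_reflect:
  fixes b t :: real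
  assumes "0 < b" "0 \<le> c" "c \<le> t"
  shows "(\<integral>\<^sup>+s. ennreal ((t - s) powr (b - 1)) * indicator {t - c<..<t} s \<partial>lborel) = ennreal (c powr b / b)"
    and "(\<integral>\<^sup>+s. ennreal (s powr (b - 1)) * indicator {0<..<c} s \<partial>lborel) = ennreal (c powr b / b)"
proof -
  show *: "(\<integral>\<^sup>+s. ennreal (s powr (b - 1)) * indicator {0<..<c} s \<partial>lborel) = ennreal (c powr b / b)"
  proof -
    have "((\<lambda>s. s powr (b - 1)) has_integral (c powr (b - 1 + 1) / (b - 1 + 1))) {0..c}"
      using assms by (intro has_integral_powr_from_0) auto
    then have "(\<integral>\<^sup>+s. ennreal (s powr (b - 1)) * indicator {0..c} s \<partial>lborel) = ennreal (c powr b / b)"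
      using nn_integral_has_integral_lebesgue'[of "{0..c}" "\<lambda>s. s powr (b - 1)" "c powr b / b"] by simp
    moreover have "(\<integral>\<^sup>+s. ennreal (s powr (b - 1)) * indicator {0..c} s \<partial>lborel) =
        (\<integral>\<^sup>+s. ennreal (s powr (b - 1)) * indicator {0<..<c} s \<partial>lborel)"
      by (rule nn_integral_cong_AE)
         (use AE_lborel_singleton[of 0] AE_lborel_singleton[of c] in \<open>eventually_elim, auto simp: indicator_def\<close>)
    ultimately show ?thesis by simp
  qed
  have "(\<integral>\<^sup>+s. ennreal ((t - s) powr (b - 1)) * indicator {t - c<..<t} s \<partial>lborel) =
      (\<integral>\<^sup>+s. ennreal ((t - (t + (-1) * s)) powr (b - 1)) * indicator {t - c<..<t} (t + (-1) * s) \<partial>lborel)"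
    by (subst nn_integral_real_affine[of _ "-1" t]) auto
  also have "\<dots> = (\<integral>\<^sup>+s. ennreal (s powr (b - 1)) * indicator {0<..<c} s \<partial>lborel)"
    by (intro nn_integral_cong) (auto simp: indicator_def)
  finally show "(\<integral>\<^sup>+s. ennreal ((t - s) powr (b - 1)) * indicator {t - c<..<t} s \<partial>lborel) = ennreal (c powr b / b)"
    using * by simp
qed

text \<open>At least one of \<open>s\<close> and \<open>t - s\<close> is not below \<open>t / 2\<close>, which bounds one of the two factors.\<close>

lemma nn_integral_beta_le:
  fixes \<mu> t :: real
  assumes "0 < \<mu>" "\<mu> < 1" "0 < t"
  shows "(\<integral>\<^sup>+s. ennreal ((t - s) powr (-\<mu>) * s powr (\<mu> - 1)) * indicator {0<..<t} s \<partial>lborel) \<le>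
    ennreal (2 / \<mu> + 2 / (1 - \<mu>))"
proof -
  let ?p = "(t / 2) powr (-\<mu>)" and ?q = "(t / 2) powr (\<mu> - 1)"
  \<comment> \<open>\<open>t - t\<close> and \<open>(1 - \<mu>) - 1\<close> stand unsimplified to
    match \<open>nn_integral_powr_reflect\<close>.\<close>
  have pt: "ennreal ((t - s) powr (-\<mu>) * s powr (\<mu> - 1)) * indicator {0<..<t} s \<le>
      ennreal ?p * (ennreal (s powr (\<mu> - 1)) * indicator {0<..<t} s) +
      ennreal ?q * (ennreal ((t - s) powr ((1 - \<mu>) - 1)) * indicator {t - t<..<t} s)" for s
  proof (cases "s \<in> {0<..<t}")
    case True
    have "(t - s) powr (-\<mu>) * s powr (\<mu> - 1) \<le> ?p * s powr (\<mu> - 1) + ?q * (t - s) powr (-\<mu>)"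
    proof (cases "s \<le> t / 2")
      case True
      then have "(t - s) powr (-\<mu>) * s powr (\<mu> - 1) \<le> ?p * s powr (\<mu> - 1)"
        using assms by (intro mult_right_mono powr_mono2') auto
      then show ?thesis by (simp add: add_increasing2)
    next
      case False
      then have "s powr (\<mu> - 1) * (t - s) powr (-\<mu>) \<le> ?q * (t - s) powr (-\<mu>)"
        using assms by (intro mult_right_mono powr_mono2') auto
      then show ?thesis by (simp add: add_increasing mult.commute)
    qed
    then show ?thesis
      using True by (simp add: ennreal_mult[symmetric] ennreal_plus[symmetric] ennreal_leI del: ennreal_plus)
  qed simp
  have p: "?p * (t powr \<mu> / \<mu>) = 2 powr \<mu> / \<mu>"
    using assms by (simp add: powr_divide powr_minus field_simps)
  have q: "?q * (t powr (1 - \<mu>) / (1 - \<mu>)) = 2 powr (1 - \<mu>) / (1 - \<mu>)"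
  proof -
    have "?q = (t / 2) powr - (1 - \<mu>)" by simp
    then show ?thesis
      unfolding powr_minus using assms by (simp add: powr_divide field_simps)
  qed
  have "(\<integral>\<^sup>+s. ennreal ((t - s) powr (-\<mu>) * s powr (\<mu> - 1)) * indicator {0<..<t} s \<partial>lborel) \<le>
      (\<integral>\<^sup>+s. ennreal ?p * (ennreal (s powr (\<mu> - 1)) * indicator {0<..<t} s) +
      ennreal ?q * (ennreal ((t - s) powr ((1 - \<mu>) - 1)) * indicator {t - t<..<t} s) \<partial>lborel)"
    by (intro nn_integral_mono pt)
  also have "\<dots> = ennreal ?p * ennreal (t powr \<mu> / \<mu>) + ennreal ?q * ennreal (t powr (1 - \<mu>) / (1 - \<mu>))"
    using nn_integral_powr_reflect[of \<mu> t t] nn_integral_powr_reflect[of "1 - \<mu>" t t] assms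
    by (simp add: nn_integral_add nn_integral_cmult)
  also have "\<dots> = ennreal (2 powr \<mu> / \<mu> + 2 powr (1 - \<mu>) / (1 - \<mu>))"
    using assms by (simp only: ennreal_mult'[symmetric] p q powr_ge_zero) (subst ennreal_plus, auto)
  also have "\<dots> \<le> ennreal (2 / \<mu> + 2 / (1 - \<mu>))"
  proof -
    have "(2::real) powr \<mu> \<le> 2" "(2::real) powr (1 - \<mu>) \<le> 2"
      using powr_mono[of \<mu> 1 2] powr_mono[of "1 - \<mu>" 1 2] assms by auto
    then show ?thesis
      using assms by (intro ennreal_leI add_mono divide_right_mono) auto
  qed
  finally show ?thesis .
qed

text \<open>A fraction in (0, 1] does not exceed its \<theta>-th power; this is applied to s / (s +
  r) and r / (s + r), which add up to 1.\<close>

lemma powr_subadditive: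
  fixes s r \<theta> :: real
  assumes "0 < s" "0 < r" "0 \<le> \<theta>" "\<theta> \<le> 1"
  shows "(s + r) powr \<theta> \<le> s powr \<theta> + r powr \<theta>"
proof -
  have *: "u / (s + r) * (s + r) powr \<theta> \<le> u powr \<theta>" if "0 < u" "u \<le> s + r" for u
  proof -
    have "(u / (s + r)) powr 1 \<le> (u / (s + r)) powr \<theta>"
      using that assms by (intro powr_mono') auto
    then have "u / (s + r) * (s + r) powr \<theta> \<le> (u / (s + r)) powr \<theta> * (s + r) powr \<theta>"
      using that assms by (intro mult_right_mono) auto
    also have "\<dots> = u powr \<theta>"
      using that assms by (simp add: powr_divide)
    finally show ?thesis .
  qed
  have "(s + r) powr \<theta> = s / (s + r) * (s + r) powr \<theta> + r / (s + r) * (s + r) powr \<theta>"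
    using assms by (simp add: distrib_right[symmetric] add_divide_distrib[symmetric])
  also have "\<dots> \<le> s powr \<theta> + r powr \<theta>"
    using assms by (intro add_mono *) auto
  finally show ?thesis .
qed

section \<open>The Duhamel operator\<close>

text \<open>\<mu> is the order of the singularity at t = 0: 0 for the heat kernel, l/d for its
  derivatives of order l. Values at nonpositive times are arbitrary.\<close>

definition singular_kernel :: "real \<Rightarrow> real \<Rightarrow> ('a::euclidean_space \<Rightarrow> real \<Rightarrow> real) \<Rightarrow> real \<Rightarrow> bool" where
  "singular_kernel d \<mu> H C \<longleftrightarrow> 0 \<le> C \<and> continuous_on (UNIV \<times> {0<..}) (\<lambda>(x, t). H x t) \<and>
     (\<forall>t>0. \<forall>x. \<bar>H x t\<bar> \<le> C * t powr (-\<mu>) * decay_kernel (t powr (1 / d)) x)"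

lemma measurable_singular_kernel:
  assumes "singular_kernel d \<mu> H C"
  shows "(\<lambda>z. indicator {0<..} (snd z) * H (fst z) (snd z)) \<in> borel_measurable borel"
proof -
  have "(\<lambda>z. indicator (UNIV \<times> {0<..}) z *\<^sub>R (case z of (x, t) \<Rightarrow> H x t)) \<in> borel_measurable borel"
    using assms unfolding singular_kernel_def
    by (intro borel_measurable_continuous_on_indicator borel_open open_Times) auto
  then show ?thesis
    by (rule measurable_cong[THEN iffD1, rotated]) (auto simp: indicator_def case_prod_beta)
qed

text \<open>One function of y dominates the kernels of all scales in [a, b] centred within a of z.
  This is the majorant in the continuity proofs.\<close>

lemma decay_kernel_le_dominating:
  fixes x y z :: "'a::euclidean_space"
  assumes "0 < a" "a \<le> c" "c \<le> b" "norm (x - z) \<le> a"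
  shows "decay_kernel c (x - y) \<le> b / a * 2 ^ (DIM('a) + 1) * decay_kernel a (z - y)"
proof -
  have "decay_kernel c (x - y) \<le> c / a * decay_kernel a (x - y)"
    using assms by (intro decay_kernel_mono_scale) auto
  also have "\<dots> \<le> b / a * (2 ^ (DIM('a) + 1) * decay_kernel a (z - y))"
    using assms decay_kernel_shift[of a "x - y" "z - y"]
    by (intro mult_mono divide_right_mono) (auto simp: decay_kernel_nonneg)
  finally show ?thesis
    by (simp add: mult.assoc)
qed

text \<open>A ramp that is 0 up to e and 1 from 2 e on; being continuous, it keeps the truncated
  kernel continuous.\<close>

definition time_cutoff :: "real \<Rightarrow> real \<Rightarrow> real" where
  "time_cutoff e r = min 1 (max 0 (r / e - 1))"

lemma time_cutoff_bounds: "0 \<le> time_cutoff e r" "time_cutoff e r \<le> 1"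
  by (auto simp: time_cutoff_def)

lemma time_cutoff_eq_0: "0 < e \<Longrightarrow> r \<le> e \<Longrightarrow> time_cutoff e r = 0"
  by (auto simp: time_cutoff_def max_def min_def field_simps)

lemma time_cutoff_eq_1: "0 < e \<Longrightarrow> 2 * e \<le> r \<Longrightarrow> time_cutoff e r = 1"
  by (auto simp: time_cutoff_def max_def min_def field_simps)

text \<open>Two open sets cover space-time: positive times, where the kernel is continuous, and
  times below e, where the cut-off makes the product 0.\<close>

lemma continuous_on_truncated_kernel:
  assumes "singular_kernel d \<mu> H C" "0 < e"
  shows "continuous_on UNIV (\<lambda>(x, r). time_cutoff e r * H x r)"
proof -
  have 1: "continuous_on (UNIV \<times> {0<..}) (\<lambda>(x, r). time_cutoff e r * H x r)"
    using assms unfolding singular_kernel_def time_cutoff_def case_prod_beta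
    by (intro continuous_intros) auto
  have 2: "continuous_on (UNIV \<times> {..<e}) (\<lambda>(x, r). time_cutoff e r * H x r)"
    using assms(2)
    by (subst continuous_on_cong[OF refl, of _ _ "\<lambda>_. 0"]) (auto simp: time_cutoff_eq_0)
  have "UNIV \<times> {0<..} \<union> UNIV \<times> {..<e} = (UNIV :: ('a \<times> real) set)"
    using assms(2) by auto
  then show ?thesis
    using continuous_on_open_Un[OF open_Times open_Times 1 2] by simp
qed

lemma nn_integral_lborel_prod_swap:
  assumes [measurable]: "(f :: 'a::euclidean_space \<times> real \<Rightarrow> ennreal) \<in> borel_measurable borel"
  shows "(\<integral>\<^sup>+z. f z \<partial>lborel) = (\<integral>\<^sup>+s. \<integral>\<^sup>+y. f (y, s) \<partial>lborel \<partial>lborel)"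
  unfolding lborel_prod[symmetric] by (rule lborel_pair.nn_integral_snd[symmetric]) (simp add: lborel_prod)

text \<open>Dominated convergence along sequences; the majorant is chosen anew for each point and
  only has to work near it.\<close>

lemma continuous_on_integral_dominated:
  fixes F :: "'z::first_countable_topology \<Rightarrow> 'b \<Rightarrow> real"
  assumes dom: "\<And>z0. z0 \<in> S \<Longrightarrow> \<exists>g. integrable M g \<and> (\<forall>\<^sub>F z in at z0 within S. \<forall>y\<in>space M. \<bar>F z y\<bar> \<le> g y)"
    and meas: "\<And>z. z \<in> S \<Longrightarrow> F z \<in> borel_measurable M"
    and cont: "\<And>y. y \<in> space M \<Longrightarrow> continuous_on S (\<lambda>z. F z y)"
  shows "continuous_on S (\<lambda>z. LINT y|M. F z y)"
  unfolding continuous_on_def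
proof
  fix z0 assume z0: "z0 \<in> S"
  obtain g where g: "integrable M g" "\<forall>\<^sub>F z in at z0 within S. \<forall>y\<in>space M. \<bar>F z y\<bar> \<le> g y"
    using dom[OF z0] by blast
  show "((\<lambda>z. LINT y|M. F z y) \<longlongrightarrow> (LINT y|M. F z0 y)) (at z0 within S)"
    unfolding tendsto_at_iff_sequentially comp_def
  proof (intro allI impI)
    fix X assume X: "\<forall>i. X i \<in> S - {z0}" "X \<longlonglongrightarrow> z0"
    then have fl: "filterlim X (at z0 within S) sequentially"
      by (auto simp: filterlim_at)
    then have "\<forall>\<^sub>F n in sequentially. \<forall>y\<in>space M. \<bar>F (X n) y\<bar> \<le> g y"
      using g(2) by (rule eventually_compose_filterlim[rotated])
    then obtain k where k: "\<And>n. n \<ge> k \<Longrightarrow> \<forall>y\<in>space M. \<bar>F (X n) y\<bar> \<le> g y"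
      by (auto simp: eventually_sequentially)
    show "(\<lambda>n. LINT y|M. F (X n) y) \<longlonglongrightarrow> (LINT y|M. F z0 y)"
    proof (rule LIMSEQ_offset[of _ k], rule integral_dominated_convergence[OF _ _ g(1)])
      show "AE y in M. (\<lambda>n. F (X (n + k)) y) \<longlonglongrightarrow> F z0 y"
      proof (intro AE_I2)
        fix y assume "y \<in> space M"
        then have "((\<lambda>z. F z y) \<longlongrightarrow> F z0 y) (at z0 within S)"
          using cont z0 by (auto simp: continuous_on_def)
        then have "(\<lambda>n. F (X n) y) \<longlonglongrightarrow> F z0 y"
          using fl by (rule filterlim_compose)
        then show "(\<lambda>n. F (X (n + k)) y) \<longlonglongrightarrow> F z0 y"
          by (rule LIMSEQ_ignore_initial_segment)
      qed
      show "AE y in M. norm (F (X (n + k)) y) \<le> g y" for n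
        using k[of "n + k"] by auto
    qed (use meas z0 X in auto)
  qed
qed

lemma ereal_between_real:
  assumes "ereal t < T"
  obtains t1 where "t < t1" "ereal t1 < T"
  using ereal_dense2[OF assms] by auto

text \<open>The first two factors come from the almost-semigroup property, the factor 2 from
  (t-s)^(1/d) + s^(1/d) \<le> 2 t^(1/d), and the bracket bounds the Beta integral.\<close>

definition duhamel_const :: "'a::euclidean_space itself \<Rightarrow> real \<Rightarrow> real" where
  "duhamel_const _ \<mu> = 2 ^ (DIM('a) + 2) * decay_mass TYPE('a) * 2 * (2 / \<mu> + 2 / (1 - \<mu>))"

lemma duhamel_const_nonneg: "0 < \<mu> \<Longrightarrow> \<mu> < 1 \<Longrightarrow> 0 \<le> duhamel_const TYPE('a::euclidean_space) \<mu>"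
  unfolding duhamel_const_def using decay_mass_nonneg[where 'a='a] by simp

text \<open>A point with time t lies in the open set that belongs to \<tau> = t / 2. Uniform
  convergence will be available only away from t = 0, and this is how it still gives continuity
  everywhere.\<close>

lemma continuous_on_positive_times:
  fixes F :: "'z::topological_space \<times> real \<Rightarrow> 'b::topological_space"
  assumes c: "\<And>\<tau>. 0 < \<tau> \<Longrightarrow> ereal \<tau> < T \<Longrightarrow> continuous_on (UNIV \<times> {t. \<tau> < t \<and> ereal t < T}) F"
  shows "continuous_on (UNIV \<times> {t. 0 < t \<and> ereal t < T}) F"
proof -
  have op: "open (UNIV \<times> {t. \<tau> < t \<and> ereal t < T} :: ('z \<times> real) set)" for \<tau>
  proof -
    have "open ({\<tau><..} \<inter> ereal -` {..<T})"
      by (intro open_Int open_vimage continuous_on_ereal) auto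
    then show ?thesis
      by (intro open_Times) (auto simp: vimage_def Int_def)
  qed
  have "continuous_on (\<Union>\<tau>\<in>{\<tau>. 0 < \<tau> \<and> ereal \<tau> < T}. UNIV \<times> {t. \<tau> < t \<and> ereal t < T}) F"
    by (rule continuous_on_open_UN) (use op c in auto)
  moreover have "(\<Union>\<tau>\<in>{\<tau>. 0 < \<tau> \<and> ereal \<tau> < T}. UNIV \<times> {t. \<tau> < t \<and> ereal t < T}) =
      (UNIV \<times> {t. 0 < t \<and> ereal t < T} :: ('z \<times> real) set)"
  proof (intro equalityI subsetI)
    fix p :: "'z \<times> real" assume p: "p \<in> UNIV \<times> {t. 0 < t \<and> ereal t < T}"
    then have "p \<in> UNIV \<times> {t. snd p / 2 < t \<and> ereal t < T}" "0 < snd p / 2" "ereal (snd p / 2) < T"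
      by (auto intro: le_less_trans[of _ "ereal (snd p)"])
    then show "p \<in> (\<Union>\<tau>\<in>{\<tau>. 0 < \<tau> \<and> ereal \<tau> < T}. UNIV \<times> {t. \<tau> < t \<and> ereal t < T})"
      by blast
  qed auto
  ultimately show ?thesis by simp
qed

section \<open>Weighted estimates of the Duhamel integral\<close>

text \<open>\<open>average\<close> is all that is kept of the hypothesis on the datum. The exponents
  \<kappa> and \<mu> are independent here; \<open>picard_iteration\<close> ties them
  together.\<close>

locale weighted_duhamel =
  fixes \<phi> :: "'a::euclidean_space \<Rightarrow> real" and d \<mu> A \<kappa> :: real and T :: ereal
  assumes measurable_\<phi> [measurable]: "\<phi> \<in> borel_measurable borel"
    and d: "1 \<le> d" and \<mu>: "0 < \<mu>" "\<mu> < 1" and A: "0 \<le> A" and \<kappa>: "0 \<le> \<kappa>"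
    and average: "\<And>t x. 0 < t \<Longrightarrow> ereal t < T \<Longrightarrow>
      kernel_average \<phi> (t powr (1 / d)) x \<le> ennreal (A * t powr (-\<kappa>))"
begin

definition weight :: "'a \<Rightarrow> real \<Rightarrow> real" where
  "weight x t = enn2real (kernel_average \<phi> (t powr (1 / d)) x)"

lemma measurable_weight [measurable]:
  assumes [measurable]: "f \<in> borel_measurable M" "g \<in> borel_measurable M"
  shows "(\<lambda>x. weight (f x) (g x)) \<in> borel_measurable M"
  unfolding weight_def by measurable

lemma weight_nonneg: "0 \<le> weight x t"
  by (simp add: weight_def)

lemma ennreal_weight:
  assumes "0 < t" "ereal t < T"
  shows "ennreal (weight x t) = kernel_average \<phi> (t powr (1 / d)) x"
  unfolding weight_def using average[OF assms, of x]
  by (intro ennreal_enn2real) (auto intro: le_less_trans)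

lemma weight_le:
  assumes "0 < t" "ereal t < T"
  shows "weight x t \<le> A * t powr (-\<kappa>)"
  using average[OF assms, of x] A unfolding ennreal_weight[OF assms, symmetric]
  by (simp add: ennreal_le_iff)

text \<open>The class of right-hand sides that the Duhamel operator maps back to multiples of the
  weight: s^(\<mu>-1) is what the singularity (t-s)^(-\<mu>) needs for a scale-invariant time
  integral.\<close>

definition source :: "('a \<times> real \<Rightarrow> real) \<Rightarrow> real \<Rightarrow> bool" where
  "source f B \<longleftrightarrow> 0 \<le> B \<and> f \<in> borel_measurable borel \<and>
     (\<forall>y s. 0 < s \<longrightarrow> ereal s < T \<longrightarrow> \<bar>f (y, s)\<bar> \<le> B * s powr (\<mu> - 1) * weight y s)"

definition duhamel_integrand :: "('a \<Rightarrow> real \<Rightarrow> real) \<Rightarrow> ('a \<times> real \<Rightarrow> real) \<Rightarrow> 'a \<Rightarrow> real \<Rightarrow> 'a \<times> real \<Rightarrow> real" where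
  "duhamel_integrand H f x t z = indicator {0<..<t} (snd z) * (H (x - fst z) (t - snd z) * f z)"

text \<open>One integral over space-time, so that absolute convergence is a single statement;
  \<open>duhamel_iterated\<close> recovers the iterated form.\<close>

definition duhamel :: "('a \<Rightarrow> real \<Rightarrow> real) \<Rightarrow> ('a \<times> real \<Rightarrow> real) \<Rightarrow> 'a \<Rightarrow> real \<Rightarrow> real" where
  "duhamel H f x t = (LINT z|lborel. duhamel_integrand H f x t z)"

lemma measurable_duhamel_integrand:
  assumes H: "singular_kernel d \<mu> H C" and f: "source f B"
  shows "duhamel_integrand H f x t \<in> borel_measurable borel"
proof -
  have [measurable]: "f \<in> borel_measurable (borel \<Otimes>\<^sub>M borel)" using f by (simp add: source_def borel_prod)
  have shift: "(\<lambda>z::'a\<times>real. (x - fst z, t - snd z)) \<in> borel_measurable borel"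
    by (intro borel_measurable_continuous_onI continuous_intros)
  have [measurable]: "(\<lambda>z. indicator {0<..} (t - snd z) * H (x - fst z) (t - snd z)) \<in> borel_measurable (borel \<Otimes>\<^sub>M borel)"
    using measurable_compose[OF shift measurable_singular_kernel[OF H]] by (simp add: borel_prod)
  have "(\<lambda>z. indicator {0<..<t} (snd z) * ((indicator {0<..} (t - snd z) * H (x - fst z) (t - snd z)) * f z)) \<in> borel_measurable borel"
    unfolding borel_prod[symmetric] by measurable
  then show ?thesis
    by (rule measurable_cong[THEN iffD1, rotated]) (auto simp: duhamel_integrand_def indicator_def)
qed


text \<open>The convolution lands on the scale (t-s)^(1/d) + s^(1/d), which lies between t^(1/d) and
  2 t^(1/d). The lower bound, from 1/d \<le> 1, permits the comparison with the weight at time t;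
  the upper one limits the loss to a factor 2.\<close>

lemma decay_kernel_weight_convolution:
  assumes "0 < s" "s < t" "ereal t < T"
  shows "(\<integral>\<^sup>+y. ennreal (decay_kernel ((t - s) powr (1 / d)) (x - y)) * ennreal (weight y s) \<partial>lborel) \<le>
    ennreal (2 ^ (DIM('a) + 2) * decay_mass TYPE('a) * 2 * weight x t)"
proof -
  let ?a = "(t - s) powr (1 / d)" and ?b = "s powr (1 / d)" and ?r = "t powr (1 / d)"
  have sT: "ereal s < T" using assms(2,3) by (meson ereal_less(2) less_ereal.simps(1) less_trans)
  have ab: "?a > 0" "?b > 0" "?r > 0" using assms by auto
  have r1: "?r \<le> ?a + ?b"
    using powr_subadditive[of "t - s" s "1 / d"] assms d by auto
  have r2: "?a + ?b \<le> 2 * ?r"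
    using assms d powr_mono2[of "1/d" "t - s" t] powr_mono2[of "1/d" s t] by auto
  have "(\<integral>\<^sup>+y. ennreal (decay_kernel ?a (x - y)) * ennreal (weight y s) \<partial>lborel) \<le>
      ennreal (2 ^ (DIM('a) + 2) * decay_mass TYPE('a)) * kernel_average \<phi> (?a + ?b) x"
    unfolding ennreal_weight[OF assms(1) sT] by (rule kernel_average_semigroup[OF measurable_\<phi> ab(1,2)])
  also have "\<dots> \<le> ennreal (2 ^ (DIM('a) + 2) * decay_mass TYPE('a)) * (ennreal 2 * kernel_average \<phi> ?r x)"
  proof (intro mult_left_mono)
    have "kernel_average \<phi> (?a + ?b) x \<le> ennreal ((?a + ?b) / ?r) * kernel_average \<phi> ?r x"
      using r1 ab by (intro kernel_average_scale) auto
    also have "\<dots> \<le> ennreal 2 * kernel_average \<phi> ?r x"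
      using r2 ab by (intro mult_right_mono ennreal_leI) (auto simp: divide_le_eq)
    finally show "kernel_average \<phi> (?a + ?b) x \<le> ennreal 2 * kernel_average \<phi> ?r x" .
  qed simp
  also have "\<dots> = ennreal (2 ^ (DIM('a) + 2) * decay_mass TYPE('a) * 2 * weight x t)"
    using ennreal_weight[of t x] assms decay_mass_nonneg[where 'a='a] weight_nonneg[of x t]
    by (simp add: ennreal_mult mult.assoc del: power_Suc ennreal_numeral)
  finally show ?thesis .
qed

lemma nn_integral_duhamel_integrand:
  assumes H: "singular_kernel d \<mu> H C" and f: "source f B" and t: "0 < t" "ereal t < T"
  shows "(\<integral>\<^sup>+z. ennreal \<bar>duhamel_integrand H f x t z\<bar> \<partial>lborel) \<le> ennreal (duhamel_const TYPE('a) \<mu> * C * B * weight x t)"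
proof -
  have [measurable]: "duhamel_integrand H f x t \<in> borel_measurable borel"
    by (rule measurable_duhamel_integrand[OF H f])
  have CB: "0 \<le> C" "0 \<le> B" using H f by (auto simp: singular_kernel_def source_def)
  let ?k = "2 ^ (DIM('a) + 2) * decay_mass TYPE('a) * 2 * weight x t"
  have k: "0 \<le> ?k"
    using decay_mass_nonneg[where 'a='a] weight_nonneg[of x t] by simp
  have inner: "(\<integral>\<^sup>+y. ennreal \<bar>duhamel_integrand H f x t (y, s)\<bar> \<partial>lborel) \<le>
      ennreal (C * B * ?k) * (ennreal ((t - s) powr (-\<mu>) * s powr (\<mu> - 1)) * indicator {0<..<t} s)" for s
  proof (cases "s \<in> {0<..<t}")
    case True
    then have sT: "ereal s < T" using t(2) by (auto intro: less_trans[of _ "ereal t"])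
    let ?c = "C * B * ((t - s) powr (-\<mu>) * s powr (\<mu> - 1))"
    have "(\<integral>\<^sup>+y. ennreal \<bar>duhamel_integrand H f x t (y, s)\<bar> \<partial>lborel) \<le>
       (\<integral>\<^sup>+y. ennreal ?c * (ennreal (decay_kernel ((t - s) powr (1 / d)) (x - y)) * ennreal (weight y s)) \<partial>lborel)"
    proof (intro nn_integral_mono)
      fix y
      have "\<bar>H (x - y) (t - s)\<bar> * \<bar>f (y, s)\<bar> \<le>
          (C * (t - s) powr (-\<mu>) * decay_kernel ((t - s) powr (1 / d)) (x - y)) * (B * s powr (\<mu> - 1) * weight y s)"
        using H f True sT CB
        by (intro mult_mono) (auto simp: singular_kernel_def source_def decay_kernel_nonneg)
      also have "\<dots> = ?c * (decay_kernel ((t - s) powr (1 / d)) (x - y) * weight y s)"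
        by (simp add: mult_ac)
      finally show "ennreal \<bar>duhamel_integrand H f x t (y, s)\<bar> \<le>
          ennreal ?c * (ennreal (decay_kernel ((t - s) powr (1 / d)) (x - y)) * ennreal (weight y s))"
        using True CB weight_nonneg[of y s]
        by (simp add: duhamel_integrand_def abs_mult ennreal_mult[symmetric] decay_kernel_nonneg ennreal_leI)
    qed
    also have "\<dots> = ennreal ?c * (\<integral>\<^sup>+y. ennreal (decay_kernel ((t - s) powr (1 / d)) (x - y)) * ennreal (weight y s) \<partial>lborel)"
      by (intro nn_integral_cmult) measurable
    also have "\<dots> \<le> ennreal ?c * ennreal ?k"
      using True t by (intro mult_left_mono decay_kernel_weight_convolution) auto
    also have "\<dots> = ennreal (C * B * ?k) * (ennreal ((t - s) powr (-\<mu>) * s powr (\<mu> - 1)) * indicator {0<..<t} s)"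
      using True CB k by (simp add: ennreal_mult[symmetric] mult_ac del: power_Suc)
    finally show ?thesis .
  qed (simp add: duhamel_integrand_def)
  have "(\<integral>\<^sup>+z. ennreal \<bar>duhamel_integrand H f x t z\<bar> \<partial>lborel) =
      (\<integral>\<^sup>+s. \<integral>\<^sup>+y. ennreal \<bar>duhamel_integrand H f x t (y, s)\<bar> \<partial>lborel \<partial>lborel)"
    by (rule nn_integral_lborel_prod_swap) measurable
  also have "\<dots> \<le> (\<integral>\<^sup>+s. ennreal (C * B * ?k) * (ennreal ((t - s) powr (-\<mu>) * s powr (\<mu> - 1)) * indicator {0<..<t} s) \<partial>lborel)"
    by (intro nn_integral_mono inner)
  also have "\<dots> = ennreal (C * B * ?k) * (\<integral>\<^sup>+s. ennreal ((t - s) powr (-\<mu>) * s powr (\<mu> - 1)) * indicator {0<..<t} s \<partial>lborel)"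
    by (intro nn_integral_cmult) measurable
  also have "\<dots> \<le> ennreal (C * B * ?k) * ennreal (2 / \<mu> + 2 / (1 - \<mu>))"
    by (intro mult_left_mono nn_integral_beta_le \<mu> t) simp
  also have "\<dots> = ennreal (duhamel_const TYPE('a) \<mu> * C * B * weight x t)"
    using CB k \<mu> by (subst ennreal_mult[symmetric]) (auto simp: duhamel_const_def mult_ac)
  finally show ?thesis .
qed

lemma integrable_duhamel:
  assumes "singular_kernel d \<mu> H C" "source f B" "0 < t" "ereal t < T"
  shows "integrable lborel (duhamel_integrand H f x t)"
  using nn_integral_duhamel_integrand[OF assms, of x] measurable_duhamel_integrand[OF assms(1,2)]
  by (intro integrableI_bounded) (auto intro: le_less_trans)

lemma duhamel_bound:
  assumes "singular_kernel d \<mu> H C" "source f B" "0 < t" "ereal t < T"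
  shows "\<bar>duhamel H f x t\<bar> \<le> duhamel_const TYPE('a) \<mu> * C * B * weight x t"
proof -
  have "0 \<le> duhamel_const TYPE('a) \<mu> * C * B * weight x t"
    using assms duhamel_const_nonneg[OF \<mu>, where 'a='a] weight_nonneg[of x t] by (simp add: singular_kernel_def source_def)
  moreover have "ennreal (norm (duhamel H f x t)) \<le> (\<integral>\<^sup>+z. ennreal (norm (duhamel_integrand H f x t z)) \<partial>lborel)"
    unfolding duhamel_def by (rule integral_norm_bound_ennreal[OF integrable_duhamel[OF assms]])
  ultimately show ?thesis
    using nn_integral_duhamel_integrand[OF assms, of x] order_trans[of "ennreal \<bar>duhamel H f x t\<bar>"]
    by (fastforce simp: ennreal_le_iff)
qed

lemma duhamel_diff:
  assumes "singular_kernel d \<mu> H C" "source f B" "source g B'" "0 < t" "ereal t < T"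
  shows "duhamel H f x t - duhamel H g x t = duhamel H (\<lambda>z. f z - g z) x t"
proof -
  have "duhamel_integrand H (\<lambda>z. f z - g z) x t = (\<lambda>z. duhamel_integrand H f x t z - duhamel_integrand H g x t z)"
    by (rule ext) (simp add: duhamel_integrand_def right_diff_distrib)
  then show ?thesis
    unfolding duhamel_def
    using integrable_duhamel[OF assms(1,2,4,5), of x] integrable_duhamel[OF assms(1,3,4,5), of x]
    by simp
qed

section \<open>Continuity of the Duhamel integral\<close>

text \<open>The cut-off vanishes for s \<ge> t - e and so takes the place of the jump at s = t,
  which makes the integrand continuous in (x, t) for fixed (y, s).\<close>

definition trunc_integrand :: "real \<Rightarrow> ('a \<Rightarrow> real \<Rightarrow> real) \<Rightarrow> ('a \<times> real \<Rightarrow> real) \<Rightarrow> 'a \<Rightarrow> real \<Rightarrow> 'a \<times> real \<Rightarrow> real" where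
  "trunc_integrand e H f x t z = indicator {0<..} (snd z) * (time_cutoff e (t - snd z) * H (x - fst z) (t - snd z) * f z)"

lemma trunc_integrand_eq:
  assumes "0 < e"
  shows "trunc_integrand e H f x t z = time_cutoff e (t - snd z) * duhamel_integrand H f x t z"
  using time_cutoff_eq_0[OF assms, of "t - snd z"] assms
  by (cases "snd z < t") (auto simp: trunc_integrand_def duhamel_integrand_def indicator_def)

lemma measurable_time_cutoff [measurable]: "time_cutoff e \<in> borel_measurable borel"
  unfolding time_cutoff_def by measurable

lemma measurable_trunc_integrand:
  assumes "singular_kernel d \<mu> H C" "source f B" "0 < e"
  shows "trunc_integrand e H f x t \<in> borel_measurable borel"
proof -
  note [measurable] = measurable_duhamel_integrand[OF assms(1,2), of x t, folded borel_prod]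
  show ?thesis
    unfolding trunc_integrand_eq[OF assms(3), abs_def] borel_prod[symmetric] by measurable
qed

lemma measurable_dominating:
  "(\<lambda>z. indicator {0<..<t} (snd z) * (decay_kernel a (x - fst z) *
    (snd z powr (\<mu> - 1) * weight (fst z) (snd z)))) \<in> borel_measurable borel"
  unfolding borel_prod[symmetric] by measurable

text \<open>The space integral gives an average at scale a + s^(1/d), comparable from above with the
  one at scale a uniformly in s < t; the remaining s^(\<mu>-1) is integrable.\<close>

lemma nn_integral_dominating_finite:
  assumes "0 < a" "0 < t" "ereal t < T" "kernel_average \<phi> a x < \<infinity>"
  shows "(\<integral>\<^sup>+z. ennreal (indicator {0<..<t} (snd z) * (decay_kernel a (x - fst z) *
    (snd z powr (\<mu> - 1) * weight (fst z) (snd z)))) \<partial>lborel) < \<infinity>"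
proof -
  let ?b = "t powr (1 / d)"
  let ?k = "ennreal (2 ^ (DIM('a) + 2) * decay_mass TYPE('a)) * (ennreal ((a + ?b) / a) * kernel_average \<phi> a x)"
  have inner: "(\<integral>\<^sup>+y. ennreal (indicator {0<..<t} s * (decay_kernel a (x - y) * (s powr (\<mu> - 1) * weight y s))) \<partial>lborel)
      \<le> ?k * (ennreal (s powr (\<mu> - 1)) * indicator {0<..<t} s)" for s
  proof (cases "s \<in> {0<..<t}")
    case True
    then have sT: "ereal s < T" using assms(3) by (auto intro: less_trans[of _ "ereal t"])
    have s0: "0 < s powr (1 / d)" using True by auto
    have "(\<integral>\<^sup>+y. ennreal (indicator {0<..<t} s * (decay_kernel a (x - y) * (s powr (\<mu> - 1) * weight y s))) \<partial>lborel) =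
        (\<integral>\<^sup>+y. ennreal (s powr (\<mu> - 1)) * (ennreal (decay_kernel a (x - y)) * kernel_average \<phi> (s powr (1 / d)) y) \<partial>lborel)"
      using True assms(1) sT weight_nonneg
      by (intro nn_integral_cong) (simp add: ennreal_weight[symmetric] ennreal_mult[symmetric] decay_kernel_nonneg mult_ac)
    also have "\<dots> = ennreal (s powr (\<mu> - 1)) * (\<integral>\<^sup>+y. ennreal (decay_kernel a (x - y)) * kernel_average \<phi> (s powr (1 / d)) y \<partial>lborel)"
      by (intro nn_integral_cmult) measurable
    also have "\<dots> \<le> ennreal (s powr (\<mu> - 1)) * ?k"
    proof (intro mult_left_mono)
      have "(\<integral>\<^sup>+y. ennreal (decay_kernel a (x - y)) * kernel_average \<phi> (s powr (1 / d)) y \<partial>lborel) \<le>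
          ennreal (2 ^ (DIM('a) + 2) * decay_mass TYPE('a)) * kernel_average \<phi> (a + s powr (1 / d)) x"
        by (rule kernel_average_semigroup[OF measurable_\<phi> assms(1) s0])
      also have "\<dots> \<le> ?k"
      proof (intro mult_left_mono)
        have "kernel_average \<phi> (a + s powr (1 / d)) x \<le> ennreal ((a + s powr (1 / d)) / a) * kernel_average \<phi> a x"
          using assms(1) by (intro kernel_average_scale) auto
        also have "\<dots> \<le> ennreal ((a + ?b) / a) * kernel_average \<phi> a x"
          using assms(1) True d by (intro mult_right_mono ennreal_leI divide_right_mono add_left_mono powr_mono2) auto
        finally show "kernel_average \<phi> (a + s powr (1 / d)) x \<le> ennreal ((a + ?b) / a) * kernel_average \<phi> a x" .
      qed simp
      finally show "(\<integral>\<^sup>+y. ennreal (decay_kernel a (x - y)) * kernel_average \<phi> (s powr (1 / d)) y \<partial>lborel) \<le> ?k" .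
    qed simp
    finally show ?thesis
      using True by (simp add: mult.commute)
  qed simp
  have "(\<integral>\<^sup>+z. ennreal (indicator {0<..<t} (snd z) * (decay_kernel a (x - fst z) *
    (snd z powr (\<mu> - 1) * weight (fst z) (snd z)))) \<partial>lborel) =
     (\<integral>\<^sup>+s. \<integral>\<^sup>+y. ennreal (indicator {0<..<t} s * (decay_kernel a (x - y) * (s powr (\<mu> - 1) * weight y s))) \<partial>lborel \<partial>lborel)"
    using nn_integral_lborel_prod_swap[OF measurable_compose[OF measurable_dominating measurable_ennreal], of t a x]
    by simp
  also have "\<dots> \<le> (\<integral>\<^sup>+s. ?k * (ennreal (s powr (\<mu> - 1)) * indicator {0<..<t} s) \<partial>lborel)"
    by (intro nn_integral_mono inner)
  also have "\<dots> = ?k * ennreal (t powr \<mu> / \<mu>)"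
    using nn_integral_powr_reflect(2)[of \<mu> t t] \<mu> assms by (subst nn_integral_cmult) auto
  also have "\<dots> < \<infinity>"
    using assms(4) by (simp add: ennreal_mult_less_top)
  finally show ?thesis .
qed


lemma kernel_average_finite:
  assumes "0 < e" "ereal e < T"
  shows "kernel_average \<phi> (e powr (1 / d)) x < \<infinity>"
  using average[OF assms, of x] by (auto intro: le_less_trans)

text \<open>Near (x0, t0) the cut-off confines t - s to the range from e to t1, so all kernels that
  occur are dominated by a multiple of one kernel of fixed scale centred at x0. Finiteness of the
  average at that scale comes from e < T.\<close>

lemma continuous_on_trunc:
  assumes H: "singular_kernel d \<mu> H C" and f: "source f B" and e: "0 < e" "ereal e < T"
  shows "continuous_on (UNIV \<times> {t. 0 < t \<and> ereal t < T})
    (\<lambda>p. LINT z|lborel. trunc_integrand e H f (fst p) (snd p) z)"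
proof (rule continuous_on_integral_dominated)
  fix p0 :: "'a \<times> real" assume p0: "p0 \<in> UNIV \<times> {t. 0 < t \<and> ereal t < T}"
  define x0 t0 where "x0 = fst p0" and "t0 = snd p0"
  have t0: "0 < t0" "ereal t0 < T" using p0 by (auto simp: t0_def)
  obtain t1 where t1: "t0 < t1" "ereal t1 < T" using ereal_between_real[OF t0(2)] .
  \<comment> \<open>\<open>a\<close> is the least scale that survives the cut-off, \<open>b\<close>
    bounds the largest; the \<open>max\<close> keeps a \<le> b even if t1 < e.\<close>
  define a b where "a = e powr (1 / d)" and "b = max a (t1 powr (1 / d))"
  have a: "0 < a" "a \<le> b" using e by (auto simp: a_def b_def)
  have CB: "0 \<le> C" "0 \<le> B" using H f by (auto simp: singular_kernel_def source_def)
  define D where "D = (C * e powr (-\<mu>) * (b / a * 2 ^ (DIM('a) + 1))) * B"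
  have D: "0 \<le> D" using CB a by (simp add: D_def)
  define h where "h z = indicator {0<..<t1} (snd z) * (decay_kernel a (x0 - fst z) *
    (snd z powr (\<mu> - 1) * weight (fst z) (snd z)))" for z :: "'a \<times> real"
  have h0: "0 \<le> h z" for z
    using a weight_nonneg by (simp add: h_def decay_kernel_nonneg)
  have "(\<integral>\<^sup>+z. ennreal (h z) \<partial>lborel) < \<infinity>"
    unfolding h_def a_def using kernel_average_finite[OF e, of x0] e t0 t1
    by (intro nn_integral_dominating_finite) auto
  then have "integrable lborel h"
    using h0 measurable_dominating[of t1 a x0] unfolding h_def by (intro integrableI_nonneg) auto
  then have "integrable lborel (\<lambda>z. D * h z)"
    by simp
  moreover have "\<forall>\<^sub>F p in at p0 within UNIV \<times> {t. 0 < t \<and> ereal t < T}.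
      \<forall>z\<in>space lborel. \<bar>trunc_integrand e H f (fst p) (snd p) z\<bar> \<le> D * h z"
  proof -
    have "((\<lambda>p. norm (fst p - x0)) \<longlongrightarrow> norm (fst p0 - x0)) (at p0 within UNIV \<times> {t. 0 < t \<and> ereal t < T})"
      by (intro tendsto_intros)
    then have "\<forall>\<^sub>F p in at p0 within UNIV \<times> {t. 0 < t \<and> ereal t < T}. norm (fst p - x0) < a"
      using a by (intro order_tendstoD(2)) (auto simp: x0_def)
    moreover have "((\<lambda>p. snd p) \<longlongrightarrow> t0) (at p0 within UNIV \<times> {t. 0 < t \<and> ereal t < T})"
      unfolding t0_def by (intro tendsto_intros)
    then have "\<forall>\<^sub>F p in at p0 within UNIV \<times> {t. 0 < t \<and> ereal t < T}. snd p < t1"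
      using t1 by (intro order_tendstoD(2))
    ultimately show ?thesis
    proof eventually_elim
      case (elim p)
      define x t where "x = fst p" and "t = snd p"
      show ?case
      proof
        fix z :: "'a \<times> real"
        obtain y s where z: "z = (y, s)" by (cases z)
        show "\<bar>trunc_integrand e H f (fst p) (snd p) z\<bar> \<le> D * h z"
        proof (cases "0 < s \<and> e < t - s")
          case True
          then have s: "0 < s" "s < t1" "e < t - s" "t - s < t1" "ereal s < T"
            using elim t1 e by (auto simp: t_def intro: less_trans[of _ "ereal t1"])
          have k: "decay_kernel ((t - s) powr (1 / d)) (x - y) \<le> b / a * 2 ^ (DIM('a) + 1) * decay_kernel a (x0 - y)"
          proof (rule decay_kernel_le_dominating[OF a(1)])
            show "a \<le> (t - s) powr (1 / d)"
              unfolding a_def using e s d by (intro powr_mono2) auto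
            show "(t - s) powr (1 / d) \<le> b"
              unfolding b_def using e s d by (intro max.coboundedI2 powr_mono2) auto
            show "norm (x - x0) \<le> a"
              using elim by (simp add: x_def)
          qed
          have "\<bar>H (x - y) (t - s)\<bar> \<le> C * (t - s) powr (-\<mu>) * decay_kernel ((t - s) powr (1 / d)) (x - y)"
            using H s e by (auto simp: singular_kernel_def)
          also have "\<dots> \<le> C * e powr (-\<mu>) * (b / a * 2 ^ (DIM('a) + 1) * decay_kernel a (x0 - y))"
            using s e \<mu> CB by (intro mult_mono k powr_mono2') (auto simp: decay_kernel_nonneg)
          finally have Hle: "\<bar>H (x - y) (t - s)\<bar> \<le> C * e powr (-\<mu>) * (b / a * 2 ^ (DIM('a) + 1)) * decay_kernel a (x0 - y)"
            by (simp add: mult.assoc)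
          have "\<bar>trunc_integrand e H f x t z\<bar> \<le> 1 * \<bar>H (x - y) (t - s)\<bar> * \<bar>f (y, s)\<bar>"
            using s time_cutoff_bounds[of e "t - s"]
            by (auto simp: trunc_integrand_def z abs_mult intro!: mult_right_mono mult_left_le_one_le)
          also have "\<dots> \<le> 1 * (C * e powr (-\<mu>) * (b / a * 2 ^ (DIM('a) + 1)) * decay_kernel a (x0 - y)) *
              (B * s powr (\<mu> - 1) * weight y s)"
            using f s CB a Hle by (intro mult_mono) (auto simp: source_def decay_kernel_nonneg)
          also have "\<dots> = D * h z"
            using s by (simp add: D_def h_def z mult_ac)
          finally show ?thesis by (simp add: x_def t_def)
        next
          case False
          then have "trunc_integrand e H f x t z = 0"
            using time_cutoff_eq_0[OF e(1), of "t - s"] by (auto simp: trunc_integrand_def z)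
          then show ?thesis using D h0[of z] by (simp add: x_def t_def)
        qed
      qed
    qed
  qed
  ultimately show "\<exists>g. integrable lborel g \<and> (\<forall>\<^sub>F p in at p0 within UNIV \<times> {t. 0 < t \<and> ereal t < T}.
      \<forall>z\<in>space lborel. \<bar>trunc_integrand e H f (fst p) (snd p) z\<bar> \<le> g z)"
    by blast
next
  fix z :: "'a \<times> real"
  have "continuous_on UNIV (\<lambda>p. (\<lambda>(x, r). time_cutoff e r * H x r) (fst p - fst z, snd p - snd z))"
    by (intro continuous_on_compose2[OF continuous_on_truncated_kernel[OF H e(1)]] continuous_intros) auto
  then show "continuous_on (UNIV \<times> {t. 0 < t \<and> ereal t < T}) (\<lambda>p. trunc_integrand e H f (fst p) (snd p) z)"
    unfolding trunc_integrand_def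
    by (intro continuous_on_mult_left continuous_on_mult_right) (auto intro: continuous_on_subset)
qed (simp add: measurable_trunc_integrand[OF H f e(1)])

text \<open>
  Continuity comes from the kernel rather than from the source: cutting off the kernel near \<open>s = t\<close>
  makes the operator continuous, and the error is uniformly small away from \<open>t = 0\<close>.
\<close>

lemma duhamel_minus_trunc:
  assumes H: "singular_kernel d \<mu> H C" and f: "source f B" and e: "0 < e" "4 * e \<le> \<tau>"
    and t: "\<tau> \<le> t" "ereal t < T"
  shows "\<bar>duhamel H f x t - (LINT z|lborel. trunc_integrand e H f x t z)\<bar> \<le>
    C * (B * (A * (\<tau> / 2) powr (\<mu> - 1 - \<kappa>))) * decay_mass TYPE('a) * ((2 * e) powr (1 - \<mu>) / (1 - \<mu>))"
proof -
  have t0: "0 < t" using e t by linarith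
  have CB: "0 \<le> C" "0 \<le> B" using H f by (auto simp: singular_kernel_def source_def)
  let ?Q = "B * (A * (\<tau> / 2) powr (\<mu> - 1 - \<kappa>))"
  have Q: "0 \<le> ?Q" using CB A by simp
  note int = integrable_duhamel[OF H f t0 t(2), of x]
  have intt: "integrable lborel (trunc_integrand e H f x t)"
    by (rule Bochner_Integration.integrable_bound[OF int])
       (use measurable_trunc_integrand[OF H f e(1)] time_cutoff_bounds in
         \<open>auto simp: trunc_integrand_eq[OF e(1)] abs_mult intro!: mult_left_le_one_le\<close>)
  let ?g = "\<lambda>z. duhamel_integrand H f x t z - trunc_integrand e H f x t z"
  have [measurable]: "?g \<in> borel_measurable borel"
    using int intt by auto
  have pt: "ennreal \<bar>?g (y, s)\<bar> \<le> ennreal (C * ?Q) * (ennreal ((t - s) powr ((1 - \<mu>) - 1)) * indicator {t - 2 * e<..<t} s) *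
      ennreal (decay_kernel ((t - s) powr (1 / d)) (x - y))" for y s
  proof (cases "s \<in> {t - 2 * e<..<t}")
    case True
    \<comment> \<open>The condition 4 e \<le> \<tau> keeps s above \<tau> / 2, where the source is
      bounded; only the singularity of the kernel at s = t is left to integrate.\<close>
    then have s: "\<tau> / 2 \<le> s" "0 < s" "s < t" using e t by auto
    have sT: "ereal s < T" using s t(2) by (auto intro: less_trans[of _ "ereal t"])
    have "\<bar>f (y, s)\<bar> \<le> B * s powr (\<mu> - 1) * weight y s"
      using f s sT by (auto simp: source_def)
    also have "\<dots> \<le> B * s powr (\<mu> - 1) * (A * s powr (-\<kappa>))"
      using CB s sT by (intro mult_left_mono weight_le) auto
    also have "\<dots> = B * (A * s powr (\<mu> - 1 - \<kappa>))"
      by (simp add: powr_add[symmetric] mult.left_commute)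
    also have "\<dots> \<le> ?Q"
      using CB A s e \<mu> \<kappa> by (intro mult_left_mono powr_mono2') auto
    finally have f1: "\<bar>f (y, s)\<bar> \<le> ?Q" .
    have "\<bar>?g (y, s)\<bar> = \<bar>1 - time_cutoff e (t - s)\<bar> * (\<bar>H (x - y) (t - s)\<bar> * \<bar>f (y, s)\<bar>)"
      using s by (simp add: trunc_integrand_eq[OF e(1)] duhamel_integrand_def abs_mult[symmetric] left_diff_distrib)
    also have "\<dots> \<le> 1 * ((C * (t - s) powr (-\<mu>) * decay_kernel ((t - s) powr (1 / d)) (x - y)) * ?Q)"
      using H s f1 CB time_cutoff_bounds[of e "t - s"]
      by (intro mult_mono) (auto simp: singular_kernel_def decay_kernel_nonneg)
    also have "\<dots> = C * ?Q * ((t - s) powr ((1 - \<mu>) - 1)) * decay_kernel ((t - s) powr (1 / d)) (x - y)"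
      by (simp add: mult_ac)
    finally show ?thesis
      using True CB Q by (simp add: ennreal_mult[symmetric] decay_kernel_nonneg ennreal_leI)
  next
    case False
    then have "?g (y, s) = 0"
      using time_cutoff_eq_1[OF e(1), of "t - s"]
      by (cases "s < t") (auto simp: trunc_integrand_eq[OF e(1)] duhamel_integrand_def)
    then show ?thesis by simp
  qed
  have "ennreal (norm (LINT z|lborel. ?g z)) \<le> (\<integral>\<^sup>+z. ennreal (norm (?g z)) \<partial>lborel)"
    by (intro integral_norm_bound_ennreal Bochner_Integration.integrable_diff int intt)
  also have "\<dots> = (\<integral>\<^sup>+s. \<integral>\<^sup>+y. ennreal \<bar>?g (y, s)\<bar> \<partial>lborel \<partial>lborel)"
    unfolding real_norm_def by (rule nn_integral_lborel_prod_swap) measurable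
  also have "\<dots> \<le> (\<integral>\<^sup>+s. \<integral>\<^sup>+y. ennreal (C * ?Q) * (ennreal ((t - s) powr ((1 - \<mu>) - 1)) * indicator {t - 2 * e<..<t} s) *
      ennreal (decay_kernel ((t - s) powr (1 / d)) (x - y)) \<partial>lborel \<partial>lborel)"
    by (intro nn_integral_mono pt)
  also have "\<dots> = (\<integral>\<^sup>+s. ennreal (C * ?Q) * (ennreal ((t - s) powr ((1 - \<mu>) - 1)) * indicator {t - 2 * e<..<t} s) *
      ennreal (decay_mass TYPE('a)) \<partial>lborel)"
  proof (intro nn_integral_cong)
    fix s
    have "(\<integral>\<^sup>+y. ennreal (C * ?Q) * (ennreal ((t - s) powr ((1 - \<mu>) - 1)) * indicator {t - 2 * e<..<t} s) *
      ennreal (decay_kernel ((t - s) powr (1 / d)) (x - y)) \<partial>lborel) =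
      ennreal (C * ?Q) * (ennreal ((t - s) powr ((1 - \<mu>) - 1)) * indicator {t - 2 * e<..<t} s) *
      (\<integral>\<^sup>+y. ennreal (decay_kernel ((t - s) powr (1 / d)) (x - y)) \<partial>lborel)"
      by (intro nn_integral_cmult) measurable
    then show "(\<integral>\<^sup>+y. ennreal (C * ?Q) * (ennreal ((t - s) powr ((1 - \<mu>) - 1)) * indicator {t - 2 * e<..<t} s) *
      ennreal (decay_kernel ((t - s) powr (1 / d)) (x - y)) \<partial>lborel) =
      ennreal (C * ?Q) * (ennreal ((t - s) powr ((1 - \<mu>) - 1)) * indicator {t - 2 * e<..<t} s) *
      ennreal (decay_mass TYPE('a))"
      by (cases "s < t") (simp_all add: nn_integral_decay_kernel)
  qed
  also have "\<dots> = ennreal (C * ?Q) * ennreal ((2 * e) powr (1 - \<mu>) / (1 - \<mu>)) * ennreal (decay_mass TYPE('a))"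
    using nn_integral_powr_reflect(1)[of "1 - \<mu>" "2 * e" t] \<mu> e t
    by (simp add: nn_integral_multc nn_integral_cmult)
  also have "\<dots> = ennreal (C * ?Q * decay_mass TYPE('a) * ((2 * e) powr (1 - \<mu>) / (1 - \<mu>)))"
  proof -
    have "ennreal u * ennreal v * ennreal w = ennreal (u * w * v)" if "0 \<le> u" "0 \<le> v" "0 \<le> w" for u v w
      using that by (simp add: ennreal_mult mult_ac)
    then show ?thesis
      using CB(1) Q \<mu> decay_mass_nonneg[where 'a='a] by simp
  qed
  finally have "\<bar>LINT z|lborel. ?g z\<bar> \<le> C * ?Q * decay_mass TYPE('a) * ((2 * e) powr (1 - \<mu>) / (1 - \<mu>))"
    using CB Q \<mu> decay_mass_nonneg[where 'a='a]
    by (subst (asm) ennreal_le_iff) (auto intro!: mult_nonneg_nonneg)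
  then show ?thesis
    unfolding duhamel_def by (subst (asm) Bochner_Integration.integral_diff[OF int intt])
qed

lemma continuous_on_duhamel:
  assumes H: "singular_kernel d \<mu> H C" and f: "source f B"
  shows "continuous_on (UNIV \<times> {t. 0 < t \<and> ereal t < T}) (\<lambda>p. duhamel H f (fst p) (snd p))"
proof -
  have "continuous_on (UNIV \<times> {t. \<tau> < t \<and> ereal t < T}) (\<lambda>p. duhamel H f (fst p) (snd p))"
    if \<tau>: "0 < \<tau>" "ereal \<tau> < T" for \<tau>
  proof (rule uniform_limit_theorem)
    \<comment> \<open>At most \<tau> / 4, as the error estimate requires, and therefore also below
      \<open>T\<close>.\<close>
    let ?e = "\<lambda>n. \<tau> / 4 / real (Suc n)"
    let ?K = "C * (B * (A * (\<tau> / 2) powr (\<mu> - 1 - \<kappa>))) * decay_mass TYPE('a)"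
    have e: "0 < ?e n" "4 * ?e n \<le> \<tau>" "ereal (?e n) < T" for n
    proof -
      show 1: "0 < ?e n" using \<tau> by simp
      show 2: "4 * ?e n \<le> \<tau>" using \<tau> by (simp add: field_simps)
      show "ereal (?e n) < T" using 1 2 \<tau>(2) by (intro le_less_trans[OF _ \<tau>(2)]) auto
    qed
    show "\<forall>\<^sub>F n in sequentially. continuous_on (UNIV \<times> {t. \<tau> < t \<and> ereal t < T})
        (\<lambda>p. LINT z|lborel. trunc_integrand (?e n) H f (fst p) (snd p) z)"
      using \<tau> by (intro always_eventually allI continuous_on_subset[OF continuous_on_trunc[OF H f e(1,3)]]) auto
    show "uniform_limit (UNIV \<times> {t. \<tau> < t \<and> ereal t < T})
        (\<lambda>n p. LINT z|lborel. trunc_integrand (?e n) H f (fst p) (snd p) z)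
        (\<lambda>p. duhamel H f (fst p) (snd p)) sequentially"
    proof (rule uniform_limitI)
      fix r :: real assume r: "0 < r"
      have "(\<lambda>n. ?K * ((2 * ?e n) powr (1 - \<mu>) / (1 - \<mu>))) \<longlonglongrightarrow> ?K * (0 powr (1 - \<mu>) / (1 - \<mu>))"
      proof (intro tendsto_intros tendsto_powr2)
        have "(\<lambda>n. \<tau> / 2 * inverse (real (Suc n))) \<longlonglongrightarrow> \<tau> / 2 * 0"
          by (intro tendsto_intros LIMSEQ_inverse_real_of_nat)
        moreover have "2 * ?e n = \<tau> / 2 * inverse (real (Suc n))" for n
          by (simp add: divide_simps)
        ultimately show "(\<lambda>n. 2 * ?e n) \<longlonglongrightarrow> 0"
          by (simp only: mult_zero_right)
      qed (use \<mu> \<tau> in auto)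
      then have "\<forall>\<^sub>F n in sequentially. ?K * ((2 * ?e n) powr (1 - \<mu>) / (1 - \<mu>)) < r"
        using r by (intro order_tendstoD(2)) auto
      then show "\<forall>\<^sub>F n in sequentially. \<forall>p\<in>UNIV \<times> {t. \<tau> < t \<and> ereal t < T}.
          dist (LINT z|lborel. trunc_integrand (?e n) H f (fst p) (snd p) z) (duhamel H f (fst p) (snd p)) < r"
      proof eventually_elim
        case (elim n)
        show ?case
        proof
          fix p :: "'a \<times> real" assume p: "p \<in> UNIV \<times> {t. \<tau> < t \<and> ereal t < T}"
          then have "\<tau> \<le> snd p" "ereal (snd p) < T" by auto
          from duhamel_minus_trunc[OF H f e(1)[of n] e(2)[of n] this, of "fst p"] elim
          show "dist (LINT z|lborel. trunc_integrand (?e n) H f (fst p) (snd p) z) (duhamel H f (fst p) (snd p)) < r"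
            unfolding dist_real_def by (subst abs_minus_commute) linarith
        qed
      qed
    qed
  qed simp
  then show ?thesis
    by (rule continuous_on_positive_times)
qed

end

section \<open>Picard iteration\<close>

lemma measurable_power_nonlinearity [measurable]: "power_nonlinearity p \<in> borel_measurable borel"
  unfolding power_nonlinearity_def by measurable

lemma power_nonlinearity_minus: "power_nonlinearity p (- v) = - power_nonlinearity p v"
  by (simp add: power_nonlinearity_def)

text \<open>For arguments of equal sign this is the mean value theorem; for opposite signs |u - v| =
  |u| + |v|, and the size bound on each term suffices.\<close>

lemma power_nonlinearity_diff:
  assumes p: "1 < p" and uv: "\<bar>u\<bar> \<le> m" "\<bar>v\<bar> \<le> m"
  shows "\<bar>power_nonlinearity p u - power_nonlinearity p v\<bar> \<le> p * m powr (p - 1) * \<bar>u - v\<bar>"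
proof -
  have abs: "\<bar>power_nonlinearity p u\<bar> \<le> m powr (p - 1) * \<bar>u\<bar>" if "\<bar>u\<bar> \<le> m" for u
    using p that unfolding power_nonlinearity_def abs_mult by (intro mult_right_mono) (auto intro: powr_mono2)
  have le_p: "m powr (p - 1) * z \<le> p * m powr (p - 1) * z" if "0 \<le> z" for z
    using p that mult_right_mono[of 1 p "m powr (p - 1) * z"] by (simp add: mult.assoc)
  have pos: "\<bar>power_nonlinearity p u - power_nonlinearity p v\<bar> \<le> p * m powr (p - 1) * \<bar>u - v\<bar>"
    if "0 \<le> v" "v \<le> u" "u \<le> m" for u v
  \<comment> \<open>The derivative rule for \<open>powr\<close> wants a positive base, so v = 0 is
    left to the size bound.\<close>
  proof (cases "v = 0 \<or> u = v")
    case True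
    then show ?thesis
      using abs[of u] le_p[of "\<bar>u\<bar>"] that by (auto simp: power_nonlinearity_def)
  next
    case False
    then have v: "0 < v" "v < u" using that by auto
    have eq: "power_nonlinearity p x = x powr p" if "0 < x" for x
      using that powr_add[of x "p - 1" 1] by (simp add: power_nonlinearity_def)
    have "\<exists>z. v < z \<and> z < u \<and> u powr p - v powr p = (u - v) * (p * z powr (p - 1))"
      using v by (intro MVT2 has_real_derivative_powr) auto
    then obtain z where z: "v < z" "z < u" "u powr p - v powr p = (u - v) * (p * z powr (p - 1))"
      by blast
    have "z powr (p - 1) \<le> m powr (p - 1)"
      using z v that p by (intro powr_mono2) auto
    then have "(u - v) * (p * z powr (p - 1)) \<le> (u - v) * (p * m powr (p - 1))"
      using v p by (intro mult_left_mono) auto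
    moreover have "0 \<le> (u - v) * (p * z powr (p - 1))"
      using v p by (intro mult_nonneg_nonneg) auto
    ultimately show ?thesis
      using v z by (simp add: eq mult.commute)
  qed
  have nonneg: "\<bar>power_nonlinearity p u - power_nonlinearity p v\<bar> \<le> p * m powr (p - 1) * \<bar>u - v\<bar>"
    if "0 \<le> u" "0 \<le> v" "u \<le> m" "v \<le> m" for u v
    using pos[of v u] pos[of u v] that by (cases "v \<le> u") (auto simp: abs_minus_commute)
  have opp: "\<bar>power_nonlinearity p u - power_nonlinearity p v\<bar> \<le> p * m powr (p - 1) * \<bar>u - v\<bar>"
    if "u * v \<le> 0" "\<bar>u\<bar> \<le> m" "\<bar>v\<bar> \<le> m" for u v
  proof -
    have "\<bar>u - v\<bar> = \<bar>u\<bar> + \<bar>v\<bar>"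
      using that(1) by (auto simp: mult_le_0_iff)
    moreover have "\<bar>power_nonlinearity p u - power_nonlinearity p v\<bar> \<le>
        \<bar>power_nonlinearity p u\<bar> + \<bar>power_nonlinearity p v\<bar>"
      by (rule abs_triangle_ineq4)
    ultimately show ?thesis
      using abs[OF that(2)] abs[OF that(3)] le_p[of "\<bar>u\<bar> + \<bar>v\<bar>"] by (simp add: distrib_left)
  qed
  consider "0 \<le> u \<and> 0 \<le> v" | "u \<le> 0 \<and> v \<le> 0" | "u * v \<le> 0"
    by (cases "0 \<le> u"; cases "0 \<le> v") (auto simp: mult_le_0_iff)
  then show ?thesis
  proof cases
    case 1
    then show ?thesis using nonneg[of u v] uv by auto
  next
    case 2
    then show ?thesis
      using nonneg[of "- u" "- v"] uv
      by (simp add: power_nonlinearity_minus abs_minus_commute)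
  next
    case 3
    then show ?thesis using opp uv by auto
  qed
qed

lemma geometric_increments_converge:
  fixes a :: "nat \<Rightarrow> real"
  assumes inc: "\<And>n. \<bar>a (Suc n) - a n\<bar> \<le> c * (1/2)^n"
  shows "a \<longlonglongrightarrow> lim a" and "\<bar>a n - lim a\<bar> \<le> 2 * c * (1/2)^n"
proof -
  have "summable (\<lambda>n. a (Suc n) - a n)"
    by (rule summable_comparison_test'[of "\<lambda>n. c * (1/2)^n"]) (use inc in \<open>auto intro!: summable_mult\<close>)
  then have "(\<lambda>n. \<Sum>k<n. a (Suc k) - a k) \<longlonglongrightarrow> (\<Sum>n. a (Suc n) - a n)"
    by (rule summable_LIMSEQ)
  then have "(\<lambda>n. a n - a 0 + a 0) \<longlonglongrightarrow> (\<Sum>n. a (Suc n) - a n) + a 0"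
    unfolding sum_lessThan_telescope by (intro tendsto_intros)
  then show lim: "a \<longlonglongrightarrow> lim a"
    by (simp add: convergent_def convergent_LIMSEQ_iff[symmetric]) (metis convergentI convergent_LIMSEQ_iff)
  \<comment> \<open>Subtracting the tail that is still to come lets the induction close: each step
    uses exactly one term of the geometric series.\<close>
  have tail: "\<bar>a n - a (n + k)\<bar> \<le> 2 * c * (1/2)^n - 2 * c * (1/2)^(n + k)" for k
  proof (induction k)
    case (Suc k)
    then show ?case
      using inc[of "n + k"] by simp
  qed simp
  have c: "0 \<le> c"
    using inc[of 0] by simp
  have "\<bar>a n - a (n + k)\<bar> \<le> 2 * c * (1/2)^n" for k
  proof -
    have "0 \<le> 2 * c * (1/2)^(n + k)" using c by simp
    then show ?thesis using tail[of k] by linarith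
  qed
  moreover have "(\<lambda>k. \<bar>a n - a (n + k)\<bar>) \<longlonglongrightarrow> \<bar>a n - lim a\<bar>"
    using LIMSEQ_ignore_initial_segment[OF lim, of n] by (intro tendsto_intros) (simp add: add.commute)
  ultimately show "\<bar>a n - lim a\<bar> \<le> 2 * c * (1/2)^n"
    by (intro LIMSEQ_le_const2) auto
qed

lemma measurable_singular_kernel_slice:
  assumes "singular_kernel d \<mu> G C" "0 < t"
  shows "(\<lambda>y. G (x - y) t) \<in> borel_measurable borel"
proof -
  have "continuous_on UNIV (\<lambda>y. (\<lambda>(x, t). G x t) (x - y, t))"
    by (rule continuous_on_compose2[of "UNIV \<times> {0<..}" "\<lambda>(x, t). G x t"])
       (use assms in \<open>auto simp: singular_kernel_def intro!: continuous_intros\<close>)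
  then show ?thesis
    by (auto intro: borel_measurable_continuous_onI)
qed

section \<open>The linear evolution of the datum\<close>

context weighted_duhamel
begin

lemma measurable_linear_integrand:
  assumes "singular_kernel d 0 G C" "0 < t"
  shows "(\<lambda>y. G (x - y) t * \<phi> y) \<in> borel_measurable borel"
  using measurable_singular_kernel_slice[OF assms] by simp

lemma nn_integral_linear:
  assumes G: "singular_kernel d 0 G C" and t: "0 < t" "ereal t < T"
  shows "(\<integral>\<^sup>+y. ennreal \<bar>G (x - y) t * \<phi> y\<bar> \<partial>lborel) \<le> ennreal (C * weight x t)"
proof -
  have C: "0 \<le> C" using G by (simp add: singular_kernel_def)
  have "(\<integral>\<^sup>+y. ennreal \<bar>G (x - y) t * \<phi> y\<bar> \<partial>lborel) \<le>
     (\<integral>\<^sup>+y. ennreal C * (ennreal (decay_kernel (t powr (1 / d)) (x - y)) * ennreal \<bar>\<phi> y\<bar>) \<partial>lborel)"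
  proof (intro nn_integral_mono)
    fix y
    have "\<bar>G (x - y) t\<bar> * \<bar>\<phi> y\<bar> \<le> C * decay_kernel (t powr (1 / d)) (x - y) * \<bar>\<phi> y\<bar>"
      using G t by (intro mult_right_mono) (auto simp: singular_kernel_def)
    then show "ennreal \<bar>G (x - y) t * \<phi> y\<bar> \<le>
        ennreal C * (ennreal (decay_kernel (t powr (1 / d)) (x - y)) * ennreal \<bar>\<phi> y\<bar>)"
      using C by (simp add: abs_mult ennreal_mult[symmetric] decay_kernel_nonneg ennreal_leI mult.assoc)
  qed
  also have "\<dots> = ennreal C * kernel_average \<phi> (t powr (1 / d)) x"
    unfolding kernel_average_def by (intro nn_integral_cmult) measurable
  also have "\<dots> = ennreal (C * weight x t)"
    using C weight_nonneg[of x t] by (simp add: ennreal_weight[OF t, symmetric] ennreal_mult)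
  finally show ?thesis .
qed

lemma integrable_linear:
  assumes G: "singular_kernel d 0 G C" and t: "0 < t" "ereal t < T"
  shows "integrable lborel (\<lambda>y. G (x - y) t * \<phi> y)"
  using nn_integral_linear[OF assms, of x] measurable_linear_integrand[OF assms(1,2), of x]
  by (intro integrableI_bounded) (auto intro: le_less_trans)

definition linear_part :: "('a \<Rightarrow> real \<Rightarrow> real) \<Rightarrow> 'a \<Rightarrow> real \<Rightarrow> real" where
  "linear_part G x t = (LINT y|lborel. G (x - y) t * \<phi> y)"

lemma linear_part_bound:
  assumes G: "singular_kernel d 0 G C" and t: "0 < t" "ereal t < T"
  shows "\<bar>linear_part G x t\<bar> \<le> C * weight x t"
proof -
  have "ennreal (norm (linear_part G x t)) \<le> (\<integral>\<^sup>+y. ennreal (norm (G (x - y) t * \<phi> y)) \<partial>lborel)"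
    unfolding linear_part_def by (rule integral_norm_bound_ennreal[OF integrable_linear[OF assms]])
  also have "\<dots> \<le> ennreal (C * weight x t)"
    using nn_integral_linear[OF assms, of x] by simp
  finally show ?thesis
    using G weight_nonneg[of x t] by (simp add: ennreal_le_iff singular_kernel_def)
qed

text \<open>Times between t0/2 and 2 t0 have scales in [a, b]; the dominating kernel is integrable
  against the datum because its own time t0/2 lies in (0, T).\<close>

lemma continuous_on_linear_part:
  assumes G: "singular_kernel d 0 G C"
  shows "continuous_on (UNIV \<times> {t. 0 < t \<and> ereal t < T}) (\<lambda>p. linear_part G (fst p) (snd p))"
  unfolding linear_part_def
proof (rule continuous_on_integral_dominated)
  fix p0 :: "'a \<times> real" assume p0: "p0 \<in> UNIV \<times> {t. 0 < t \<and> ereal t < T}"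
  define x0 t0 where "x0 = fst p0" and "t0 = snd p0"
  have t0: "0 < t0" "ereal t0 < T" using p0 by (auto simp: t0_def)
  have C: "0 \<le> C" using G by (simp add: singular_kernel_def)
  define a b where "a = (t0 / 2) powr (1 / d)" and "b = (2 * t0) powr (1 / d)"
  have a: "0 < a" using t0 by (auto simp: a_def)
  have "ereal (t0 / 2) < T" using t0 by (intro le_less_trans[OF _ t0(2)]) auto
  then have fin: "kernel_average \<phi> a x0 < \<infinity>"
    unfolding a_def using t0 by (intro kernel_average_finite) auto
  let ?g = "\<lambda>y. C * (b / a * 2 ^ (DIM('a) + 1)) * (decay_kernel a (x0 - y) * \<bar>\<phi> y\<bar>)"
  have "integrable lborel (\<lambda>y. decay_kernel a (x0 - y) * \<bar>\<phi> y\<bar>)"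
  proof (rule integrableI_nonneg)
    have "(\<integral>\<^sup>+y. ennreal (decay_kernel a (x0 - y) * \<bar>\<phi> y\<bar>) \<partial>lborel) = kernel_average \<phi> a x0"
      unfolding kernel_average_def using a
      by (intro nn_integral_cong) (simp add: ennreal_mult decay_kernel_nonneg)
    then show "(\<integral>\<^sup>+y. ennreal (decay_kernel a (x0 - y) * \<bar>\<phi> y\<bar>) \<partial>lborel) < \<infinity>"
      using fin by simp
  qed (use a in \<open>auto simp: decay_kernel_nonneg\<close>)
  then have "integrable lborel ?g" by simp
  moreover have "\<forall>\<^sub>F p in at p0 within UNIV \<times> {t. 0 < t \<and> ereal t < T}.
      \<forall>y\<in>space lborel. \<bar>G (fst p - y) (snd p) * \<phi> y\<bar> \<le> ?g y"
  proof -
    have "((\<lambda>p. norm (fst p - x0)) \<longlongrightarrow> norm (fst p0 - x0)) (at p0 within UNIV \<times> {t. 0 < t \<and> ereal t < T})"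
      by (intro tendsto_intros)
    then have "\<forall>\<^sub>F p in at p0 within UNIV \<times> {t. 0 < t \<and> ereal t < T}. norm (fst p - x0) < a"
      using a by (intro order_tendstoD(2)) (auto simp: x0_def)
    moreover have s: "((\<lambda>p. snd p) \<longlongrightarrow> t0) (at p0 within UNIV \<times> {t. 0 < t \<and> ereal t < T})"
      unfolding t0_def by (intro tendsto_intros)
    then have "\<forall>\<^sub>F p in at p0 within UNIV \<times> {t. 0 < t \<and> ereal t < T}. snd p < 2 * t0"
      using t0 by (intro order_tendstoD(2)) auto
    moreover have "\<forall>\<^sub>F p in at p0 within UNIV \<times> {t. 0 < t \<and> ereal t < T}. t0 / 2 < snd p"
      using t0 by (intro order_tendstoD(1)[OF s]) auto
    ultimately show ?thesis
    proof eventually_elim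
      case (elim p)
      show ?case
      proof
        fix y
        have "decay_kernel (snd p powr (1 / d)) (fst p - y) \<le> b / a * 2 ^ (DIM('a) + 1) * decay_kernel a (x0 - y)"
          using elim t0 d by (intro decay_kernel_le_dominating[OF a]) (auto simp: a_def b_def intro!: powr_mono2)
        then have "C * decay_kernel (snd p powr (1 / d)) (fst p - y) \<le> C * (b / a * 2 ^ (DIM('a) + 1) * decay_kernel a (x0 - y))"
          using C by (rule mult_left_mono)
        moreover have "\<bar>G (fst p - y) (snd p)\<bar> \<le> C * decay_kernel (snd p powr (1 / d)) (fst p - y)"
          using G elim t0 by (auto simp: singular_kernel_def)
        ultimately have "\<bar>G (fst p - y) (snd p)\<bar> \<le> C * (b / a * 2 ^ (DIM('a) + 1) * decay_kernel a (x0 - y))"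
          by linarith
        then have "\<bar>G (fst p - y) (snd p)\<bar> * \<bar>\<phi> y\<bar> \<le> C * (b / a * 2 ^ (DIM('a) + 1) * decay_kernel a (x0 - y)) * \<bar>\<phi> y\<bar>"
          by (rule mult_right_mono) simp
        then show "\<bar>G (fst p - y) (snd p) * \<phi> y\<bar> \<le> ?g y"
          by (simp only: abs_mult mult.assoc)
      qed
    qed
  qed
  ultimately show "\<exists>g. integrable lborel g \<and> (\<forall>\<^sub>F p in at p0 within UNIV \<times> {t. 0 < t \<and> ereal t < T}.
      \<forall>y\<in>space lborel. \<bar>G (fst p - y) (snd p) * \<phi> y\<bar> \<le> g y)"
    by blast
next
  fix y
  have "continuous_on (UNIV \<times> {t. 0 < t \<and> ereal t < T}) (\<lambda>p. (\<lambda>(x, t). G x t) (fst p - y, snd p))"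
    by (rule continuous_on_compose2[of "UNIV \<times> {0<..}" "\<lambda>(x, t). G x t"])
       (use G in \<open>auto simp: singular_kernel_def intro!: continuous_intros\<close>)
  then show "continuous_on (UNIV \<times> {t. 0 < t \<and> ereal t < T}) (\<lambda>p. G (fst p - y) (snd p) * \<phi> y)"
    by (intro continuous_on_mult_right) simp
next
  fix p :: "'a \<times> real" assume "p \<in> UNIV \<times> {t. 0 < t \<and> ereal t < T}"
  then show "(\<lambda>y. G (fst p - y) (snd p) * \<phi> y) \<in> borel_measurable lborel"
    using measurable_linear_integrand[OF G, of "snd p" "fst p"] by auto
qed

end

section \<open>Fixed point of the Duhamel map\<close>

text \<open>\<open>M\<close> is twice the bound of the linear part, which leaves M / 2 for the
  Duhamel term. \<open>critical\<close> is the scaling relation between the datum and the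
  nonlinearity, \<open>small\<close> makes the contraction factor 1/2.\<close>

locale picard_iteration = weighted_duhamel \<phi> d \<mu> A \<kappa> T
  for \<phi> :: "'a::euclidean_space \<Rightarrow> real" and d \<mu> A \<kappa> :: real and T :: ereal +
  fixes p :: real and G H :: "'a \<Rightarrow> real \<Rightarrow> real" and C\<^sub>G C\<^sub>H M :: real
  assumes p: "1 < p" and G: "singular_kernel d 0 G C\<^sub>G" and H: "singular_kernel d \<mu> H C\<^sub>H"
    and M: "M = 2 * C\<^sub>G" and critical: "\<kappa> * (p - 1) = 1 - \<mu>"
    and small: "duhamel_const TYPE('a) \<mu> * C\<^sub>H * (p * (M * A) powr (p - 1)) \<le> 1 / 2"
begin

lemma M_nonneg: "0 \<le> M"
  using G by (simp add: M singular_kernel_def)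

text \<open>Set to 0 outside (0, T), which makes it Borel on all of space-time although
  \<open>v\<close> is controlled only on (0, T).\<close>

definition nonlin :: "('a \<Rightarrow> real \<Rightarrow> real) \<Rightarrow> 'a \<times> real \<Rightarrow> real" where
  "nonlin v z = (if 0 < snd z \<and> ereal (snd z) < T then power_nonlinearity p (v (fst z) (snd z)) else 0)"

text \<open>The weighted ball that the iteration never leaves. Continuity is carried along because
  it yields measurability of the nonlinearity.\<close>

definition dominated :: "('a \<Rightarrow> real \<Rightarrow> real) \<Rightarrow> bool" where
  "dominated v \<longleftrightarrow> continuous_on (UNIV \<times> {t. 0 < t \<and> ereal t < T}) (\<lambda>z. v (fst z) (snd z)) \<and>
     (\<forall>x t. 0 < t \<longrightarrow> ereal t < T \<longrightarrow> \<bar>v x t\<bar> \<le> M * weight x t)"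

lemma measurable_nonlin:
  assumes "dominated v"
  shows "nonlin v \<in> borel_measurable borel"
proof -
  have "open ({0<..} \<inter> ereal -` {..<T})"
    by (intro open_Int open_vimage continuous_on_ereal) auto
  then have "open (UNIV \<times> {t. 0 < t \<and> ereal t < T} :: ('a \<times> real) set)"
    by (intro open_Times) (auto simp: vimage_def Int_def)
  then have "(\<lambda>z. indicator (UNIV \<times> {t. 0 < t \<and> ereal t < T}) z *\<^sub>R v (fst z) (snd z)) \<in> borel_measurable borel"
    using assms unfolding dominated_def by (intro borel_measurable_continuous_on_indicator) auto
  then have "(\<lambda>z. power_nonlinearity p (indicator (UNIV \<times> {t. 0 < t \<and> ereal t < T}) z *\<^sub>R v (fst z) (snd z))) \<in> borel_measurable borel"
    by (rule measurable_compose[OF _ measurable_power_nonlinearity])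
  then show ?thesis
    by (rule measurable_cong[THEN iffD1, rotated])
       (auto simp: nonlin_def indicator_def power_nonlinearity_def)
qed

text \<open>In the Lipschitz constant p (M w)^(p-1) the weight is replaced by its supremum; the
  factor w of the difference is retained.\<close>

lemma source_nonlin_diff:
  assumes v: "dominated v" "dominated v'" and \<delta>: "0 \<le> \<delta>"
    and diff: "\<And>x t. 0 < t \<Longrightarrow> ereal t < T \<Longrightarrow> \<bar>v x t - v' x t\<bar> \<le> \<delta> * weight x t"
  shows "source (\<lambda>z. nonlin v z - nonlin v' z) (p * (M * A) powr (p - 1) * \<delta>)"
  unfolding source_def
proof (intro conjI allI impI)
  show "0 \<le> p * (M * A) powr (p - 1) * \<delta>"
    using p \<delta> by simp
  show "(\<lambda>z. nonlin v z - nonlin v' z) \<in> borel_measurable borel"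
    using measurable_nonlin[OF v(1)] measurable_nonlin[OF v(2)] by simp
  fix y s assume s: "0 < s" "ereal s < T"
  have "\<bar>nonlin v (y, s) - nonlin v' (y, s)\<bar> \<le> p * (M * weight y s) powr (p - 1) * \<bar>v y s - v' y s\<bar>"
    using s v unfolding nonlin_def dominated_def
    by (simp add: power_nonlinearity_diff[OF p])
  also have "\<dots> \<le> p * (M * (A * s powr (-\<kappa>))) powr (p - 1) * (\<delta> * weight y s)"
    using p s M_nonneg weight_nonneg[of y s]
    by (intro mult_mono diff mult_left_mono powr_mono2 weight_le) auto
  \<comment> \<open>Here criticality enters: s^(-\<kappa>(p-1)) is exactly the s^(\<mu>-1) of a
    \<open>source\<close>.\<close>
  also have "(M * (A * s powr (-\<kappa>))) powr (p - 1) = (M * A) powr (p - 1) * s powr (\<mu> - 1)"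
  proof -
    have "- (\<kappa> * (p - 1)) = \<mu> - 1" using critical by simp
    then show ?thesis
      using M_nonneg A s unfolding mult.assoc[symmetric] by (simp add: powr_mult powr_powr)
  qed
  finally show "\<bar>nonlin v (y, s) - nonlin v' (y, s)\<bar> \<le> p * (M * A) powr (p - 1) * \<delta> * s powr (\<mu> - 1) * weight y s"
    by (simp add: mult_ac)
qed

lemma dominated_zero: "dominated (\<lambda>_ _. 0)"
  using M_nonneg weight_nonneg by (simp add: dominated_def)

lemma nonlin_zero: "nonlin (\<lambda>_ _. 0) = (\<lambda>_. 0)"
  by (auto simp: nonlin_def power_nonlinearity_def)

lemma source_nonlin:
  assumes "dominated v"
  shows "source (nonlin v) (p * (M * A) powr (p - 1) * M)"
proof -
  show ?thesis
    using source_nonlin_diff[OF assms dominated_zero M_nonneg] assms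
    by (simp add: dominated_def nonlin_zero)
qed

lemma duhamel_nonlin_diff:
  assumes v: "dominated v" "dominated v'" and \<delta>: "0 \<le> \<delta>"
    and diff: "\<And>x t. 0 < t \<Longrightarrow> ereal t < T \<Longrightarrow> \<bar>v x t - v' x t\<bar> \<le> \<delta> * weight x t"
    and t: "0 < t" "ereal t < T"
  shows "\<bar>duhamel H (nonlin v) x t - duhamel H (nonlin v') x t\<bar> \<le> \<delta> / 2 * weight x t"
proof -
  have "\<bar>duhamel H (nonlin v) x t - duhamel H (nonlin v') x t\<bar> \<le>
      duhamel_const TYPE('a) \<mu> * C\<^sub>H * (p * (M * A) powr (p - 1) * \<delta>) * weight x t"
    unfolding duhamel_diff[OF H source_nonlin[OF v(1)] source_nonlin[OF v(2)] t]
    by (intro duhamel_bound[OF H source_nonlin_diff[OF v \<delta> diff] t])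
  also have "\<dots> = (duhamel_const TYPE('a) \<mu> * C\<^sub>H * (p * (M * A) powr (p - 1))) * (\<delta> * weight x t)"
    by (simp add: mult_ac)
  also have "\<dots> \<le> 1 / 2 * (\<delta> * weight x t)"
    using small \<delta> weight_nonneg[of x t] by (intro mult_right_mono) auto
  finally show ?thesis by simp
qed

definition picard_map :: "('a \<Rightarrow> real \<Rightarrow> real) \<Rightarrow> 'a \<Rightarrow> real \<Rightarrow> real" where
  "picard_map v x t = linear_part G x t + duhamel H (nonlin v) x t"

lemma dominated_picard_map:
  assumes "dominated v"
  shows "dominated (picard_map v)"
  unfolding dominated_def
proof (intro conjI allI impI)
  show "continuous_on (UNIV \<times> {t. 0 < t \<and> ereal t < T}) (\<lambda>z. picard_map v (fst z) (snd z))"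
    unfolding picard_map_def
    by (intro continuous_on_add continuous_on_linear_part[OF G] continuous_on_duhamel[OF H source_nonlin[OF assms]])
  fix x t assume t: "0 < t" "ereal t < T"
  \<comment> \<open>The Duhamel term is estimated as a difference from that of the zero function,
    which costs M / 2; the linear part takes the other half, \<open>C\<^sub>G\<close>.\<close>
  have z: "duhamel H (nonlin (\<lambda>_ _. 0)) x t = 0"
    by (simp add: duhamel_def duhamel_integrand_def nonlin_zero)
  have "\<bar>duhamel H (nonlin v) x t - duhamel H (nonlin (\<lambda>_ _. 0)) x t\<bar> \<le> M / 2 * weight x t"
    using assms by (intro duhamel_nonlin_diff dominated_zero M_nonneg t) (auto simp: dominated_def)
  then show "\<bar>picard_map v x t\<bar> \<le> M * weight x t"
    using linear_part_bound[OF G t, of x] unfolding picard_map_def z M by simp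
qed

definition picard_seq :: "nat \<Rightarrow> 'a \<Rightarrow> real \<Rightarrow> real" where
  "picard_seq n = (picard_map ^^ n) (\<lambda>_ _. 0)"

lemma dominated_picard_seq: "dominated (picard_seq n)"
  by (induction n) (auto simp: picard_seq_def dominated_zero dominated_picard_map)

lemma picard_seq_Suc: "picard_seq (Suc n) = picard_map (picard_seq n)"
  by (simp add: picard_seq_def)

lemma picard_seq_diff:
  assumes "0 < t" "ereal t < T"
  shows "\<bar>picard_seq (Suc n) x t - picard_seq n x t\<bar> \<le> M * (1/2)^n * weight x t"
  using assms
proof (induction n arbitrary: x t)
  case 0
  then show ?case
    using dominated_picard_seq[of 1] by (simp add: dominated_def picard_seq_def)
next
  case (Suc n)
  have "\<bar>duhamel H (nonlin (picard_seq (Suc n))) x t - duhamel H (nonlin (picard_seq n)) x t\<bar> \<le>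
      (M * (1/2)^n) / 2 * weight x t"
    using M_nonneg Suc by (intro duhamel_nonlin_diff dominated_picard_seq) auto
  then show ?case
    by (simp add: picard_seq_Suc[of "Suc n"] picard_seq_Suc[of n] picard_map_def)
qed

definition picard_limit :: "'a \<Rightarrow> real \<Rightarrow> real" where
  "picard_limit x t = lim (\<lambda>n. picard_seq n x t)"

lemma
  assumes t: "0 < t" "ereal t < T"
  shows picard_seq_tendsto: "(\<lambda>n. picard_seq n x t) \<longlonglongrightarrow> picard_limit x t"
    and picard_seq_minus_limit: "\<bar>picard_seq n x t - picard_limit x t\<bar> \<le> 2 * M * (1/2)^n * weight x t"
  unfolding picard_limit_def
  using geometric_increments_converge[of "\<lambda>n. picard_seq n x t" "M * weight x t"] picard_seq_diff[OF t, of _ x]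
  by (simp_all add: mult_ac)

text \<open>For t > \<tau> the weight is bounded, so convergence relative to the weight is uniform
  there and continuity passes to the limit.\<close>

lemma dominated_picard_limit: "dominated picard_limit"
  unfolding dominated_def
proof (intro conjI allI impI)
  fix x t assume t: "0 < t" "ereal t < T"
  have "(\<lambda>n. \<bar>picard_seq n x t\<bar>) \<longlonglongrightarrow> \<bar>picard_limit x t\<bar>"
    by (intro tendsto_intros picard_seq_tendsto t)
  then show "\<bar>picard_limit x t\<bar> \<le> M * weight x t"
    using dominated_picard_seq t by (intro LIMSEQ_le_const2) (auto simp: dominated_def)
next
  show "continuous_on (UNIV \<times> {t. 0 < t \<and> ereal t < T}) (\<lambda>z. picard_limit (fst z) (snd z))"
  proof (rule continuous_on_positive_times)
    fix \<tau> :: real assume \<tau>: "0 < \<tau>" "ereal \<tau> < T"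
    let ?S = "UNIV \<times> {t. \<tau> < t \<and> ereal t < T} :: ('a \<times> real) set"
    show "continuous_on ?S (\<lambda>z. picard_limit (fst z) (snd z))"
    proof (rule uniform_limit_theorem)
      show "\<forall>\<^sub>F n in sequentially. continuous_on ?S (\<lambda>z. picard_seq n (fst z) (snd z))"
      proof (intro always_eventually allI)
        fix n
        show "continuous_on ?S (\<lambda>z. picard_seq n (fst z) (snd z))"
          by (rule continuous_on_subset[of "UNIV \<times> {t. 0 < t \<and> ereal t < T}"])
             (use dominated_picard_seq[of n] \<tau> in \<open>auto simp: dominated_def\<close>)
      qed
      show "uniform_limit ?S (\<lambda>n z. picard_seq n (fst z) (snd z)) (\<lambda>z. picard_limit (fst z) (snd z)) sequentially"
      proof (rule uniform_limitI)
        fix e :: real assume e: "0 < e"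
        have "(\<lambda>n. 2 * M * (1/2)^n * (A * \<tau> powr (-\<kappa>))) \<longlonglongrightarrow> 2 * M * 0 * (A * \<tau> powr (-\<kappa>))"
          by (intro tendsto_intros) auto
        then have "\<forall>\<^sub>F n in sequentially. 2 * M * (1/2)^n * (A * \<tau> powr (-\<kappa>)) < e"
          using e by (intro order_tendstoD(2)) auto
        then show "\<forall>\<^sub>F n in sequentially. \<forall>z\<in>?S. dist (picard_seq n (fst z) (snd z)) (picard_limit (fst z) (snd z)) < e"
        proof eventually_elim
          case (elim n)
          show ?case
          proof
            fix z assume "z \<in> ?S"
            then have t: "\<tau> < snd z" "0 < snd z" "ereal (snd z) < T" using \<tau> by auto
            have "weight (fst z) (snd z) \<le> A * snd z powr (-\<kappa>)"
              by (rule weight_le[OF t(2,3)])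
            also have "\<dots> \<le> A * \<tau> powr (-\<kappa>)"
              using A \<kappa> \<tau> t by (intro mult_left_mono powr_mono2') auto
            finally have "2 * M * (1/2)^n * weight (fst z) (snd z) \<le> 2 * M * (1/2)^n * (A * \<tau> powr (-\<kappa>))"
              using M_nonneg by (intro mult_left_mono) auto
            then show "dist (picard_seq n (fst z) (snd z)) (picard_limit (fst z) (snd z)) < e"
              using picard_seq_minus_limit[OF t(2,3), of n "fst z"] elim unfolding dist_real_def by linarith
          qed
        qed
      qed
    qed simp
  qed
qed

text \<open>The limit passes through the Duhamel term by the contraction estimate itself, applied to
  the n-th iterate and the limit with \<delta> = 2 M 2^(-n).\<close>

lemma picard_limit_fixed_point:
  assumes t: "0 < t" "ereal t < T"
  shows "picard_limit x t = linear_part G x t + duhamel H (nonlin picard_limit) x t"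
proof -
  have "(\<lambda>n. duhamel H (nonlin (picard_seq n)) x t - duhamel H (nonlin picard_limit) x t) \<longlonglongrightarrow> 0"
  proof (rule Lim_null_comparison)
    show "\<forall>\<^sub>F n in sequentially. norm (duhamel H (nonlin (picard_seq n)) x t - duhamel H (nonlin picard_limit) x t) \<le>
        (2 * M * (1/2)^n) / 2 * weight x t"
      unfolding real_norm_def using M_nonneg picard_seq_minus_limit
      by (intro always_eventually allI duhamel_nonlin_diff dominated_picard_seq dominated_picard_limit t) auto
    have "(\<lambda>n. (2 * M * (1/2)^n) / 2 * weight x t) \<longlonglongrightarrow> (2 * M * 0) / 2 * weight x t"
      by (intro tendsto_intros) auto
    then show "(\<lambda>n. (2 * M * (1/2)^n) / 2 * weight x t) \<longlonglongrightarrow> 0" by simp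
  qed
  then have "(\<lambda>n. linear_part G x t + duhamel H (nonlin (picard_seq n)) x t) \<longlonglongrightarrow>
      linear_part G x t + duhamel H (nonlin picard_limit) x t"
    by (intro tendsto_intros) (simp add: LIM_zero_iff)
  then have "(\<lambda>n. picard_seq (Suc n) x t) \<longlonglongrightarrow> linear_part G x t + duhamel H (nonlin picard_limit) x t"
    by (simp add: picard_seq_Suc picard_map_def)
  then show ?thesis
    using LIMSEQ_unique LIMSEQ_Suc[OF picard_seq_tendsto[OF t]] by blast
qed

end

section \<open>Existence of a solution\<close>

lemma singular_kernel_kernel_deriv:
  fixes \<alpha> :: "'n::finite \<Rightarrow> nat"
  assumes "1 < d"
  shows "\<exists>C. singular_kernel d (real (\<Sum>j\<in>UNIV. \<alpha> j) / d) (kernel_deriv d \<alpha>) C"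
  using kernel_deriv_bound[OF assms, of \<alpha>] continuous_on_kernel_deriv[of d \<alpha>] assms
  unfolding singular_kernel_def by auto

text \<open>Lets the iteration treat the whole sum over multi-indices as one Duhamel
  operator.\<close>

lemma singular_kernel_sum:
  assumes "finite I" "\<And>i. i \<in> I \<Longrightarrow> singular_kernel d \<mu> (K i) (C i)"
  shows "singular_kernel d \<mu> (\<lambda>x t. \<Sum>i\<in>I. c i * K i x t) (\<Sum>i\<in>I. \<bar>c i\<bar> * C i)"
  unfolding singular_kernel_def
proof (intro conjI allI impI)
  show "0 \<le> (\<Sum>i\<in>I. \<bar>c i\<bar> * C i)"
    using assms by (intro sum_nonneg) (auto simp: singular_kernel_def)
  have "continuous_on (UNIV \<times> {0<..}) (\<lambda>z. \<Sum>i\<in>I. c i * (case z of (x, t) \<Rightarrow> K i x t))"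
    using assms by (intro continuous_intros) (auto simp: singular_kernel_def)
  then show "continuous_on (UNIV \<times> {0<..}) (\<lambda>(x, t). \<Sum>i\<in>I. c i * K i x t)"
    by (simp add: case_prod_beta)
  fix t :: real and x assume t: "0 < t"
  have "\<bar>\<Sum>i\<in>I. c i * K i x t\<bar> \<le> (\<Sum>i\<in>I. \<bar>c i\<bar> * (C i * t powr (-\<mu>) * decay_kernel (t powr (1 / d)) x))"
    using assms t
    by (intro order_trans[OF sum_abs] sum_mono) (auto simp: abs_mult singular_kernel_def intro!: mult_left_mono)
  also have "\<dots> = (\<Sum>i\<in>I. \<bar>c i\<bar> * C i) * t powr (-\<mu>) * decay_kernel (t powr (1 / d)) x"
    by (simp add: sum_distrib_right mult.assoc)
  finally show "\<bar>\<Sum>i\<in>I. c i * K i x t\<bar> \<le> (\<Sum>i\<in>I. \<bar>c i\<bar> * C i) * t powr (-\<mu>) * decay_kernel (t powr (1 / d)) x" .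
qed

section \<open>From the hypothesis on the datum to the integral equation\<close>

text \<open>The datum is the pointwise limit of its truncations to balls, hence Lebesgue measurable,
  and so equals a Borel function almost everywhere. The product-space arguments work with Borel
  functions.\<close>

lemma locally_integrable_borel_representative:
  fixes \<phi> :: "real ^ 'n \<Rightarrow> real"
  assumes "locally_integrable \<phi>"
  obtains \<psi> where "\<phi> \<in> borel_measurable lebesgue" "\<psi> \<in> borel_measurable borel" "AE y in lebesgue. \<phi> y = \<psi> y"
proof -
  have \<phi>: "\<phi> \<in> borel_measurable lebesgue"
  proof (rule borel_measurable_LIMSEQ_real)
    show "(\<lambda>y. indicator (cball 0 (real n)) y *\<^sub>R \<phi> y) \<in> borel_measurable lebesgue" for n
      using assms unfolding locally_integrable_def set_integrable_def
      by (intro borel_measurable_integrable) (use compact_cball in blast)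
    fix y :: "real ^ 'n"
    obtain k where k: "norm y \<le> real k" using real_arch_simple by blast
    show "(\<lambda>n. indicator (cball 0 (real n)) y *\<^sub>R \<phi> y) \<longlonglongrightarrow> \<phi> y"
    proof (rule tendsto_eventually, rule eventually_sequentiallyI)
      fix n assume "k \<le> n"
      then have "norm y \<le> real n" using k by (meson of_nat_mono order_trans)
      then show "indicator (cball 0 (real n)) y *\<^sub>R \<phi> y = \<phi> y" by simp
    qed
  qed
  then obtain \<psi> where \<psi>: "\<psi> \<in> borel_measurable lborel" "AE y in lborel. \<phi> y = \<psi> y"
    using completion_ex_borel_measurable_real by blast
  then show thesis
    by (intro that[of \<psi>] \<phi>) (auto intro: AE_completion)
qed

text \<open>The radius a is one competitor in the supremum. Local integrability ensures that the
  Bochner integral there is the true integral and not the default 0, so it may be turned into a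
  nonnegative integral.\<close>

lemma morrey_sup_ball_bound:
  fixes \<phi> \<psi> :: "real ^ 'n \<Rightarrow> real"
  assumes \<phi>: "locally_integrable \<phi>" and \<psi>: "\<psi> \<in> borel_measurable borel" "AE y in lebesgue. \<phi> y = \<psi> y"
    and sup: "morrey_sup d l p T \<phi> \<le> ereal \<gamma>" and a: "0 < a" "ereal a < time_root d T"
  shows "(\<integral>\<^sup>+y. indicator (ball x a) y * ennreal \<bar>\<psi> y\<bar> \<partial>lborel) \<le>
    ennreal (\<gamma> * a powr (- ((d - real l) / (p - 1)))) * emeasure lborel (ball (0 :: real ^ 'n) a)"
proof -
  let ?e = "(d - real l) / (p - 1)" and ?I = "LINT y:ball x a|lebesgue. \<bar>\<phi> y\<bar>"
  have V: "0 < measure lebesgue (ball x a)"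
    using a(1) content_ball_pos by (simp add: measure_def)
  have "ereal (a powr ?e * (?I / measure lebesgue (ball x a))) \<le> morrey_sup d l p T \<phi>"
    unfolding morrey_sup_def using a by (intro SUP_upper2[of x] SUP_upper2[of a]) auto
  then have "a powr ?e * (?I / measure lebesgue (ball x a)) \<le> \<gamma>"
    using sup by (metis ereal_less_eq(3) order_trans)
  then have I: "?I \<le> \<gamma> * a powr (- ?e) * measure lebesgue (ball x a)"
    using V a(1) by (simp add: field_simps powr_minus)
  have int: "set_integrable lebesgue (ball x a) \<phi>"
    by (rule set_integrable_subset[of lebesgue "cball x a"])
       (use \<phi> in \<open>auto simp: locally_integrable_def\<close>)
  then have int': "integrable lebesgue (\<lambda>y. indicator (ball x a) y *\<^sub>R \<bar>\<phi> y\<bar>)"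
    using set_integrable_abs unfolding set_integrable_def by blast
  have "(\<integral>\<^sup>+y. indicator (ball x a) y * ennreal \<bar>\<psi> y\<bar> \<partial>lborel) =
      (\<integral>\<^sup>+y. indicator (ball x a) y * ennreal \<bar>\<psi> y\<bar> \<partial>lebesgue)"
    using \<psi>(1) by (simp add: nn_integral_completion)
  also have "\<dots> = (\<integral>\<^sup>+y. ennreal (indicator (ball x a) y *\<^sub>R \<bar>\<phi> y\<bar>) \<partial>lebesgue)"
    by (intro nn_integral_cong_AE, use \<psi>(2) in eventually_elim) (auto simp: indicator_def)
  also have "\<dots> = ennreal ?I"
    unfolding set_lebesgue_integral_def using int' by (intro nn_integral_eq_integral) auto
  also have "\<dots> \<le> ennreal (\<gamma> * a powr (- ?e) * measure lebesgue (ball x a))"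
    by (intro ennreal_leI I)
  also have "\<dots> = ennreal (\<gamma> * a powr (- ?e)) * emeasure lborel (ball (0 :: real ^ 'n) a)"
  proof -
    have "ennreal (measure lebesgue (ball x a)) = emeasure lborel (ball x a)"
      using emeasure_lborel_ball_finite[of x a] by (simp add: emeasure_eq_ennreal_measure less_top[symmetric])
    also have "\<dots> = emeasure lborel (ball (0 :: real ^ 'n) a)"
      using a(1) by (simp add: emeasure_ball)
    finally show ?thesis
      by (subst ennreal_mult'') auto
  qed
  finally show ?thesis .
qed

lemma less_time_root:
  assumes "0 < t" "ereal t < T" "0 < d"
  shows "ereal (t powr (1 / d)) < time_root d T"
  using assms by (cases T) (auto simp: time_root_def intro!: powr_less_mono2)

context weighted_duhamel
begin

lemma duhamel_sum:
  assumes "finite I" "\<And>i. i \<in> I \<Longrightarrow> singular_kernel d \<mu> (K i) (C i)" "source f B" "0 < t" "ereal t < T"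
  shows "duhamel (\<lambda>x t. \<Sum>i\<in>I. c i * K i x t) f x t = (\<Sum>i\<in>I. c i * duhamel (K i) f x t)"
proof -
  have "duhamel_integrand (\<lambda>x t. \<Sum>i\<in>I. c i * K i x t) f x t = (\<lambda>z. \<Sum>i\<in>I. c i * duhamel_integrand (K i) f x t z)"
    by (rule ext) (simp add: duhamel_integrand_def sum_distrib_left sum_distrib_right mult_ac)
  then show ?thesis
    using integrable_duhamel[OF assms(2) assms(3-5)]
    by (simp add: duhamel_def Bochner_Integration.integral_sum)
qed

text \<open>The space-time integral converges absolutely, so it may be iterated in the order used by
  \<open>is_solution\<close>.\<close>

lemma duhamel_iterated:
  assumes "singular_kernel d \<mu> K C" "source f B" "0 < t" "ereal t < T"
  shows "duhamel K f x t = (LINT s|lborel. LINT y|lborel. duhamel_integrand K f x t (y, s))"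
proof -
  have "integrable (lborel \<Otimes>\<^sub>M lborel) (case_prod (\<lambda>y s. duhamel_integrand K f x t (y, s)))"
    using integrable_duhamel[OF assms, of x] by (simp add: lborel_prod)
  from lborel_pair.integral_snd[OF this] show ?thesis
    by (simp add: duhamel_def lborel_prod)
qed

end

theorem theorem7p3:
  fixes d p :: real and l :: nat and a :: "('n::finite \<Rightarrow> nat) \<Rightarrow> real"
  assumes "1 \<le> l" and "real l < d" and "1 < p"
  shows "\<exists>\<gamma>>0. \<forall>(\<phi> :: real ^ 'n \<Rightarrow> real) (T :: ereal).
           locally_integrable \<phi> \<and> 0 < T \<and> morrey_sup d l p T \<phi> \<le> ereal \<gamma> \<longrightarrow>
           (\<exists>u. is_solution d l a p \<phi> T u)"
proof -
  have d: "1 < d" using assms by simp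
  define \<mu> where "\<mu> = real l / d"
  have \<mu>: "0 < \<mu>" "\<mu> < 1" using assms by (auto simp: \<mu>_def)
  \<comment> \<open>The radius \<sigma> = t^(1/d) turns \<sigma>^(-(d-l)/(p-1)) into
    t^(-\<kappa>).\<close>
  define \<kappa> where "\<kappa> = (d - real l) / (p - 1) / d"
  have \<kappa>: "0 \<le> \<kappa>" "\<kappa> * (p - 1) = 1 - \<mu>"
    using assms by (auto simp: \<kappa>_def \<mu>_def field_simps)
  let ?I = "multi_indices l :: ('n \<Rightarrow> nat) set"
  have "\<exists>C. singular_kernel d \<mu> (kernel_deriv d \<alpha>) C" if "\<alpha> \<in> ?I" for \<alpha>
    using singular_kernel_kernel_deriv[OF d, of \<alpha>] that by (simp add: multi_indices_def \<mu>_def del: of_nat_sum)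
  then obtain C where C: "\<And>\<alpha>. \<alpha> \<in> ?I \<Longrightarrow> singular_kernel d \<mu> (kernel_deriv d \<alpha>) (C \<alpha>)"
    by metis
  define G :: "real ^ 'n \<Rightarrow> real \<Rightarrow> real" where "G = kernel_deriv d (\<lambda>_. 0)"
  obtain C\<^sub>G where G: "singular_kernel d 0 G C\<^sub>G"
    using singular_kernel_kernel_deriv[OF d, of "\<lambda>_::'n. 0"] by (auto simp: G_def)
  define H where "H x t = (\<Sum>\<alpha>\<in>?I. a \<alpha> * kernel_deriv d \<alpha> x t)" for x t
  define C\<^sub>H where "C\<^sub>H = (\<Sum>\<alpha>\<in>?I. \<bar>a \<alpha>\<bar> * C \<alpha>)"
  have H: "singular_kernel d \<mu> H C\<^sub>H"
    unfolding H_def C\<^sub>H_def by (intro singular_kernel_sum finite_multi_indices C)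
  define M where "M = 2 * C\<^sub>G"
  \<comment> \<open>The constant of \<open>kernel_average_le_ball_average\<close>.\<close>
  define A\<^sub>0 where "A\<^sub>0 = 2 ^ (CARD('n) + 1) * decay_mass TYPE(real ^ 'n)"
  define Q where "Q = duhamel_const TYPE(real ^ 'n) \<mu> * C\<^sub>H * p"
  have nn: "0 \<le> M" "0 \<le> A\<^sub>0" "0 \<le> Q"
    using G H duhamel_const_nonneg[OF \<mu>, where 'a="real ^ 'n"] decay_mass_nonneg[where 'a="real ^ 'n"] assms(3)
    by (auto simp: M_def A\<^sub>0_def Q_def singular_kernel_def)
  \<comment> \<open>Chosen so that \<open>Q * (M * (A\<^sub>0 * \<gamma>)) powr (p - 1)\<close> is
    at most 1/2, with \<open>A\<^sub>0 * \<gamma>\<close> as the constant of the weight bound. The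
    added 1's keep the denominators positive when \<open>Q\<close> or \<open>M * A\<^sub>0\<close>
    is 0.\<close>
  define \<gamma> where "\<gamma> = (1 / (2 * (Q + 1))) powr (1 / (p - 1)) / (M * A\<^sub>0 + 1)"
  have MA: "0 < M * A\<^sub>0 + 1" using nn by (simp add: add_nonneg_pos)
  have \<gamma>: "0 < \<gamma>"
    unfolding \<gamma>_def using MA nn by (intro divide_pos_pos) auto
  have small: "duhamel_const TYPE(real ^ 'n) \<mu> * C\<^sub>H * (p * (M * (A\<^sub>0 * \<gamma>)) powr (p - 1)) \<le> 1 / 2"
  proof -
    have "M * (A\<^sub>0 * \<gamma>) = M * A\<^sub>0 / (M * A\<^sub>0 + 1) * (1 / (2 * (Q + 1))) powr (1 / (p - 1))"
      by (simp add: \<gamma>_def)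
    also have "\<dots> \<le> 1 * (1 / (2 * (Q + 1))) powr (1 / (p - 1))"
      using MA nn by (intro mult_right_mono) auto
    finally have "(M * (A\<^sub>0 * \<gamma>)) powr (p - 1) \<le> (1 * (1 / (2 * (Q + 1))) powr (1 / (p - 1))) powr (p - 1)"
      using nn \<gamma> assms(3) by (intro powr_mono2) auto
    also have "\<dots> = 1 / (2 * (Q + 1))"
      using nn assms(3) by (simp add: powr_powr)
    finally have "Q * (M * (A\<^sub>0 * \<gamma>)) powr (p - 1) \<le> Q * (1 / (2 * (Q + 1)))"
      using nn by (intro mult_left_mono)
    also have "\<dots> \<le> 1 / 2"
      using nn by (simp add: field_simps)
    finally show ?thesis
      by (simp add: Q_def mult.assoc)
  qed
  show ?thesis
  proof (intro exI[of _ \<gamma>] conjI allI impI, fact \<gamma>, elim conjE)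
    fix \<phi> :: "real ^ 'n \<Rightarrow> real" and T :: ereal
    assume \<phi>: "locally_integrable \<phi>" and T: "0 < T" and sup: "morrey_sup d l p T \<phi> \<le> ereal \<gamma>"
    obtain \<psi> where m: "\<phi> \<in> borel_measurable lebesgue" and \<psi>: "\<psi> \<in> borel_measurable borel" "AE y in lebesgue. \<phi> y = \<psi> y"
      using locally_integrable_borel_representative[OF \<phi>] .
    \<comment> \<open>The iteration runs on the Borel representative; the datum itself returns only
      in the linear integral, where null sets do not matter.\<close>
    interpret picard_iteration \<psi> d \<mu> "A\<^sub>0 * \<gamma>" \<kappa> T p G H C\<^sub>G C\<^sub>H M
    proof
      fix t :: real and x :: "real ^ 'n" assume t: "0 < t" "ereal t < T"
      let ?r = "t powr (1 / d)"
      have "kernel_average \<psi> ?r x \<le> ennreal (2 ^ (DIM(real ^ 'n) + 1) * decay_mass TYPE(real ^ 'n) *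
          (\<gamma> * ?r powr (- ((d - real l) / (p - 1)))))"
        using t d \<gamma> less_time_root[OF t, of d]
        by (intro kernel_average_le_ball_average morrey_sup_ball_bound[OF \<phi> \<psi> sup] \<psi>) auto
      then show "kernel_average \<psi> ?r x \<le> ennreal (A\<^sub>0 * \<gamma> * t powr (-\<kappa>))"
        by (simp add: A\<^sub>0_def \<kappa>_def powr_powr mult.assoc mult.commute[of d])
    qed (use \<psi> d \<mu> \<kappa> nn \<gamma> assms(3) G H small in \<open>auto simp: M_def\<close>)
    define u where "u = picard_limit"
    have u: "dominated u" unfolding u_def by (rule dominated_picard_limit)
    have src: "source (nonlin u) (p * (M * (A\<^sub>0 * \<gamma>)) powr (p - 1) * M)"
      by (rule source_nonlin[OF u])
    have "is_solution d l a p \<phi> T u"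
      unfolding is_solution_def
    proof (intro conjI allI ballI impI; (elim conjE)?)
      fix \<tau> :: real assume \<tau>: "0 < \<tau>" "ereal \<tau> < T"
      show "bounded ((\<lambda>(x, t). u x t) ` (UNIV \<times> {t. \<tau> < t \<and> ereal t < T}))"
        unfolding bounded_iff
      proof (intro exI[of _ "M * (A\<^sub>0 * \<gamma> * \<tau> powr (-\<kappa>))"] ballI)
        fix v assume "v \<in> (\<lambda>(x, t). u x t) ` (UNIV \<times> {t. \<tau> < t \<and> ereal t < T})"
        then obtain x t where t: "\<tau> < t" "ereal t < T" and v: "v = u x t" by auto
        have "\<bar>u x t\<bar> \<le> M * weight x t"
          using u t \<tau> by (auto simp: dominated_def)
        also have "\<dots> \<le> M * (A\<^sub>0 * \<gamma> * t powr (-\<kappa>))"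
          using t \<tau> nn by (intro mult_left_mono weight_le) auto
        also have "\<dots> \<le> M * (A\<^sub>0 * \<gamma> * \<tau> powr (-\<kappa>))"
          using t \<tau> nn \<gamma> \<kappa> by (intro mult_left_mono powr_mono2') auto
        finally show "norm v \<le> M * (A\<^sub>0 * \<gamma> * \<tau> powr (-\<kappa>))"
          by (simp add: v)
      qed
      have "continuous_on (UNIV \<times> {t. \<tau> < t \<and> ereal t < T}) (\<lambda>z. u (fst z) (snd z))"
        by (rule continuous_on_subset[of "UNIV \<times> {t. 0 < t \<and> ereal t < T}"])
           (use u \<tau> in \<open>auto simp: dominated_def\<close>)
      then show "continuous_on (UNIV \<times> {t. \<tau> < t \<and> ereal t < T}) (\<lambda>(x, t). u x t)"
        by (simp add: case_prod_beta)
    next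
      fix x :: "real ^ 'n" and t :: real assume t: "0 < t" "ereal t < T"
      \<comment> \<open>For s < t the time t - s is positive, so the iterated derivatives are the
        Fourier integrals; s < T makes \<open>nonlin u\<close> the true nonlinearity.\<close>
      have K: "multi_deriv \<alpha> (\<lambda>z. heat_kernel d z (t - s)) (x - y) * power_nonlinearity p (u y s) =
          kernel_deriv d \<alpha> (x - y) (t - s) * nonlin u (y, s)" if "s \<in> {0<..<t}" for \<alpha> y s
      proof -
        have "ereal s < T" using that t(2) by (auto intro: less_trans[of _ "ereal t"])
        then show ?thesis
          using multi_deriv_heat_kernel[of d "t - s" \<alpha>] that d by (simp add: nonlin_def)
      qed
      have D: "indicator (UNIV \<times> {0<..<t}) z *\<^sub>R (\<lambda>(y, s). multi_deriv \<alpha> (\<lambda>z. heat_kernel d z (t - s)) (x - y) *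
          power_nonlinearity p (u y s)) z = duhamel_integrand (kernel_deriv d \<alpha>) (nonlin u) x t z" for \<alpha> z
        using K[of "snd z" \<alpha> "fst z"] by (cases z) (auto simp: duhamel_integrand_def indicator_def)
      have L: "AE y in lebesgue. heat_kernel d (x - y) t * \<phi> y = G (x - y) t * \<psi> y"
        using \<psi>(2) by eventually_elim (simp add: heat_kernel_eq G_def)
      have m\<psi>: "(\<lambda>y. G (x - y) t * \<psi> y) \<in> borel_measurable borel"
        by (rule measurable_linear_integrand[OF G t(1)])
      have m\<phi>: "(\<lambda>y. heat_kernel d (x - y) t * \<phi> y) \<in> borel_measurable lebesgue"
      proof -
        have "(\<lambda>y. G (x - y) t) \<in> borel_measurable lebesgue"
          using measurable_singular_kernel_slice[OF G t(1), of x] by (intro measurable_completion) simp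
        then show ?thesis
          unfolding heat_kernel_eq G_def[symmetric] using m by (rule borel_measurable_times)
      qed
      have i\<psi>: "integrable lebesgue (\<lambda>y. G (x - y) t * \<psi> y)"
        using integrable_linear[OF G t, of x] m\<psi> by (simp add: integrable_completion)
      then show "integrable lebesgue (\<lambda>y. heat_kernel d (x - y) t * \<phi> y)"
        using integrable_cong_AE[OF m\<phi> _ L] by auto
      show "set_integrable lborel (UNIV \<times> {0<..<t}) (\<lambda>(y, s).
          multi_deriv \<alpha> (\<lambda>z. heat_kernel d z (t - s)) (x - y) * power_nonlinearity p (u y s))"
        if "\<alpha> \<in> multi_indices l" for \<alpha>
        unfolding set_integrable_def D using integrable_duhamel[OF C[OF that] src t] .
      have "(LINT y|lebesgue. heat_kernel d (x - y) t * \<phi> y) = (LINT y|lebesgue. G (x - y) t * \<psi> y)"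
        using m\<phi> i\<psi> L by (intro integral_cong_AE) auto
      also have "\<dots> = linear_part G x t"
        unfolding linear_part_def using m\<psi> by (intro integral_completion) auto
      finally have lin: "(LINT y|lebesgue. heat_kernel d (x - y) t * \<phi> y) = linear_part G x t" .
      have duh: "(LINT s:{0<..<t}|lborel. LINT y|lborel. multi_deriv \<alpha> (\<lambda>z. heat_kernel d z (t - s)) (x - y) *
          power_nonlinearity p (u y s)) = duhamel (kernel_deriv d \<alpha>) (nonlin u) x t" if "\<alpha> \<in> ?I" for \<alpha>
        unfolding set_lebesgue_integral_def duhamel_iterated[OF C[OF that] src t]
      proof (intro Bochner_Integration.integral_cong refl)
        fix s
        show "indicator {0<..<t} s *\<^sub>R (LINT y|lborel. multi_deriv \<alpha> (\<lambda>z. heat_kernel d z (t - s)) (x - y) *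
          power_nonlinearity p (u y s)) = (LINT y|lborel. duhamel_integrand (kernel_deriv d \<alpha>) (nonlin u) x t (y, s))"
          by (cases "s \<in> {0<..<t}") (simp_all add: K duhamel_integrand_def)
      qed
      have "u x t = linear_part G x t + duhamel H (nonlin u) x t"
        unfolding u_def by (rule picard_limit_fixed_point[OF t])
      also have "duhamel H (nonlin u) x t = (\<Sum>\<alpha>\<in>?I. a \<alpha> * duhamel (kernel_deriv d \<alpha>) (nonlin u) x t)"
        unfolding H_def[abs_def] using C by (intro duhamel_sum[OF finite_multi_indices _ src t]) auto
      finally show "u x t = (LINT y|lebesgue. heat_kernel d (x - y) t * \<phi> y) +
          (\<Sum>\<alpha>\<in>multi_indices l. a \<alpha> *
             (LINT s:{0<..<t}|lborel. LINT y|lborel.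
                multi_deriv \<alpha> (\<lambda>z. heat_kernel d z (t - s)) (x - y) * power_nonlinearity p (u y s)))"
        unfolding lin by (simp add: duh)
    qed
    then show "\<exists>u. is_solution d l a p \<phi> T u" by blast
  qed
qed

end
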